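(* Let $\delta:\mathbb{N}_0\to\mathbb{Q}$ be defined by $\delta(n)=\tfrac14\,\#\{(x,y)\in\mathbb{Z}\times\mathbb{Z} : x^2+y^2=n\}$. Then, as $x\to\infty$, \[ \max_{n\le x}\log \delta(\delta(n)) = \frac{\sqrt{\log x}}{\log_2 x}\left(\frac{c}{\sqrt 2}+\mathcal{O}\!\left(\frac{\log_3 x}{\log_2 x}\right)\right), \qquad c=\left(8\sum_{l=1}^{\infty}\left(\log\left(1+\frac1l\right)\right)^2\right)^{1/2}. \]
   Context: $\log$ is the natural logarithm and $\log_k$ denotes the $k$-fold iterated natural logarithm ($\log_2 x=\log\log x$, $\log_3 x=\log\log\log x$). The maximum is over positive integers $n\le x$. Note $\delta$ is a positive integer for $n\ge1$ with $x^2+y^2=n$ solvable, $\delta(n)=0$ otherwise for $n\geq 1$, and $\delta(0)=1/4$. *)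

theory Defs
  imports Complex_Main "HOL-Library.Landau_Symbols"
begin

definition delta :: "nat \<Rightarrow> rat" where
  "delta n = (1 / 4) * of_nat (card {(x :: int, y :: int). x\<^sup>2 + y\<^sup>2 = int n})"

text \<open>
  The iterate \<open>\<delta>(\<delta>(n))\<close>. For \<open>n \<ge> 1\<close> the rational number \<open>\<delta>(n)\<close> is a
  natural number, and \<open>nat \<lfloor>delta n\<rfloor>\<close> is that natural number; see
  \<open>delta_eq_of_nat\<close> below. Since \<open>\<delta>(0) = 1/4\<close>, the value of \<open>delta_delta 0\<close> is
  meaningless.
\<close>

definition delta_delta :: "nat \<Rightarrow> rat" where
  "delta_delta n = delta (nat \<lfloor>delta n\<rfloor>)"

lemma finite_sum_two_squares:
  "finite {(x :: int, y :: int). x\<^sup>2 + y\<^sup>2 = int n}"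
proof (rule finite_subset)
  have bound: "\<bar>x\<bar> \<le> int n" if "x\<^sup>2 \<le> int n" for x :: int
  proof -
    have "\<bar>x\<bar> \<le> \<bar>x\<bar> ^ 2"
    proof (cases "x = 0")
      case False
      then show ?thesis
        by (intro self_le_power) auto
    qed simp
    then show ?thesis
      using that by simp
  qed
  show "{(x :: int, y :: int). x\<^sup>2 + y\<^sup>2 = int n} \<subseteq> {- int n..int n} \<times> {- int n..int n}"
  proof clarify
    fix x y :: int
    assume eq: "x\<^sup>2 + y\<^sup>2 = int n"
    have "x\<^sup>2 \<ge> 0" "y\<^sup>2 \<ge> 0"
      by simp_all
    with eq have "x\<^sup>2 \<le> int n" "y\<^sup>2 \<le> int n"
      by linarith+
    from this[THEN bound] show "x \<in> {- int n..int n} \<and> y \<in> {- int n..int n}"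
      by auto
  qed
qed simp

lemma delta_eq_of_nat:
  assumes "n \<ge> 1"
  shows "delta n = of_nat (nat \<lfloor>delta n\<rfloor>)"
proof -
  define S where "S = {(x :: int, y :: int). x\<^sup>2 + y\<^sup>2 = int n}"
  define A where "A = {(x, y). (x, y) \<in> S \<and> x > 0 \<and> y \<ge> 0}"
  define B where "B = {(x, y). (x, y) \<in> S \<and> y > 0 \<and> x \<le> 0}"
  define C where "C = {(x, y). (x, y) \<in> S \<and> x < 0 \<and> y \<le> 0}"
  define D where "D = {(x, y). (x, y) \<in> S \<and> y < 0 \<and> x \<ge> 0}"
  note defs = S_def A_def B_def C_def D_def
  have fin: "finite S"
    unfolding S_def by (rule finite_sum_two_squares)
  then have finABCD: "finite A" "finite B" "finite C" "finite D"
    by (auto intro!: finite_subset[OF _ fin] simp: A_def B_def C_def D_def)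
  have S: "S = (A \<union> B) \<union> (C \<union> D)"
  proof (intro equalityI subsetI)
    fix p assume p: "p \<in> S"
    then have "fst p \<noteq> 0 \<or> snd p \<noteq> 0"
      using assms by (auto simp: S_def)
    then show "p \<in> (A \<union> B) \<union> (C \<union> D)"
      using p by (cases p) (auto simp: A_def B_def C_def D_def)
  qed (auto simp: A_def B_def C_def D_def)
  have "bij_betw (\<lambda>(x, y). (- y, x)) A B"
    by (rule bij_betw_byWitness[where f' = "\<lambda>(x, y). (y, - x)"])
       (auto simp: defs add.commute)
  then have "card A = card B"
    by (rule bij_betw_same_card)
  moreover have "bij_betw (\<lambda>(x, y). (- x, - y)) A C"
    by (rule bij_betw_byWitness[where f' = "\<lambda>(x, y). (- x, - y)"])
       (auto simp: defs)
  then have "card A = card C"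
    by (rule bij_betw_same_card)
  moreover have "bij_betw (\<lambda>(x, y). (y, - x)) A D"
    by (rule bij_betw_byWitness[where f' = "\<lambda>(x, y). (- y, x)"])
       (auto simp: defs add.commute)
  then have "card A = card D"
    by (rule bij_betw_same_card)
  moreover have "card S = card (A \<union> B) + card (C \<union> D)"
    unfolding S using finABCD
    by (intro card_Un_disjoint) (auto simp: A_def B_def C_def D_def)
  moreover have "card (A \<union> B) = card A + card B"
    using finABCD by (intro card_Un_disjoint) (auto simp: A_def B_def)
  moreover have "card (C \<union> D) = card C + card D"
    using finABCD by (intro card_Un_disjoint) (auto simp: C_def D_def)
  ultimately have "card S = 4 * card A"
    by simp
  then have "delta n = of_nat (card A)"
    unfolding delta_def S_def by simp
  then show ?thesis
    by simp
qed

end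

theory Submission
  imports Defs "HOL-Number_Theory.Number_Theory" "HOL-Complex_Analysis.Complex_Analysis"
    "HOL-Probability.Probability" "HOL-Real_Asymp.Real_Asymp"
begin

text \<open>
  Let \<open>P\<close> be the set of primes congruent to \<open>1\<close> modulo \<open>4\<close> and \<open>X = log x\<close>. By Jacobi's theorem \<open>\<delta>(n)\<close>,
  if nonzero, is the product of \<open>v\<^sub>p(n) + 1\<close> over \<open>p \<in> P\<close>. Hence \<open>log \<delta>(\<delta>(n))\<close> is at most the sum of
  \<open>log (b\<^sub>q + 1)\<close> over \<open>q \<in> P\<close>, where \<open>b\<^sub>q\<close> is the multiplicity of \<open>q\<close> in \<open>\<delta>(n)\<close>, and each factor \<open>q\<close>
  of \<open>\<delta>(n)\<close> costs an exponent \<open>q - 1\<close> at some prime divisor \<open>p\<close> of \<open>n\<close>. Since \<open>log p\<close> is about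
  \<open>(log X)/2\<close> for all relevant \<open>p\<close>, one has to maximise \<open>\<Sum> log (b\<^sub>q + 1)\<close> subject to
  \<open>\<Sum> b\<^sub>q (q - 1) \<le> Y\<close> with \<open>Y\<close> about \<open>2 X / log X\<close>.

  Write \<open>\<ell>\<^sub>l = log (1 + 1/l)\<close>. Lagrangian duality bounds the maximum by
  \<open>(Y + \<Sum>\<^sub>l \<pi>\<^sub>1(T \<ell>\<^sub>l)) / T\<close> for every \<open>T\<close>, where \<open>\<pi>\<^sub>1(y)\<close> is the sum of \<open>y - q\<close> over the \<open>q \<in> P\<close>
  with \<open>q \<le> y\<close>, and the bound is attained by a greedy choice of the \<open>b\<^sub>q\<close> for a suitable \<open>T\<close>. Therefore only the integrated
  form \<open>\<pi>\<^sub>1(y) = y\<^sup>2 / (4 log y) (1 + O(1 / log y))\<close> of the prime number theorem for \<open>P\<close> is needed.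
  This form follows from the Dedekind zeta function \<open>\<zeta>(s) L(s, \<chi>\<^sub>4)\<close> of the Gaussian field: the 3-4-1
  inequality bounds its logarithmic derivative and the derivative of that by \<open>O(t\<^bsup>1/2\<^esup>)\<close> up to the
  line \<open>Re s = 1\<close>, and a Fourier argument on that line saves one logarithm.
\<close>

section \<open>Sums of two squares\<close>

text \<open>With \<open>X = ln x\<close>, the error \<open>ln (ln X) / ln X\<close> comes from
  \<open>ln p\<close> alone. The upper bound charges a prime base of \<open>n\<close> only
  \<open>ln y\<close> with \<open>y = sqrt X / (ln X) ^ 3\<close>, the lower bound charges it
  \<open>ln z\<close> with \<open>z = sqrt X * (ln X) ^ 5\<close>; both logarithms are
  \<open>(ln X) / 2 + O(ln (ln X))\<close>. The prime number theorem has to be at least as precise,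
  hence the relative error O(1 / log y); a bare asymptotic formula would only give o(1). The
  constant: let S be the sum of the squares of the logarithmic steps. The dual bound behaves like
  \<open>(2 X / T + T S / 2) / ln X\<close>, which is smallest at \<open>T = 2 sqrt (X / S)\<close>
  with the value \<open>2 sqrt (S X) / ln X\<close>, and \<open>c / sqrt 2 = 2 sqrt S\<close>. In
  the lower bound \<open>T\<close> is dictated by using up the budget, and AM-GM gives the same
  constant for that \<open>T\<close>. The obstacle in the dual bound is uniformity: the integrated
  prime count is evaluated at \<open>T\<close> times every step, also at arguments whose logarithm
  is far from \<open>ln T\<close>. An error term with the exponent 3/2 in the step interpolates
  between these ranges and can still be summed over all steps.\<close>

definition sq_reps :: "nat \<Rightarrow> (int \<times> int) set" where
  "sq_reps n = {(x, y). x\<^sup>2 + y\<^sup>2 = int n}"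

definition primes_1mod4 :: "nat set" where
  "primes_1mod4 = {q. prime q \<and> q mod 4 = 1}"

lemma finite_sq_reps [simp]: "finite (sq_reps n)"
  unfolding sq_reps_def by (rule finite_sum_two_squares)

lemma delta_sq_reps: "delta n = of_nat (card (sq_reps n)) / 4"
  by (simp add: delta_def sq_reps_def)

section \<open>Representation counts under multiplication by a prime\<close>

lemma card_sq_reps_1: "card (sq_reps 1) = 4"
proof -
  have "sq_reps 1 = {(1,0),(-1,0),(0,1),(0,-1)}"
  proof (intro equalityI subsetI)
    fix z :: "int \<times> int" assume z: "z \<in> sq_reps 1"
    obtain x y where xy: "z = (x, y)" by (cases z)
    have e: "x\<^sup>2 + y\<^sup>2 = 1" using z xy by (simp add: sq_reps_def)
    have "x\<^sup>2 \<ge> 0" "y\<^sup>2 \<ge> 0" by auto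
    with e have "x\<^sup>2 = 0 \<and> y\<^sup>2 = 1 \<or> x\<^sup>2 = 1 \<and> y\<^sup>2 = 0" by linarith
    then have "x = 0 \<and> (y = 1 \<or> y = -1) \<or> (x = 1 \<or> x = -1) \<and> y = 0"
      by (auto simp: power2_eq_1_iff)
    then show "z \<in> {(1,0),(-1,0),(0,1),(0,-1)}" using xy by auto
  qed (auto simp: sq_reps_def)
  then show ?thesis by simp
qed

text \<open>The map sends \<open>x + i y\<close> to \<open>(1 + i) (x - i y)\<close>, and
  \<open>1 + i\<close> has norm 2. It can be inverted because \<open>x\<close> and \<open>y\<close>
  have the same parity when the sum of their squares is even.\<close>

lemma card_sq_reps_double: "card (sq_reps (2 * k)) = card (sq_reps k)"
proof -
  have "bij_betw (\<lambda>(x, y). (x + y, x - y)) (sq_reps k) (sq_reps (2 * k))"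
  proof (rule bij_betw_byWitness[where f' = "\<lambda>(x, y). ((x + y) div 2, (x - y) div 2)"])
    show "(\<lambda>(x, y). ((x + y) div 2, (x - y) div 2)) ` sq_reps (2 * k) \<subseteq> sq_reps k"
    proof clarify
      fix x y assume "(x, y) \<in> sq_reps (2 * k)"
      then have e: "x\<^sup>2 + y\<^sup>2 = 2 * int k" by (simp add: sq_reps_def)
      then have "even (x\<^sup>2 + y\<^sup>2)" by simp
      then have "even (x + y)" by simp
      then obtain a where a: "x + y = 2 * a" by (elim evenE)
      then have x: "x = 2 * a - y" by simp
      then have b: "x - y = 2 * (a - y)" by simp
      have "a\<^sup>2 + (a - y)\<^sup>2 = int k"
        using e unfolding x by (simp add: power2_eq_square algebra_simps)
      then show "((x + y) div 2, (x - y) div 2) \<in> sq_reps k"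
        unfolding a b by (simp add: sq_reps_def)
    qed
    have "(x + y) div 2 + (x - y) div 2 = x \<and> (x + y) div 2 - (x - y) div 2 = y"
      if "(x, y) \<in> sq_reps (2 * k)" for x y
    proof -
      from that have "x\<^sup>2 + y\<^sup>2 = 2 * int k" by (simp add: sq_reps_def)
      then have "even (x\<^sup>2 + y\<^sup>2)" by simp
      then have "even (x + y)" by simp
      then obtain a where a: "x + y = 2 * a" by (elim evenE)
      then have b: "x - y = 2 * (a - y)" by simp
      show ?thesis unfolding a b using a by simp
    qed
    then show "\<forall>a'\<in>sq_reps (2 * k). (\<lambda>(x, y). (x + y, x - y)) ((\<lambda>(x, y). ((x + y) div 2, (x - y) div 2)) a') = a'"
      by auto
  qed (auto simp: sq_reps_def power2_eq_square algebra_simps)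
  from bij_betw_same_card[OF this] show ?thesis by simp
qed

text \<open>-1 is not a square modulo \<open>p\<close>: raising \<open>x^2 = - y^2\<close> to the
  odd power \<open>h = (p - 1) / 2\<close> and applying Fermat's theorem to both sides would give 1
  = -1 modulo \<open>p\<close>.\<close>

lemma prime_3mod4_dvd_sum_squares:
  fixes x y :: int and p :: nat
  assumes "prime p" "p mod 4 = 3" "int p dvd x\<^sup>2 + y\<^sup>2"
  shows "int p dvd x \<and> int p dvd y"
proof (rule ccontr)
  assume neg: "\<not> (int p dvd x \<and> int p dvd y)"
  have pp: "prime (int p)" using assms by simp
  have dx: "int p dvd x \<longleftrightarrow> int p dvd x\<^sup>2" for x
    using pp by (simp add: prime_dvd_power_iff)
  have "int p dvd x \<longleftrightarrow> int p dvd y"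
    unfolding dx[of x] dx[of y] using assms(3)
    by (metis dvd_add_right_iff dvd_add_left_iff)
  with neg have nx: "\<not> int p dvd x" and ny: "\<not> int p dvd y" by auto
  define h where "h = (p - 1) div 2"
  have h: "p - 1 = 2 * h" "odd h" using assms(2) unfolding h_def by presburger+
  have f: "[z ^ (p - 1) = 1] (mod int p)" if "\<not> int p dvd z" for z :: int
  proof -
    have "[(nat (z mod p)) ^ (p - 1) = 1] (mod p)"
    proof (rule fermat_theorem[OF assms(1)])
      show "\<not> p dvd nat (z mod p)"
        using that prime_gt_0_nat[OF assms(1)]
        by (metis dvd_mod_iff int_dvd_int_iff int_nat_eq of_nat_0_less_iff pos_mod_sign dvd_refl)
    qed
    then have "[int ((nat (z mod p)) ^ (p - 1)) = int 1] (mod int p)"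
      using cong_int_iff by blast
    then have "[(z mod p) ^ (p - 1) = 1] (mod int p)"
      using prime_gt_0_nat[OF assms(1)] by simp
    moreover have "[(z mod int p) ^ (p - 1) = z ^ (p - 1)] (mod int p)"
      by (intro cong_pow) simp
    ultimately show ?thesis using cong_sym cong_trans by blast
  qed
  have "[x\<^sup>2 = - (y\<^sup>2)] (mod int p)" using assms(3) by (simp add: cong_iff_dvd_diff)
  then have "[(x\<^sup>2) ^ h = (- (y\<^sup>2)) ^ h] (mod int p)" by (rule cong_pow)
  then have "[x ^ (p - 1) = - (y ^ (p - 1))] (mod int p)"
    using h by (simp add: power_mult)
  moreover have "[- (y ^ (p - 1)) = - 1] (mod int p)"
    using f[OF ny] by (simp add: cong_minus_minus_iff)
  ultimately have "[1 = (- 1 :: int)] (mod int p)"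
    using f[OF nx] by (meson cong_sym cong_trans)
  then have "int p dvd 2" by (simp add: cong_iff_dvd_diff)
  then have "p dvd 2" by (metis int_dvd_int_iff of_nat_numeral)
  then have "p \<le> 2" by (simp add: dvd_imp_le)
  then show False using assms(2) by (cases "p = 0"; cases "p = 1"; cases "p=2") auto
qed

text \<open>Dividing both coordinates by \<open>p\<close> turns a representation of
  \<open>p * k\<close> into one of \<open>k / p\<close>. For inert primes this accounts for all
  representations, for split primes for those counted twice.\<close>

lemma card_sq_reps_dvd:
  assumes "p > 0"
  shows "card {(x, y) \<in> sq_reps (p * k). int p dvd x \<and> int p dvd y} = (if p dvd k then card (sq_reps (k div p)) else 0)"
    (is "card ?D = _")
proof (cases "p dvd k")
  case True
  then obtain j where j: "k = p * j" by (elim dvdE)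
  have eq: "(int p * a, int p * b) \<in> sq_reps (p * k) \<longleftrightarrow> (a, b) \<in> sq_reps j" for a b
  proof -
    have "(int p * a, int p * b) \<in> sq_reps (p * k) \<longleftrightarrow> (int p * int p) * (a\<^sup>2 + b\<^sup>2) = (int p * int p) * int j"
      unfolding j by (simp add: sq_reps_def power2_eq_square algebra_simps)
    also have "\<dots> \<longleftrightarrow> (a, b) \<in> sq_reps j" using assms by (simp add: sq_reps_def)
    finally show ?thesis .
  qed
  have "?D = (\<lambda>(x, y). (int p * x, int p * y)) ` sq_reps j"
    by (auto elim!: dvdE simp: eq)
  moreover have "inj_on (\<lambda>(x, y). (int p * x, int p * y)) (sq_reps j)"
    using assms by (auto simp: inj_on_def)
  ultimately have "card ?D = card (sq_reps j)" by (simp add: card_image)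
  then show ?thesis using True j assms by simp
next
  case False
  have "?D = {}"
  proof (rule ccontr)
    assume "?D \<noteq> {}"
    then obtain a b where ab: "(int p * a, int p * b) \<in> sq_reps (p * k)" by (auto elim!: dvdE)
    have "int p * (int p * (a\<^sup>2 + b\<^sup>2)) = int p * int k"
      using ab by (simp add: sq_reps_def power2_eq_square algebra_simps)
    then have "int p * (a\<^sup>2 + b\<^sup>2) = int k" using assms by simp
    then have "int p dvd int k" by (metis dvd_triv_left)
    then show False using False by simp
  qed
  then show ?thesis using False by (simp only: card.empty if_False)
qed

lemma card_sq_reps_3mod4:
  assumes "prime p" "p mod 4 = 3"
  shows "card (sq_reps (p * k)) = (if p dvd k then card (sq_reps (k div p)) else 0)"
proof -
  have dv: "int p dvd x \<and> int p dvd y" if "(x, y) \<in> sq_reps (p * k)" for x y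
  proof -
    have "int p dvd x\<^sup>2 + y\<^sup>2" using that by (simp add: sq_reps_def)
    then show ?thesis using prime_3mod4_dvd_sum_squares[OF assms] by blast
  qed
  then have "{(x, y) \<in> sq_reps (p * k). int p dvd x \<and> int p dvd y} = sq_reps (p * k)" by auto
  then show ?thesis using card_sq_reps_dvd[of p k] prime_gt_0_nat[OF assms(1)] by simp
qed

text \<open>Thue's argument. Euler's criterion gives a root \<open>z\<close> of -1 modulo
  \<open>p\<close>. There are more than \<open>p\<close> pairs in the square of side
  \<open>r = floor_sqrt p\<close>, so two of them agree in \<open>a - z b\<close> modulo
  \<open>p\<close>; the sum of the squares of their differences is a multiple of \<open>p\<close>
  strictly between 0 and \<open>2 p\<close>.\<close>

lemma prime_1mod4_sum_squares:
  assumes "p \<in> primes_1mod4"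
  obtains c d :: int where "c\<^sup>2 + d\<^sup>2 = int p"
proof -
  have p: "prime p" "p mod 4 = 1" using assms by (auto simp: primes_1mod4_def)
  have p2: "p > 2" using p prime_ge_2_nat[OF p(1)] by (cases "p = 2") auto
  have "even ((p - 1) div 2)" using p(2) by presburger
  then have "[Legendre (- 1) (int p) = 1] (mod int p)"
    using euler_criterion[OF p(1) p2, of "-1"] by simp
  moreover have "Legendre (- 1) (int p) \<in> {- 1, 0, 1}" by (simp add: Legendre_def)
  moreover have "\<not> [- 1 = 1] (mod int p)" "\<not> [0 = 1] (mod int p)"
    using p2 by (auto simp: cong_iff_dvd_diff dest: zdvd_imp_le)
  ultimately have "Legendre (- 1) (int p) = 1" by auto
  then have "QuadRes (int p) (- 1)" by (auto simp: Legendre_def split: if_splits)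
  then obtain z where z: "[z\<^sup>2 = - 1] (mod int p)" by (auto simp: QuadRes_def)
  define r where "r = floor_sqrt p"
  have r: "r\<^sup>2 \<le> p" "p < (Suc r)\<^sup>2"
    unfolding r_def using floor_sqrt_power2_le Suc_floor_sqrt_power2_gt by auto
  \<comment> \<open>Strictness matters: it excludes \<open>2 p\<close> as the value of
    \<open>c^2 + d^2\<close> below. A prime is not a perfect square.\<close>
  have r': "r\<^sup>2 < p"
  proof -
    have "r\<^sup>2 \<noteq> p" using p(1) by (metis prime_power_iff zero_neq_numeral numeral_eq_one_iff semiring_norm(85))
    with r show ?thesis by simp
  qed
  define A where "A = {0..int r} \<times> {0..int r}"
  define f where "f = (\<lambda>(a, b). (a - z * b) mod int p)"
  have "f ` A \<subseteq> {0..<int p}" using p2 by (auto simp: f_def)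
  then have "card (f ` A) \<le> p" using card_mono[of "{0..<int p}" "f ` A"] by simp
  also have "p < card A" using r(2) by (simp add: A_def power2_eq_square nat_add_distrib)
  finally have "\<not> inj_on f A" using pigeonhole by blast
  then obtain a b a' b' where ab: "(a,b) \<in> A" "(a',b') \<in> A" "(a,b) \<noteq> (a',b')" "f (a,b) = f (a',b')"
    unfolding inj_on_def by auto
  define c where "c = a - a'"
  define d where "d = b - b'"
  have "int p dvd (a - z * b) - (a' - z * b')"
    using ab(4) by (simp add: f_def mod_eq_dvd_iff)
  then have "int p dvd c - z * d" by (simp add: c_def d_def algebra_simps)
  then have "[c = z * d] (mod int p)" by (simp add: cong_iff_dvd_diff)
  then have "[c\<^sup>2 = (z * d)\<^sup>2] (mod int p)" by (rule cong_pow)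
  moreover have "[z\<^sup>2 * d\<^sup>2 = - 1 * d\<^sup>2] (mod int p)" using z by (rule cong_mult) simp
  ultimately have "[c\<^sup>2 = - d\<^sup>2] (mod int p)" 
    by (metis cong_trans power_mult_distrib mult_minus1)
  then have dvd: "int p dvd c\<^sup>2 + d\<^sup>2" by (simp add: cong_iff_dvd_diff)
  have bd: "u\<^sup>2 < int p" if "\<bar>u\<bar> \<le> int r" for u :: int
  proof -
    have "u\<^sup>2 \<le> (int r)\<^sup>2" using that by (metis abs_le_square_iff abs_of_nat)
    also have "\<dots> < int p" using r' by (metis of_nat_less_iff of_nat_power)
    finally show ?thesis .
  qed
  have lt: "c\<^sup>2 + d\<^sup>2 < 2 * int p"
  proof -
    have "\<bar>c\<bar> \<le> int r" "\<bar>d\<bar> \<le> int r" using ab by (auto simp: A_def c_def d_def)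
    then show ?thesis using bd[of c] bd[of d] by linarith
  qed
  have "c \<noteq> 0 \<or> d \<noteq> 0" using ab(3) by (auto simp: c_def d_def)
  then have gt: "c\<^sup>2 + d\<^sup>2 > 0" by (simp add: sum_power2_gt_zero_iff)
  from dvd obtain k where k: "c\<^sup>2 + d\<^sup>2 = int p * k" by (elim dvdE)
  have "k > 0" using gt k p2 by (simp add: zero_less_mult_iff)
  moreover have "k < 2" using lt k p2 by simp
  ultimately have "k = 1" by simp
  with k show ?thesis using that by simp
qed

text \<open>Let \<open>p\<close> be the norm of the Gaussian integer \<open>c + i d\<close>. Every
  element of norm \<open>p * k\<close> is divisible by \<open>c + i d\<close> (the set
  \<open>A\<close>) or by its conjugate (the set \<open>B\<close>). Division puts each set in
  bijection with the elements of norm \<open>k\<close>, and the overlap consists of the multiples of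
  \<open>p\<close>; inclusion-exclusion gives the recurrence.\<close>

lemma card_sq_reps_1mod4:
  assumes "p \<in> primes_1mod4"
  shows "card (sq_reps (p * k)) + (if p dvd k then card (sq_reps (k div p)) else 0) = 2 * card (sq_reps k)"
proof -
  have p: "prime p" "p mod 4 = 1" using assms by (auto simp: primes_1mod4_def)
  have pp: "prime (int p)" using p by simp
  have p0: "int p > 0" "p > 0" using p prime_gt_0_nat by auto
  have podd: "\<not> int p dvd 2"
  proof
    assume "int p dvd 2"
    then have "p dvd 2" by (metis int_dvd_int_iff of_nat_numeral)
    then have "p = 2" using p(1) primes_dvd_imp_eq two_is_prime_nat by blast
    then show False using p(2) by simp
  qed
  obtain c d :: int where cd: "c\<^sup>2 + d\<^sup>2 = int p" using prime_1mod4_sum_squares[OF assms] .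
  have nsq: "\<not> int p dvd u" if "u\<^sup>2 + v\<^sup>2 = int p" for u v :: int
  proof
    assume u: "int p dvd u"
    then have u2: "(int p)\<^sup>2 dvd u\<^sup>2" by simp
    have "int p dvd u\<^sup>2" using u by (simp add: power2_eq_square)
    then have "int p dvd v\<^sup>2" using that by (metis dvd_add_right_iff dvd_refl)
    then have "int p dvd v" using pp prime_dvd_power by blast
    then have "(int p)\<^sup>2 dvd v\<^sup>2" by simp
    with u2 have "(int p)\<^sup>2 dvd int p" using that dvd_add by metis
    then have "int p dvd 1" using p0 by (simp add: power2_eq_square)
    then show False using pp not_prime_unit by blast
  qed
  have nc: "\<not> int p dvd c" using nsq[OF cd] .
  have nd: "\<not> int p dvd d" using nsq[of d c] cd by (simp add: add.commute)
  define A where "A = {(x, y) \<in> sq_reps (p * k). int p dvd x * c + y * d}"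
  define B where "B = {(x, y) \<in> sq_reps (p * k). int p dvd x * c - y * d}"
  have fin: "finite A" "finite B" by (auto intro!: finite_subset[OF _ finite_sq_reps[of "p * k"]] simp: A_def B_def)
  have un: "A \<union> B = sq_reps (p * k)"
  proof -
    have "int p dvd x * c + y * d \<or> int p dvd x * c - y * d" if "(x, y) \<in> sq_reps (p * k)" for x y
    proof -
      have e: "x\<^sup>2 + y\<^sup>2 = int p * int k" using that by (simp add: sq_reps_def)
      have "(x * c + y * d) * (x * c - y * d) = x\<^sup>2 * (c\<^sup>2 + d\<^sup>2) - d\<^sup>2 * (x\<^sup>2 + y\<^sup>2)"
        by (simp add: power2_eq_square algebra_simps)
      also have "\<dots> = int p * (x\<^sup>2 - d\<^sup>2 * int k)" unfolding cd e by (simp add: algebra_simps)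
      finally have "int p dvd (x * c + y * d) * (x * c - y * d)" by simp
      then show ?thesis using pp by (simp add: prime_dvd_mult_iff)
    qed
    then show ?thesis by (auto simp: A_def B_def)
  qed
  have half: "card {(x, y) \<in> sq_reps (p * k). int p dvd x * u + y * v} = card (sq_reps k)"
    if uv: "u\<^sup>2 + v\<^sup>2 = int p" for u v :: int
  proof -
    \<comment> \<open>Divisibility by \<open>u + i v\<close> asks for both parts of
      \<open>(x + i y) (u - i v)\<close> to be multiples of \<open>p\<close>. The norm identity
      shows that the real part forces the imaginary part.\<close>
    have key: "int p dvd y * u - x * v" if "(x, y) \<in> sq_reps (p * k)" "int p dvd x * u + y * v" for x y
    proof -
      have e: "x\<^sup>2 + y\<^sup>2 = int p * int k" using that by (simp add: sq_reps_def)
      have "(y * u - x * v)\<^sup>2 = (x\<^sup>2 + y\<^sup>2) * (u\<^sup>2 + v\<^sup>2) - (x * u + y * v)\<^sup>2"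
        by (simp add: power2_eq_square algebra_simps)
      then have "int p dvd (y * u - x * v)\<^sup>2"
        using that(2) unfolding e uv by (simp add: power2_eq_square)
      then show ?thesis using pp prime_dvd_power by blast
    qed
    have "bij_betw (\<lambda>(a, b). (a * u - b * v, a * v + b * u)) (sq_reps k) {(x, y) \<in> sq_reps (p * k). int p dvd x * u + y * v}"
    proof (rule bij_betw_byWitness[where f' = "\<lambda>(x, y). ((x * u + y * v) div int p, (y * u - x * v) div int p)"])
      have i1: "(a * u - b * v) * u + (a * v + b * u) * v = int p * a"
        and i2: "(a * v + b * u) * u - (a * u - b * v) * v = int p * b" for a b
        unfolding uv[symmetric] by (simp_all add: power2_eq_square algebra_simps)
      show "\<forall>a\<in>sq_reps k. (\<lambda>(x, y). ((x * u + y * v) div int p, (y * u - x * v) div int p)) ((\<lambda>(a, b). (a * u - b * v, a * v + b * u)) a) = a"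
        using p0 by (auto simp: i1 i2)
      have i3: "(a * u - b * v)\<^sup>2 + (a * v + b * u)\<^sup>2 = int p * (a\<^sup>2 + b\<^sup>2)" for a b
        unfolding uv[symmetric] by (simp_all add: power2_eq_square algebra_simps)
      show "(\<lambda>(a, b). (a * u - b * v, a * v + b * u)) ` sq_reps k \<subseteq> {(x, y) \<in> sq_reps (p * k). int p dvd x * u + y * v}"
        by (auto simp: sq_reps_def i1 i3)
      have rep: "\<exists>a b. x * u + y * v = int p * a \<and> y * u - x * v = int p * b \<and> x = a * u - b * v \<and> y = a * v + b * u"
        if xy: "(x, y) \<in> sq_reps (p * k)" "int p dvd x * u + y * v" for x y
      proof -
        obtain a b where ab: "x * u + y * v = int p * a" "y * u - x * v = int p * b"
          using xy(2) key[OF xy] by (auto elim!: dvdE)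
        have "int p * x = (x * u + y * v) * u - (y * u - x * v) * v"
          unfolding uv[symmetric] by (simp add: power2_eq_square algebra_simps)
        also have "\<dots> = int p * (a * u - b * v)" unfolding ab by (simp add: algebra_simps)
        finally have "x = a * u - b * v" using p0 by simp
        have "int p * y = (x * u + y * v) * v + (y * u - x * v) * u"
          unfolding uv[symmetric] by (simp add: power2_eq_square algebra_simps)
        also have "\<dots> = int p * (a * v + b * u)" unfolding ab by (simp add: algebra_simps)
        finally have "y = a * v + b * u" using p0 by simp
        with \<open>x = _\<close> ab show ?thesis by blast
      qed
      have inv: "((x * u + y * v) div int p * u - (y * u - x * v) div int p * v, (x * u + y * v) div int p * v + (y * u - x * v) div int p * u) = (x, y)
          \<and> ((x * u + y * v) div int p, (y * u - x * v) div int p) \<in> sq_reps k"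
        if xy: "(x, y) \<in> sq_reps (p * k)" "int p dvd x * u + y * v" for x y
      proof -
        obtain a b where ab: "x * u + y * v = int p * a" "y * u - x * v = int p * b" "x = a * u - b * v" "y = a * v + b * u"
          using rep[OF xy] by blast
        have "int p * (a\<^sup>2 + b\<^sup>2) = int p * int k"
          using xy(1) by (simp add: sq_reps_def i3 ab(3,4))
        then have "a\<^sup>2 + b\<^sup>2 = int k" using p0 by simp
        then show ?thesis
          unfolding ab(1,2) using p0 ab(3,4) by (simp add: sq_reps_def)
      qed
      show "\<forall>a'\<in>{(x, y) \<in> sq_reps (p * k). int p dvd x * u + y * v}.
          (\<lambda>(a, b). (a * u - b * v, a * v + b * u)) ((\<lambda>(x, y). ((x * u + y * v) div int p, (y * u - x * v) div int p)) a') = a'"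
        using inv by auto
      show "(\<lambda>(x, y). ((x * u + y * v) div int p, (y * u - x * v) div int p)) ` {(x, y) \<in> sq_reps (p * k). int p dvd x * u + y * v} \<subseteq> sq_reps k"
        using inv by auto
    qed
    from bij_betw_same_card[OF this] show ?thesis by simp
  qed
  have cA: "card A = card (sq_reps k)" unfolding A_def using half[OF cd] .
  have cB: "card B = card (sq_reps k)" unfolding B_def using half[of c "-d"] cd by simp
  have dvd2: "int p dvd x \<and> int p dvd y" if "int p dvd x * c + y * d" "int p dvd x * c - y * d" for x y
  proof -
    have "int p dvd (x * c + y * d) + (x * c - y * d)" "int p dvd (x * c + y * d) - (x * c - y * d)"
      using that dvd_add dvd_diff by blast+
    then have "int p dvd 2 * (x * c)" "int p dvd 2 * (y * d)" by (simp_all add: algebra_simps)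
    then show ?thesis
      using pp podd nc nd by (auto simp: prime_dvd_mult_iff)
  qed
  have "(x, y) \<in> A \<inter> B \<longleftrightarrow> (x, y) \<in> sq_reps (p * k) \<and> int p dvd x \<and> int p dvd y" for x y
    unfolding A_def B_def mem_Collect_eq prod.case Int_iff using dvd2[of x y]
    by (meson dvd_add dvd_diff dvd_mult2)
  then have AB: "A \<inter> B = {(x, y) \<in> sq_reps (p * k). int p dvd x \<and> int p dvd y}"
    by (simp add: set_eq_iff)
  have cAB: "card (A \<inter> B) = (if p dvd k then card (sq_reps (k div p)) else 0)"
    unfolding AB using card_sq_reps_dvd[OF p0(2)] .
  have "card A + card B = card (A \<union> B) + card (A \<inter> B)" using fin by (rule card_Un_Int)
  then show ?thesis using cA cB cAB un by simp
qed

text \<open>The previous recurrence says that the second difference in \<open>a\<close> vanishes, so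
  the count is linear in \<open>a\<close>; the values at 0 and 1 fix it.\<close>

lemma card_sq_reps_power_1mod4:
  assumes "p \<in> primes_1mod4" "\<not> p dvd m"
  shows "card (sq_reps (p ^ a * m)) = (a + 1) * card (sq_reps m)"
proof (induction a rule: less_induct)
  case (less a)
  have p: "prime p" using assms by (simp add: primes_1mod4_def)
  then have p0: "p > 0" using prime_gt_0_nat by blast
  consider "a = 0" | "a = 1" | b where "a = Suc (Suc b)"
    by (metis One_nat_def not0_implies_Suc)
  then show ?case
  proof cases
    case 2
    then show ?thesis using card_sq_reps_1mod4[OF assms(1), of m] assms(2) by simp
  next
    case (3 b)
    have "p ^ Suc b * m div p = p ^ b * m" using p0 by (simp add: mult.assoc)
    then show ?thesis
      using card_sq_reps_1mod4[OF assms(1), of "p ^ Suc b * m"] less[of b] less[of "Suc b"] 3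
      by (simp add: mult.assoc algebra_simps)
  qed simp
qed

lemma card_sq_reps_power_2: "card (sq_reps (2 ^ a * m)) = card (sq_reps m)"
  by (induction a) (simp_all add: mult.assoc card_sq_reps_double)

lemma card_sq_reps_power_3mod4:
  assumes "prime p" "p mod 4 = 3" "\<not> p dvd m"
  shows "card (sq_reps (p ^ a * m)) = (if even a then card (sq_reps m) else 0)"
proof (induction a rule: less_induct)
  case (less a)
  then have p0: "p > 0" using assms prime_gt_0_nat by blast
  consider "a = 0" | "a = 1" | b where "a = Suc (Suc b)"
    by (metis One_nat_def not0_implies_Suc)
  then show ?case
  proof cases
    case 2
    then show ?thesis using card_sq_reps_3mod4[OF assms(1,2), of m] assms(3) by simp
  next
    case (3 b)
    have "p ^ Suc b * m div p = p ^ b * m" using p0 by (simp add: mult.assoc)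
    then show ?thesis
      using card_sq_reps_3mod4[OF assms(1,2), of "p ^ Suc b * m"] less[of b] 3
      by (simp add: mult.assoc)
  qed simp
qed

text \<open>The value of \<open>delta n\<close> whenever that is nonzero. Unlike
  \<open>delta\<close>, it ignores the obstruction from primes congruent to 3 modulo 4 and is always
  positive.\<close>

definition split_part :: "nat \<Rightarrow> nat" where
  "split_part n = (\<Prod>p\<in>{p \<in> prime_factors n. p mod 4 = 1}. multiplicity p n + 1)"

lemma split_part_mult_prime_power:
  assumes "prime p" "\<not> p dvd m" "a > 0" "m > 0"
  shows "split_part (p ^ a * m) = (if p mod 4 = 1 then (a + 1) * split_part m else split_part m)"
proof -
  have p0: "p > 0" using assms prime_gt_0_nat by blast
  have pf: "prime_factors (p ^ a * m) = insert p (prime_factors m)"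
    using assms p0 by (simp add: prime_factors_product prime_factors_power prime_prime_factors)
  have pm: "p \<notin> prime_factors m" using assms(2) by auto
  have mp: "multiplicity p (p ^ a * m) = a"
    using assms p0 by (simp add: prime_elem_multiplicity_mult_distrib not_dvd_imp_multiplicity_0)
  have mq: "multiplicity q (p ^ a * m) = multiplicity q m" if "q \<in> prime_factors m" for q
  proof -
    have "prime q" "q \<noteq> p" using that pm by (auto simp: in_prime_factors_iff)
    then show ?thesis using assms p0
      by (simp add: prime_elem_multiplicity_mult_distrib multiplicity_distinct_prime_power)
  qed
  have eq: "(\<Prod>q\<in>{q \<in> prime_factors m. q mod 4 = 1}. multiplicity q (p ^ a * m) + 1) = split_part m"
    unfolding split_part_def using mq by (intro prod.cong) auto
  show ?thesis
  proof (cases "p mod 4 = 1")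
    case True
    then have "{q \<in> prime_factors (p ^ a * m). q mod 4 = 1} = insert p {q \<in> prime_factors m. q mod 4 = 1}"
      using pf by auto
    then show ?thesis using True pm mp eq by (simp add: split_part_def)
  next
    case False
    then have "{q \<in> prime_factors (p ^ a * m). q mod 4 = 1} = {q \<in> prime_factors m. q mod 4 = 1}"
      using pf by auto
    then show ?thesis using False eq by (simp add: split_part_def)
  qed
qed

text \<open>One full prime power is removed at a time, according to the class of the prime modulo 4.
  The vanishing case carries a witness prime, so that it can be ruled out when all prime factors are
  1 modulo 4.\<close>

lemma card_sq_reps_eq_or_0:
  assumes "n > 0"
  shows "card (sq_reps n) = 4 * split_part n \<or>
     card (sq_reps n) = 0 \<and> (\<exists>p\<in>prime_factors n. p mod 4 = 3)"
  using assms
proof (induction n rule: less_induct)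
  case (less n)
  show ?case
  proof (cases "n = 1")
    case True
    then show ?thesis using card_sq_reps_1 by (simp add: split_part_def)
  next
    case False
    then obtain p where p: "prime p" "p dvd n" using prime_factor_nat by blast
    define a where "a = multiplicity p n"
    obtain m where m: "n = p ^ a * m" "\<not> p dvd m"
      using multiplicity_decompose'[of n p] less.prems p(1) unfolding a_def
      by (metis not_prime_unit bot_nat_0.not_eq_extremum)
    have a0: "a > 0" using p less.prems unfolding a_def
      by (simp add: prime_multiplicity_gt_zero_iff)
    have m0: "m > 0" using m less.prems by (cases m) auto
    have "p ^ a > 1" using a0 p(1) by (metis one_less_power prime_gt_1_nat)
    then have "m < n" using m0 m(1) by simp
    from less.IH[OF this m0] have IH: "card (sq_reps m) = 4 * split_part m \<or>
     card (sq_reps m) = 0 \<and> (\<exists>p\<in>prime_factors m. p mod 4 = 3)" .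
    have sub: "prime_factors m \<subseteq> prime_factors n"
      using m less.prems by (simp add: dvd_prime_factors)
    have pn: "p \<in> prime_factors n" using p less.prems by (simp add: in_prime_factors_iff)
    have sp: "split_part n = (if p mod 4 = 1 then (a + 1) * split_part m else split_part m)"
      unfolding m(1) by (rule split_part_mult_prime_power) (use p m a0 m0 in auto)
    have "\<not> 4 dvd p"
    proof
      assume "4 dvd p"
      then have "2 dvd p" by presburger
      then have "p = 2" using p(1) primes_dvd_imp_eq two_is_prime_nat by blast
      then show False using \<open>4 dvd p\<close> by simp
    qed
    then have "p mod 4 < 4" "p mod 4 \<noteq> 0" by (simp_all add: dvd_eq_mod_eq_0)
    moreover have "p = 2" if "p mod 4 = 2"
    proof -
      have "2 dvd p" using that by presburger
      then show ?thesis using p(1) primes_dvd_imp_eq two_is_prime_nat by blast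
    qed
    ultimately consider "p mod 4 = 1" | "p = 2" | "p mod 4 = 3" by linarith
    then show ?thesis
    proof cases
      case 1
      then have "card (sq_reps n) = (a + 1) * card (sq_reps m)"
        using card_sq_reps_power_1mod4[of p m a] p(1) m by (simp add: primes_1mod4_def)
      then show ?thesis using IH sp 1 sub by auto
    next
      case 2
      then have "card (sq_reps n) = card (sq_reps m)"
        using card_sq_reps_power_2[of a m] m by simp
      then show ?thesis using IH sp 2 sub by auto
    next
      case 3
      then have "card (sq_reps n) = (if even a then card (sq_reps m) else 0)"
        using card_sq_reps_power_3mod4[of p m a] p m by simp
      then show ?thesis using IH sp 3 sub pn by (auto split: if_splits)
    qed
  qed
qed

lemma delta_eq_split_part:
  assumes "n > 0" "delta n \<noteq> 0"
  shows "delta n = of_nat (split_part n)"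
  using card_sq_reps_eq_or_0[OF assms(1)] assms(2) by (auto simp: delta_sq_reps)

lemma delta_eq_split_part_1mod4:
  assumes "n > 0" "prime_factors n \<subseteq> primes_1mod4"
  shows "delta n = of_nat (split_part n)"
proof -
  have "\<not> (\<exists>p\<in>prime_factors n. p mod 4 = 3)"
    using assms(2) by (auto simp: primes_1mod4_def)
  then show ?thesis using card_sq_reps_eq_or_0[OF assms(1)] by (auto simp: delta_sq_reps)
qed

section \<open>Dirichlet series\<close>

text \<open>The summation starts at 0, but that term vanishes because 0 raised to any power by
  \<open>powr\<close> is 0.\<close>

definition dseries :: "(nat \<Rightarrow> real) \<Rightarrow> complex \<Rightarrow> complex" where
  "dseries a s = (\<Sum>n. of_real (a n) * of_nat n powr (- s))"

definition abs_conv_gt1 :: "(nat \<Rightarrow> real) \<Rightarrow> bool" where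
  "abs_conv_gt1 a \<longleftrightarrow> (\<forall>\<sigma>>1. summable (\<lambda>n. \<bar>a n\<bar> * real n powr (- \<sigma>)))"

lemma norm_nat_powr: "norm (of_nat n powr s :: complex) = real n powr Re s"
proof (cases "n = 0")
  case False
  then show ?thesis
    using norm_powr_real_powr[of "of_nat n" s] by simp
qed simp

lemma abs_conv_gt1_bound:
  assumes "\<And>n. n > 0 \<Longrightarrow> \<bar>a n\<bar> \<le> \<bar>b n\<bar>" "abs_conv_gt1 b"
  shows "abs_conv_gt1 a"
  unfolding abs_conv_gt1_def
proof (intro allI impI)
  fix \<sigma> :: real assume "\<sigma> > 1"
  then have "summable (\<lambda>n. \<bar>b n\<bar> * real n powr (- \<sigma>))" using assms(2) by (simp add: abs_conv_gt1_def)
  then show "summable (\<lambda>n. \<bar>a n\<bar> * real n powr (- \<sigma>))"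
  proof (rule summable_comparison_test'[where N = 0])
    fix n :: nat show "norm (\<bar>a n\<bar> * real n powr (- \<sigma>)) \<le> \<bar>b n\<bar> * real n powr (- \<sigma>)"
      using assms(1)[of n] by (cases "n = 0") (auto intro!: mult_right_mono)
  qed
qed

lemma abs_conv_gt1_const: "abs_conv_gt1 (\<lambda>_. c)"
  unfolding abs_conv_gt1_def by (auto intro!: summable_mult simp: summable_real_powr_iff)

text \<open>The logarithm is absorbed by \<open>n powr d\<close>, where \<open>d\<close> is half the
  distance of the exponent from 1.\<close>

lemma abs_conv_gt1_ln:
  assumes "abs_conv_gt1 a"
  shows "abs_conv_gt1 (\<lambda>n. a n * ln (real n))"
  unfolding abs_conv_gt1_def
proof (intro allI impI)
  fix \<sigma> :: real assume s: "\<sigma> > 1"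
  define d where "d = (\<sigma> - 1) / 2"
  have d: "d > 0" "\<sigma> - d > 1" using s by (auto simp: d_def field_simps)
  have "summable (\<lambda>n. \<bar>a n\<bar> * real n powr (- (\<sigma> - d)) / d)"
    using assms d(2) unfolding abs_conv_gt1_def by (intro summable_divide) blast
  then show "summable (\<lambda>n. \<bar>a n * ln (real n)\<bar> * real n powr (- \<sigma>))"
  proof (rule summable_comparison_test'[where N = 0])
    fix n :: nat
    show "norm (\<bar>a n * ln (real n)\<bar> * real n powr (- \<sigma>)) \<le> \<bar>a n\<bar> * real n powr (- (\<sigma> - d)) / d"
    proof (cases "n = 0")
      case False
      have "ln (real n) \<le> real n powr d / d" using ln_powr_bound[of "real n" d] d False by simp
      moreover have "ln (real n) \<ge> 0" using False by simp
      ultimately have "\<bar>ln (real n)\<bar> * real n powr (- \<sigma>) \<le> real n powr d / d * real n powr (- \<sigma>)"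
        by (intro mult_right_mono) auto
      also have "\<dots> = real n powr (- (\<sigma> - d)) / d" by (simp add: powr_diff powr_minus field_simps)
      finally have "\<bar>a n\<bar> * (\<bar>ln (real n)\<bar> * real n powr (- \<sigma>)) \<le> \<bar>a n\<bar> * (real n powr (- (\<sigma> - d)) / d)"
        by (rule mult_left_mono) simp
      then show ?thesis by (simp add: abs_mult mult.assoc)
    qed simp
  qed
qed

lemma abs_conv_gt1_add:
  assumes "abs_conv_gt1 a" "abs_conv_gt1 b"
  shows "abs_conv_gt1 (\<lambda>n. a n + b n)"
proof -
  have "abs_conv_gt1 (\<lambda>n. \<bar>a n\<bar> + \<bar>b n\<bar>)"
    unfolding abs_conv_gt1_def
    using assms by (auto simp: abs_conv_gt1_def distrib_right intro!: summable_add)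
  then show ?thesis by (rule abs_conv_gt1_bound[rotated]) auto
qed

lemma nat_mult_powr: "of_nat (m * n) powr s = of_nat m powr s * (of_nat n powr s :: complex)"
  using powr_times_real[of "of_nat m" "of_nat n" s] by simp

lemma norm_dterm: "norm (complex_of_real (a n) * of_nat n powr (- s)) = \<bar>a n\<bar> * real n powr (- Re s)"
  by (simp add: norm_mult norm_nat_powr)

lemma dseries_summable:
  assumes "abs_conv_gt1 a" "Re s > 1"
  shows "summable (\<lambda>n. norm (complex_of_real (a n) * of_nat n powr (- s)))"
  using assms unfolding norm_dterm abs_conv_gt1_def by blast

lemma dseries_sums:
  assumes "abs_conv_gt1 a" "Re s > 1"
  shows "(\<lambda>n. complex_of_real (a n) * of_nat n powr (- s)) sums dseries a s"
  unfolding dseries_def by (rule summable_sums[OF summable_norm_cancel[OF dseries_summable[OF assms]]])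

lemma dseries_has_sum:
  assumes "abs_conv_gt1 a" "Re s > 1"
  shows "((\<lambda>n. complex_of_real (a n) * of_nat n powr (- s)) has_sum dseries a s) UNIV"
  by (rule norm_summable_imp_has_sum[OF dseries_summable[OF assms] dseries_sums[OF assms]])

lemma dseries_add:
  assumes "abs_conv_gt1 a" "abs_conv_gt1 b" "Re s > 1"
  shows "dseries (\<lambda>n. a n + b n) s = dseries a s + dseries b s"
  using sums_add[OF dseries_sums[OF assms(1,3)] dseries_sums[OF assms(2,3)]]
  unfolding dseries_def[of "\<lambda>n. a n + b n"] by (simp add: sums_iff distrib_right)

lemma dseries_minus:
  assumes "abs_conv_gt1 a" "Re s > 1"
  shows "dseries (\<lambda>n. - a n) s = - dseries a s"
  using sums_minus[OF dseries_sums[OF assms(1,2)]]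
  unfolding dseries_def[of "\<lambda>n. - a n"] by (simp add: sums_iff)

text \<open>Termwise differentiation. On the disc around a point whose radius is half the distance
  to the line \<open>Re s = 1\<close>, the series is dominated by its absolute values at the left
  end of the disc.\<close>

lemma dseries_deriv:
  assumes "abs_conv_gt1 a" "Re s > 1"
  shows "(dseries a has_field_derivative - dseries (\<lambda>n. a n * ln (real n)) s) (at s)"
proof -
  define S where "S = {s. Re s > 1}"
  have S: "open S" unfolding S_def by (rule open_halfspace_Re_gt)
  define f where "f = (\<lambda>n (s::complex). complex_of_real (a n) * of_nat n powr (- s))"
  define f' where "f' = (\<lambda>n (s::complex). - (complex_of_real (a n * ln (real n)) * of_nat n powr (- s)))"
  have "\<exists>g g'. \<forall>x\<in>S. ((\<lambda>n. f n x) sums g x) \<and> ((\<lambda>n. f' n x) sums g' x) \<and> (g has_field_derivative g' x) (at x)"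
  proof (rule series_and_derivative_comparison_local[OF S])
    fix n x assume "x \<in> S"
    show "(f n has_field_derivative f' n x) (at x)"
    proof (cases "n = 0")
      case False
      have "Ln (of_nat n) = of_real (ln (real n))" using False Ln_of_real[of "real n"] by simp
      then show ?thesis unfolding f_def f'_def powr_def
        using False by (auto intro!: derivative_eq_intros)
    qed (simp add: f_def f'_def)
  next
    fix x assume x: "x \<in> S"
    define d where "d = (Re x - 1) / 2"
    have d: "d > 0" "Re x - d > 1" using x by (auto simp: S_def d_def field_simps)
    have "summable (\<lambda>n. \<bar>a n\<bar> * real n powr (- (Re x - d)))"
      using assms(1) d(2) unfolding abs_conv_gt1_def by blast
    moreover have "norm (f n y) \<le> \<bar>a n\<bar> * real n powr (- (Re x - d))" if "y \<in> ball x d" for n y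
    proof (cases "n = 0")
      case False
      have "\<bar>Re x - Re y\<bar> \<le> norm (x - y)" using abs_Re_le_cmod[of "x - y"] by simp
      then have "Re y \<ge> Re x - d" using that by (auto simp: dist_norm)
      then show ?thesis unfolding f_def norm_dterm
        using False by (intro mult_left_mono powr_mono) auto
    qed (simp add: f_def)
    ultimately show "\<exists>d h. 0 < d \<and> summable h \<and> (\<forall>\<^sub>F n in sequentially. \<forall>y\<in>ball x d \<inter> S. cmod (f n y) \<le> h n)"
      using d(1) by (intro exI[of _ d] exI[of _ "\<lambda>n. \<bar>a n\<bar> * real n powr (- (Re x - d))"]) auto
  qed
  then obtain g g' where g: "\<And>x. x \<in> S \<Longrightarrow> (\<lambda>n. f n x) sums g x"
    "\<And>x. x \<in> S \<Longrightarrow> (\<lambda>n. f' n x) sums g' x" "\<And>x. x \<in> S \<Longrightarrow> (g has_field_derivative g' x) (at x)"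
    by metis
  have s: "s \<in> S" using assms by (simp add: S_def)
  have eq: "dseries a x = g x" if "x \<in> S" for x
    using g(1)[OF that] unfolding dseries_def f_def by (simp add: sums_iff)
  have "g' s = - dseries (\<lambda>n. a n * ln (real n)) s"
    using g(2)[OF s] sums_minus[OF dseries_sums[OF abs_conv_gt1_ln[OF assms(1)] assms(2)]]
    unfolding f'_def by (rule sums_unique2)
  then have "(g has_field_derivative - dseries (\<lambda>n. a n * ln (real n)) s) (at s)"
    using g(3)[OF s] by simp
  then show ?thesis
    by (rule has_field_derivative_transform_within_open[OF _ S s]) (simp add: eq)
qed

lemma mangoldt_le_ln: "n > 0 \<Longrightarrow> \<bar>mangoldt n :: real\<bar> \<le> \<bar>ln (real n)\<bar>"
  using mangoldt_le[of n] mangoldt_nonneg[of n] by simp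

lemma abs_conv_gt1_mangoldt:
  assumes "\<And>n. \<bar>f n\<bar> \<le> (1::real)"
  shows "abs_conv_gt1 (\<lambda>n. f n * mangoldt n)"
proof (rule abs_conv_gt1_bound)
  show "abs_conv_gt1 (\<lambda>n. 1 * ln (real n))" by (intro abs_conv_gt1_ln abs_conv_gt1_const)
  show "\<bar>f n * mangoldt n\<bar> \<le> \<bar>1 * ln (real n)\<bar>" if "n > 0" for n
    using mult_mono[OF assms[of n] mangoldt_le_ln[OF that]] mangoldt_nonneg[of n] by (simp add: abs_mult)
qed

lemma abs_conv_gt1_le_1: "(\<And>n. \<bar>f n\<bar> \<le> 1) \<Longrightarrow> abs_conv_gt1 f"
  by (rule abs_conv_gt1_bound[OF _ abs_conv_gt1_const[of 1]]) auto

lemma summable_on_product_norm: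
  fixes F G :: "nat \<Rightarrow> complex"
  assumes "(\<lambda>x. norm (F x)) summable_on UNIV" "(\<lambda>x. norm (G x)) summable_on UNIV"
  shows "(\<lambda>(x, y). F x * G y) summable_on UNIV \<times> UNIV"
proof -
  have "(\<lambda>z. norm (case z of (x, y) \<Rightarrow> F x * G y)) summable_on UNIV \<times> UNIV"
    unfolding Infinite_Sum.abs_summable_on_Sigma_iff using assms
    by (auto simp: norm_mult infsum_cmult_right' abs_mult abs_of_nonneg[OF infsum_nonneg] intro!: summable_on_cmult_left summable_on_cmult_right)
  then show ?thesis by (rule abs_summable_summable)
qed

text \<open>The identity that the von Mangoldt function summed over the divisors of \<open>n\<close>
  is \<open>ln n\<close>, twisted by a completely multiplicative \<open>f\<close>. Absolute
  convergence of the double series permits regrouping it by the product of the two indices.\<close>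

lemma dseries_mangoldt_conv:
  assumes mult: "\<And>m n. f (m * n) = f m * f n" and bd: "\<And>n. \<bar>f n\<bar> \<le> (1::real)" and s: "Re s > 1"
  shows "dseries (\<lambda>n. f n * mangoldt n) s * dseries f s = dseries (\<lambda>n. f n * ln (real n)) s"
proof -
  have af: "abs_conv_gt1 f" by (rule abs_conv_gt1_le_1[of f, OF bd])
  have ag: "abs_conv_gt1 (\<lambda>n. f n * mangoldt n)" by (rule abs_conv_gt1_mangoldt[of f, OF bd])
  define F where "F = (\<lambda>n. complex_of_real (f n) * of_nat n powr (- s))"
  define G where "G = (\<lambda>n. complex_of_real (f n * mangoldt n) * of_nat n powr (- s))"
  have F: "(F has_sum dseries f s) UNIV" unfolding F_def by (rule dseries_has_sum[OF af s])
  have G: "(G has_sum dseries (\<lambda>n. f n * mangoldt n) s) UNIV" unfolding G_def by (rule dseries_has_sum[OF ag s])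
  have Fa: "(\<lambda>x. norm (F x)) summable_on UNIV" unfolding F_def
    using dseries_summable[OF af s] by (auto intro!: norm_summable_imp_summable_on)
  have Ga: "(\<lambda>x. norm (G x)) summable_on UNIV" unfolding G_def
    using dseries_summable[OF ag s] by (auto intro!: norm_summable_imp_summable_on)
  have sm: "(\<lambda>(x, y). G x * F y) summable_on UNIV \<times> UNIV"
    by (rule summable_on_product_norm[OF Ga Fa])
  have "((\<lambda>(x, y). G x * F y) has_sum dseries (\<lambda>n. f n * mangoldt n) s * dseries f s) (UNIV \<times> UNIV)"
  proof (rule has_sum_SigmaI[OF _ _ sm])
    show "((\<lambda>y. case (x, y) of (x, y) \<Rightarrow> G x * F y) has_sum G x * dseries f s) UNIV" for x
      using has_sum_cmult_right[OF F] by simp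
    show "((\<lambda>x. G x * dseries f s) has_sum dseries (\<lambda>n. f n * mangoldt n) s * dseries f s) UNIV"
      by (rule has_sum_cmult_left[OF G])
  qed
  also have "?this \<longleftrightarrow> ((\<lambda>(x, y). G x * F y) has_sum dseries (\<lambda>n. f n * mangoldt n) s * dseries f s) ({0<..} \<times> {0<..})"
    by (rule has_sum_cong_neutral) (auto simp: F_def G_def)
  also have "\<dots> \<longleftrightarrow> ((\<lambda>(n, d). of_real (f n) * of_nat n powr (- s) * of_real (mangoldt d)) has_sum dseries (\<lambda>n. f n * mangoldt n) s * dseries f s)
      (Sigma {0<..} (\<lambda>n. {d. d dvd n}))"
  proof (rule has_sum_reindex_bij_witness[where i = "\<lambda>(n, d). (d, n div d)" and j = "\<lambda>(d, m). (d * m, d)"])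
    show "(case case a of (d, m) \<Rightarrow> (d * m, d) of (n, d) \<Rightarrow> complex_of_real (f n) * of_nat n powr - s * complex_of_real (mangoldt d)) =
         (case a of (x, y) \<Rightarrow> G x * F y)" if "a \<in> {0<..} \<times> {0<..}" for a
      using that by (auto simp: F_def G_def mult nat_mult_powr simp del: of_nat_mult)
  qed (auto elim!: dvdE)
  finally have "((\<lambda>n. \<Sum>d | d dvd n. of_real (f n) * of_nat n powr (- s) * of_real (mangoldt d)) has_sum dseries (\<lambda>n. f n * mangoldt n) s * dseries f s) {0<..}"
    by (rule has_sum_SigmaD) (auto intro!: has_sum_finite)
  also have "?this \<longleftrightarrow> ((\<lambda>n. complex_of_real (f n * ln (real n)) * of_nat n powr (- s)) has_sum dseries (\<lambda>n. f n * mangoldt n) s * dseries f s) UNIV"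
  proof (rule has_sum_cong_neutral)
    fix n :: nat assume "n \<in> {0<..} \<inter> UNIV"
    then have "(\<Sum>d | d dvd n. complex_of_real (mangoldt d)) = of_real (ln (real n))"
      using mangoldt_sum[of n, where ?'a = complex] by simp
    then show "(\<Sum>d | d dvd n. of_real (f n) * of_nat n powr (- s) * of_real (mangoldt d)) = complex_of_real (f n * ln (real n)) * of_nat n powr (- s)"
      by (simp only: flip: sum_distrib_left) (simp add: mult_ac)
  qed auto
  finally show ?thesis
    by (rule has_sum_unique[OF _ dseries_has_sum[OF abs_conv_gt1_ln[OF af] s]])
qed

lemma abs_conv_gt1_mangoldt_div_ln:
  assumes "\<And>n. \<bar>f n\<bar> \<le> (1::real)"
  shows "abs_conv_gt1 (\<lambda>n. f n * mangoldt n / ln (real n))"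
proof (rule abs_conv_gt1_le_1)
  fix n :: nat
  consider "n = 0" | "n = 1" | "n \<ge> 2" by linarith
  then show "\<bar>f n * mangoldt n / ln (real n)\<bar> \<le> 1"
  proof cases
    case 3
    have "\<bar>f n * mangoldt n\<bar> \<le> \<bar>ln (real n)\<bar>"
      using mult_mono[OF assms[of n] mangoldt_le_ln[of n]] mangoldt_nonneg[of n] 3 by (simp add: abs_mult)
    then show ?thesis using 3 by (simp add: abs_divide divide_simps)
  qed auto
qed

text \<open>The quotient of the two sides has derivative 0 on a convex half-plane, so it is
  constant. This yields the logarithm without an Euler product; the constant stays unidentified, and
  later uses only ask that it is nonzero.\<close>

lemma dseries_exp_log:
  assumes mult: "\<And>m n. f (m * n) = f m * f n" and bd: "\<And>n. \<bar>f n\<bar> \<le> (1::real)"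
  shows "\<exists>K. \<forall>s. Re s > 1 \<longrightarrow> dseries f s = K * exp (dseries (\<lambda>n. f n * mangoldt n / ln (real n)) s)"
proof -
  define b where "b = (\<lambda>n. f n * mangoldt n / ln (real n))"
  have ab: "abs_conv_gt1 b" unfolding b_def by (rule abs_conv_gt1_mangoldt_div_ln[OF bd])
  \<comment> \<open>At \<open>n = 1\<close> the quotient is a division by \<open>ln 1 = 0\<close>;
    the identity survives because the von Mangoldt function vanishes there.\<close>
  have bl: "b n * ln (real n) = f n * mangoldt n" for n
  proof -
    consider "n = 0" | "n = 1" | "n \<ge> 2" by linarith
    then show ?thesis by cases (auto simp: b_def)
  qed
  define h where "h = (\<lambda>s. dseries f s * exp (- dseries b s))"
  have d: "(h has_field_derivative 0) (at s within {s. Re s > 1})" if "s \<in> {s. Re s > 1}" for s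
  proof -
    have s: "Re s > 1" using that by simp
    have "(h has_field_derivative - dseries (\<lambda>n. f n * ln (real n)) s * exp (- dseries b s)
          + dseries f s * (exp (- dseries b s) * dseries (\<lambda>n. b n * ln (real n)) s)) (at s)"
      unfolding h_def
      by (rule derivative_eq_intros refl dseries_deriv ab abs_conv_gt1_le_1 bd s | simp)+
    moreover have "- dseries (\<lambda>n. f n * ln (real n)) s * exp (- dseries b s)
          + dseries f s * (exp (- dseries b s) * dseries (\<lambda>n. b n * ln (real n)) s) = 0"
      unfolding bl dseries_mangoldt_conv[of f s, OF mult bd s, symmetric] by (simp add: algebra_simps)
    ultimately have "(h has_field_derivative 0) (at s)" by (simp only:)
    then show ?thesis by (rule has_field_derivative_at_within)
  qed
  have "convex {s. Re s > 1}" by (rule convex_halfspace_Re_gt)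
  from has_field_derivative_zero_constant[OF this d]
  obtain K where K: "\<And>s. Re s > 1 \<Longrightarrow> h s = K" by auto
  have "dseries f s = K * exp (dseries b s)" if "Re s > 1" for s
    using K[OF that] unfolding h_def by (simp add: exp_minus field_simps)
  then show ?thesis unfolding b_def by blast
qed

section \<open>The functions zeta and L(s, chi4) near Re s = 1\<close>

lemma norm_diff_le_vector_derivative:
  fixes f :: "real \<Rightarrow> complex"
  assumes "a \<le> b" "\<And>x. a \<le> x \<Longrightarrow> x \<le> b \<Longrightarrow> (f has_vector_derivative f' x) (at x)"
    "\<And>x. a \<le> x \<Longrightarrow> x \<le> b \<Longrightarrow> norm (f' x) \<le> B"
  shows "norm (f b - f a) \<le> B * (b - a)"
proof -
  have "norm (f b - f a) \<le> B * norm (b - a)"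
  proof (rule differentiable_bound[of "{a..b}" f "\<lambda>x h. h *\<^sub>R f' x"])
    show "(f has_derivative (\<lambda>h. h *\<^sub>R f' x)) (at x within {a..b})" if "x \<in> {a..b}" for x
      using assms(2)[of x] that by (auto simp: has_vector_derivative_def intro: has_derivative_at_withinI)
    show "onorm (\<lambda>h. h *\<^sub>R f' x) \<le> B" if "x \<in> {a..b}" for x
      using assms(3)[of x] that by (simp add: onorm_scaleR_left[OF bounded_linear_ident] onorm_id)
  qed (use assms(1) in auto)
  then show ?thesis using assms(1) by simp
qed

lemma powr_vector_derivative:
  assumes "u > 0"
  shows "((\<lambda>u. complex_of_real u powr z) has_vector_derivative z * of_real u powr (z - 1)) (at u)"
proof -
  have "((\<lambda>w. w powr z) has_field_derivative z * of_real u powr (z - 1)) (at (complex_of_real u))"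
    using assms by (intro has_field_derivative_powr) (auto simp: complex_nonpos_Reals_iff)
  then show ?thesis by (rule has_vector_derivative_real_field)
qed

lemma norm_real_powr: "u > 0 \<Longrightarrow> norm (complex_of_real u powr s) = u powr Re s"
  using norm_powr_real_powr[of "of_real u" s] by simp

text \<open>Interpolation between the trivial bound and the mean value bound, by
  \<open>min 1 r \<le> r powr \<theta>\<close> with \<open>r = norm s / n\<close>. A small
  \<open>\<theta>\<close> buys a little decay in \<open>n\<close> for little growth in
  \<open>s\<close>.\<close>

lemma powr_diff_bound:
  assumes n: "1 \<le> n" and u: "n \<le> u" "u \<le> n + 1" and s: "Re s > 0" and th: "0 \<le> \<theta>" "\<theta> \<le> 1"
  shows "norm (complex_of_real u powr (- s) - of_real n powr (- s)) \<le> 2 * norm s powr \<theta> * n powr (- Re s - \<theta>)"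
proof -
  let ?X = "norm (complex_of_real u powr (- s) - of_real n powr (- s))"
  have pos: "norm s > 0" using s by auto
  have "?X \<le> norm (complex_of_real u powr (- s)) + norm (complex_of_real n powr (- s))"
    by (rule norm_triangle_ineq4)
  also have "\<dots> = u powr (- Re s) + n powr (- Re s)" using n u by (simp add: norm_real_powr)
  also have "u powr (- Re s) \<le> n powr (- Re s)" using n u s by (intro powr_mono2') auto
  finally have X1: "?X \<le> 2 * n powr (- Re s)" by simp
  have "?X \<le> (norm s * n powr (- Re s - 1)) * (u - n)"
  proof (rule norm_diff_le_vector_derivative[where f' = "\<lambda>u. - s * of_real u powr (- s - 1)"])
    show "norm (- s * complex_of_real x powr (- s - 1)) \<le> norm s * n powr (- Re s - 1)"
      if "n \<le> x" for x
      using that n s by (auto simp: norm_mult norm_real_powr intro!: mult_left_mono powr_mono2')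
    show "((\<lambda>a. complex_of_real a powr - s) has_vector_derivative - s * complex_of_real x powr (- s - 1)) (at x)"
      if "n \<le> x" for x
      using that n by (intro powr_vector_derivative) auto
  qed (use u in auto)
  also have "\<dots> \<le> (norm s * n powr (- Re s - 1)) * 1" using u by (intro mult_left_mono) auto
  also have "\<dots> = n powr (- Re s) * (norm s / n)" using n by (simp add: powr_diff)
  finally have X2: "?X \<le> n powr (- Re s) * (norm s / n)" .
  have "?X \<le> 2 * n powr (- Re s) * (norm s / n) powr \<theta>"
  proof (cases "norm s / n \<le> 1")
    case True
    have "norm s / n = (norm s / n) powr 1" using pos n by simp
    also have "\<dots> \<le> (norm s / n) powr \<theta>" using True pos n th by (intro powr_mono') auto
    finally have "n powr (- Re s) * (norm s / n) \<le> n powr (- Re s) * (norm s / n) powr \<theta>"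
      by (intro mult_left_mono) auto
    with X2 have "?X \<le> n powr (- Re s) * (norm s / n) powr \<theta>" by linarith
    also have "\<dots> \<le> 2 * n powr (- Re s) * (norm s / n) powr \<theta>" by simp
    finally show ?thesis .
  next
    case False
    then have "1 \<le> (norm s / n) powr \<theta>" using th by (intro ge_one_powr_ge_zero) auto
    then have "2 * n powr (- Re s) * 1 \<le> 2 * n powr (- Re s) * (norm s / n) powr \<theta>"
      by (intro mult_left_mono) auto
    with X1 show ?thesis by simp
  qed
  also have "\<dots> = 2 * norm s powr \<theta> * n powr (- Re s - \<theta>)"
    using n pos by (simp add: powr_divide powr_diff)
  finally show ?thesis .
qed

text \<open>
  On this half-plane \<open>\<bar>n\<^bsup>-s\<^esup> - (n+1)\<^bsup>-s\<^esup>\<bar> \<le> 2 \<bar>s\<bar>\<^bsup>1/40\<^esup> n\<^bsup>-81/80\<^esup>\<close>. The exponent \<open>1/40\<close> is chosen so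
  that the tenth power of the resulting bound \<open>O(t\<^bsup>2/40\<^esup>)\<close> for \<open>\<zeta>(s) L(s, \<chi>\<^sub>4)\<close> is \<open>O(t\<^bsup>1/2\<^esup>)\<close>.
\<close>

definition strip :: "complex set" where "strip = {s. Re s > 79/80}"

lemma open_strip: "open strip" unfolding strip_def by (rule open_halfspace_Re_gt)

lemma stripD: "s \<in> strip \<Longrightarrow> Re s > 79/80" by (simp add: strip_def)

lemma powr_diff_bound_strip:
  assumes n: "1 \<le> n" and u: "n \<le> u" "u \<le> n + 1" and s: "s \<in> strip"
  shows "norm (complex_of_real u powr (- s) - of_real n powr (- s)) \<le> 2 * norm s powr (1/40) * n powr (- (81/80))"
proof -
  have "norm (complex_of_real u powr (- s) - of_real n powr (- s)) \<le> 2 * norm s powr (1/40) * n powr (- Re s - 1/40)"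
    by (rule powr_diff_bound) (use n u stripD[OF s] in auto)
  also have "\<dots> \<le> 2 * norm s powr (1/40) * n powr (- (81/80))"
    using n stripD[OF s] by (intro mult_left_mono powr_mono) auto
  finally show ?thesis .
qed

lemma powr_one_plus_norm_le: "norm s powr (1/40) \<le> 1 + norm (s::complex)"
proof (cases "norm s \<le> 1")
  case True
  then have "norm s powr (1/40) \<le> 1" by (intro powr_le1) auto
  then show ?thesis using norm_ge_zero[of s] by linarith
next
  case False
  then have "norm s powr (1/40) \<le> norm s powr 1" by (intro powr_mono) auto
  then show ?thesis using False by simp
qed

text \<open>The Weierstrass test. The ceiling \<open>2 * (1 + norm s) ^ 2\<close> on
  \<open>B\<close> is increasing in \<open>norm s\<close>, so its value at \<open>norm x + 1\<close>
  controls \<open>B\<close> on the unit disc around \<open>x\<close> within the strip.\<close>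

lemma suminf_holomorphic_strip:
  fixes f :: "nat \<Rightarrow> complex \<Rightarrow> complex"
  assumes hol: "\<And>n. f n holomorphic_on strip"
    and bd: "\<And>n s. s \<in> strip \<Longrightarrow> norm (f n s) \<le> B s * c n"
    and c: "summable c" "\<And>n. c n \<ge> 0" and B: "\<And>s. s \<in> strip \<Longrightarrow> B s \<le> 2 * (1 + norm s) ^ 2"
  shows "(\<lambda>s. \<Sum>n. f n s) holomorphic_on strip"
    and "\<And>s. s \<in> strip \<Longrightarrow> norm (\<Sum>n. f n s) \<le> B s * (\<Sum>n. c n)"
    and "\<And>s. s \<in> strip \<Longrightarrow> (\<lambda>n. f n s) sums (\<Sum>n. f n s)"
proof -
  have "\<exists>g g'. \<forall>x\<in>strip. ((\<lambda>n. f n x) sums g x) \<and> ((\<lambda>n. deriv (f n) x) sums g' x) \<and> (g has_field_derivative g' x) (at x)"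
  proof (rule series_and_derivative_comparison_local[OF open_strip])
    show "(f n has_field_derivative deriv (f n) x) (at x)" if "x \<in> strip" for n x
      using hol open_strip that holomorphic_derivI by blast
    fix x assume "x \<in> strip"
    have "summable (\<lambda>n. 2 * (1 + (norm x + 1)) ^ 2 * c n)" using c by (intro summable_mult)
    moreover have "norm (f n y) \<le> 2 * (1 + (norm x + 1)) ^ 2 * c n" if y: "y \<in> ball x 1 \<inter> strip" for n y
    proof -
      have "norm y \<le> norm x + 1" using y norm_triangle_ineq2[of y x] by (auto simp: dist_norm norm_minus_commute)
      then have "2 * (1 + norm y) ^ 2 \<le> 2 * (1 + (norm x + 1)) ^ 2"
        by (intro mult_left_mono power_mono) auto
      then have "B y \<le> 2 * (1 + (norm x + 1)) ^ 2" using B[of y] y by (meson IntD2 order.trans)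
      then have "B y * c n \<le> 2 * (1 + (norm x + 1)) ^ 2 * c n" using c(2) by (intro mult_right_mono) auto
      then show ?thesis using bd[of y n] y by (meson IntD2 order.trans)
    qed
    ultimately show "\<exists>d h. 0 < d \<and> summable h \<and> (\<forall>\<^sub>F n in sequentially. \<forall>y\<in>ball x d \<inter> strip. cmod (f n y) \<le> h n)"
      by (intro exI[of _ 1] exI[of _ "\<lambda>n. 2 * (1 + (norm x + 1)) ^ 2 * c n"]) auto
  qed
  then obtain g g' where g: "\<And>x. x \<in> strip \<Longrightarrow> (\<lambda>n. f n x) sums g x" 
    "\<And>x. x \<in> strip \<Longrightarrow> (g has_field_derivative g' x) (at x)" by metis
  have eq: "(\<Sum>n. f n s) = g s" if "s \<in> strip" for s using g(1)[OF that] by (simp add: sums_iff)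
  have "g holomorphic_on strip" unfolding holomorphic_on_open[OF open_strip] using g(2) by blast
  then show "(\<lambda>s. \<Sum>n. f n s) holomorphic_on strip"
    using holomorphic_cong[OF refl eq] by simp
  fix s assume s: "s \<in> strip"
  show "(\<lambda>n. f n s) sums (\<Sum>n. f n s)" using g(1)[OF s] eq[OF s] by simp
  have sm: "summable (\<lambda>n. B s * c n)" using c by (intro summable_mult)
  have "norm (\<Sum>n. f n s) \<le> (\<Sum>n. B s * c n)"
    using bd[OF s] by (intro norm_suminf_le sm)
  also have "\<dots> = B s * (\<Sum>n. c n)" using c by (intro suminf_mult)
  finally show "norm (\<Sum>n. f n s) \<le> B s * (\<Sum>n. c n)" .
qed

definition powr_const :: real where "powr_const = (\<Sum>n. real (Suc n) powr (- (81/80)))"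

lemma summable_powr_const: "summable (\<lambda>n. real (Suc n) powr (- (81/80)))"
  using summable_real_powr_iff[of "- (81/80)"] summable_Suc_iff[of "\<lambda>n. real n powr (- (81/80))"] by simp

lemma powr_const_nonneg: "powr_const \<ge> 0"
  unfolding powr_const_def by (intro suminf_nonneg summable_powr_const) auto

definition chi4 :: "nat \<Rightarrow> real" where
  "chi4 n = (if n mod 4 = 1 then 1 else if n mod 4 = 3 then -1 else 0)"

text \<open>The sum of \<open>chi4\<close> over the positive integers up to \<open>n\<close>. That
  it only takes the values 0 and 1 gives both the convergence of \<open>L4\<close> and the
  positivity of its terms on the real axis.\<close>

definition chi4_sum :: "nat \<Rightarrow> real" where
  "chi4_sum n = (if n mod 4 = 1 \<or> n mod 4 = 2 then 1 else 0)"

text \<open>\<open>zeta_reg s\<close> is the continuation of \<open>(s - 1) \<zeta>(s)\<close>, \<open>L4\<close> that of \<open>L(s, \<chi>\<^sub>4)\<close> (summation by parts).\<close>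

definition zeta_reg :: "complex \<Rightarrow> complex" where
  "zeta_reg s = 1 + (\<Sum>n. of_nat (Suc (Suc n)) powr (1 - s) - of_nat (Suc n) powr (1 - s) + (s - 1) * of_nat (Suc n) powr (- s))"

definition L4 :: "complex \<Rightarrow> complex" where
  "L4 s = (\<Sum>n. of_real (chi4_sum (Suc n)) * (of_nat (Suc n) powr (- s) - of_nat (Suc (Suc n)) powr (- s)))"

lemma L4_strip:
  shows "L4 holomorphic_on strip"
    and "\<And>s. s \<in> strip \<Longrightarrow> norm (L4 s) \<le> 2 * norm s powr (1/40) * powr_const"
    and "\<And>s. s \<in> strip \<Longrightarrow> (\<lambda>n. of_real (chi4_sum (Suc n)) * (of_nat (Suc n) powr (- s) - of_nat (Suc (Suc n)) powr (- s))) sums L4 s"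
proof -
  let ?f = "\<lambda>n s. complex_of_real (chi4_sum (Suc n)) * (of_nat (Suc n) powr (- s) - of_nat (Suc (Suc n)) powr (- s))"
  have 1: "?f n holomorphic_on strip" for n
    by (intro holomorphic_intros)
  have 2: "norm (?f n s) \<le> 2 * norm s powr (1/40) * real (Suc n) powr (- (81/80))" if "s \<in> strip" for n s
  proof -
    have "norm (?f n s) \<le> norm (complex_of_real (real (Suc (Suc n))) powr (- s) - of_real (real (Suc n)) powr (- s))"
      by (simp add: norm_mult chi4_sum_def norm_minus_commute)
    also have "\<dots> \<le> 2 * norm s powr (1/40) * real (Suc n) powr (- (81/80))"
      using that by (intro powr_diff_bound_strip) auto
    finally show ?thesis .
  qed
  have 3: "2 * norm s powr (1/40) \<le> 2 * (1 + norm s) ^ 2" for s :: complex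
  proof -
    have "1 + norm s \<le> (1 + norm s) ^ 2" by (rule self_le_power) auto
    then show ?thesis using powr_one_plus_norm_le[of s] by linarith
  qed
  note * = suminf_holomorphic_strip[of ?f "\<lambda>s. 2 * norm s powr (1/40)" "\<lambda>n. real (Suc n) powr (- (81/80))", OF 1 2 summable_powr_const _ 3]
  show "L4 holomorphic_on strip" using *(1) by (simp add: L4_def[abs_def])
  show "norm (L4 s) \<le> 2 * norm s powr (1/40) * powr_const" if "s \<in> strip" for s
    using *(2)[OF _ _ that] by (simp add: L4_def powr_const_def)
  show "(\<lambda>n. of_real (chi4_sum (Suc n)) * (of_nat (Suc n) powr (- s) - of_nat (Suc (Suc n)) powr (- s))) sums L4 s" if "s \<in> strip" for s
    unfolding L4_def by (rule *(3)) (use that in auto)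
qed

lemma zeta_reg_strip:
  shows "zeta_reg holomorphic_on strip"
    and "\<And>s. s \<in> strip \<Longrightarrow> norm (zeta_reg s) \<le> 1 + 2 * norm (s - 1) * norm s powr (1/40) * powr_const"
    and "\<And>s. s \<in> strip \<Longrightarrow> (\<lambda>n. of_nat (Suc (Suc n)) powr (1 - s) - of_nat (Suc n) powr (1 - s) + (s - 1) * of_nat (Suc n) powr (- s)) sums (zeta_reg s - 1)"
proof -
  let ?f = "\<lambda>n s. of_nat (Suc (Suc n)) powr (1 - s) - of_nat (Suc n) powr (1 - s) + (s - 1) * of_nat (Suc n) powr (- s) :: complex"
  have 1: "?f n holomorphic_on strip" for n
    by (intro holomorphic_intros)
  have 2: "norm (?f n s) \<le> 2 * norm (s - 1) * norm s powr (1/40) * real (Suc n) powr (- (81/80))" if s: "s \<in> strip" for n s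
  proof -
    define m where "m = real (Suc n)"
    have m: "m \<ge> 1" by (simp add: m_def)
    \<comment> \<open>The linear part is subtracted so that the derivative becomes
      \<open>(1 - s) (u^(-s) - m^(-s))\<close>, which the difference bound controls. The increment
      of \<open>\<psi>\<close> over a unit interval is the term of the series.\<close>
    define \<psi> where "\<psi> = (\<lambda>u. complex_of_real u powr (1 - s) - of_real u * ((1 - s) * of_real m powr (- s)))"
    have "norm (\<psi> (m + 1) - \<psi> m) \<le> (norm (s - 1) * (2 * norm s powr (1/40) * m powr (- (81/80)))) * ((m + 1) - m)"
    proof (rule norm_diff_le_vector_derivative[where f' = "\<lambda>u. (1 - s) * of_real u powr (1 - s - 1) - 1 * ((1 - s) * of_real m powr (- s))"])
      fix x assume x: "m \<le> x" "x \<le> m + 1"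
      show "(\<psi> has_vector_derivative (1 - s) * of_real x powr (1 - s - 1) - 1 * ((1 - s) * of_real m powr (- s))) (at x)"
        unfolding \<psi>_def using x m
        by (intro has_vector_derivative_diff powr_vector_derivative has_vector_derivative_mult_left)
           (auto intro!: has_vector_derivative_of_real derivative_eq_intros)
      have "(1 - s) * of_real x powr (1 - s - 1) - 1 * ((1 - s) * of_real m powr (- s)) = (1 - s) * (complex_of_real x powr (- s) - of_real m powr (- s))"
        by (simp add: algebra_simps)
      also have "norm \<dots> = norm (s - 1) * norm (complex_of_real x powr (- s) - of_real m powr (- s))"
        by (simp add: norm_mult norm_minus_commute)
      also have "\<dots> \<le> norm (s - 1) * (2 * norm s powr (1/40) * m powr (- (81/80)))"
        using x m s by (intro mult_left_mono powr_diff_bound_strip) auto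
      finally show "norm ((1 - s) * of_real x powr (1 - s - 1) - 1 * ((1 - s) * of_real m powr (- s))) \<le> norm (s - 1) * (2 * norm s powr (1/40) * m powr (- (81/80)))" .
    qed auto
    moreover have "\<psi> (m + 1) - \<psi> m = ?f n s"
      unfolding \<psi>_def m_def by (simp add: algebra_simps)
    ultimately show ?thesis by (simp add: m_def mult_ac)
  qed
  have 3: "2 * norm (s - 1) * norm s powr (1/40) \<le> 2 * (1 + norm s) ^ 2" for s :: complex
  proof -
    have "norm (s - 1) \<le> 1 + norm s" using norm_triangle_ineq4[of s 1] by simp
    then have "norm (s - 1) * norm s powr (1/40) \<le> (1 + norm s) * (1 + norm s)"
      using powr_one_plus_norm_le[of s] by (intro mult_mono) auto
    then show ?thesis by (simp add: power2_eq_square)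
  qed
  note * = suminf_holomorphic_strip[of ?f "\<lambda>s. 2 * norm (s - 1) * norm s powr (1/40)" "\<lambda>n. real (Suc n) powr (- (81/80))", OF 1 2 summable_powr_const _ 3]
  show "zeta_reg holomorphic_on strip" using *(1) unfolding zeta_reg_def[abs_def]
    by (intro holomorphic_on_add holomorphic_on_const) auto
  show "norm (zeta_reg s) \<le> 1 + 2 * norm (s - 1) * norm s powr (1/40) * powr_const" if "s \<in> strip" for s
    unfolding zeta_reg_def powr_const_def using *(2)[OF _ _ that]
    by (intro order.trans[OF norm_triangle_ineq]) simp
  show "(\<lambda>n. ?f n s) sums (zeta_reg s - 1)" if "s \<in> strip" for s
    unfolding zeta_reg_def using *(3) that by simp
qed

section \<open>Agreement with the Dirichlet series for Re s > 1\<close>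

lemma Re_gt1_strip: "Re s > 1 \<Longrightarrow> s \<in> strip" by (simp add: strip_def)

lemma zeta_reg_1: "zeta_reg 1 = 1"
  by (simp add: zeta_reg_def del: of_nat_Suc)

lemma zeta_reg_eq:
  assumes "Re s > 1"
  shows "zeta_reg s = (s - 1) * dseries (\<lambda>_. 1) s"
proof -
  have "(\<lambda>n. of_nat (Suc n) powr (1 - s)) \<longlonglongrightarrow> (0::complex)"
    using assms by (intro LIMSEQ_Suc tendsto_neg_powr_complex_of_nat filterlim_ident) auto
  \<comment> \<open>The telescoped part contributes -1 and cancels the leading 1 in
    \<open>zeta_reg\<close>.\<close>
  from telescope_sums[OF this]
  have 1: "(\<lambda>n. of_nat (Suc (Suc n)) powr (1 - s) - of_nat (Suc n) powr (1 - s)) sums (- 1 :: complex)" by simp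
  have "(\<lambda>n. complex_of_real 1 * of_nat n powr (- s)) sums dseries (\<lambda>_. 1) s"
    by (rule dseries_sums[OF abs_conv_gt1_const assms])
  then have "(\<lambda>n. of_nat (Suc n) powr (- s)) sums dseries (\<lambda>_. 1) s"
    by (subst sums_Suc_iff) simp
  then have "(\<lambda>n. (s - 1) * of_nat (Suc n) powr (- s)) sums ((s - 1) * dseries (\<lambda>_. 1) s)"
    by (rule sums_mult)
  from sums_add[OF 1 this] have "zeta_reg s - 1 = - 1 + (s - 1) * dseries (\<lambda>_. 1) s"
    using zeta_reg_strip(3)[OF Re_gt1_strip[OF assms]] sums_unique2 by blast
  then show ?thesis by simp
qed

lemma chi4_mult: "chi4 (m * n) = chi4 m * chi4 n"
proof -
  have "m mod 4 < 4" "n mod 4 < 4" by auto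
  then have "m mod 4 \<in> {0,1,2,3}" "n mod 4 \<in> {0,1,2,3}" by auto
  moreover have "(m * n) mod 4 = ((m mod 4) * (n mod 4)) mod 4" by (simp add: mod_mult_eq)
  ultimately show ?thesis by (auto simp: chi4_def)
qed

lemma chi4_le_1: "\<bar>chi4 n\<bar> \<le> 1"
  by (simp add: chi4_def)

lemma chi4_Suc: "chi4 (Suc n) = chi4_sum (Suc n) - chi4_sum n"
proof -
  have "n mod 4 < 4" by auto
  then have "n mod 4 \<in> {0,1,2,3}" by auto
  then show ?thesis by (auto simp: chi4_def chi4_sum_def mod_Suc)
qed

text \<open>Abel summation. For \<open>Re s > 1\<close> the two halves of the difference converge
  separately, and the index shift is harmless because \<open>chi4_sum 0 = 0\<close>.\<close>

lemma L4_eq: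
  assumes "Re s > 1"
  shows "L4 s = dseries chi4 s"
proof -
  have "\<And>n. \<bar>chi4_sum n\<bar> \<le> 1" by (simp add: chi4_sum_def)
  then have ac: "abs_conv_gt1 chi4_sum" by (rule abs_conv_gt1_le_1)
  have "(\<lambda>n. complex_of_real (chi4_sum n) * of_nat n powr (- s)) sums dseries chi4_sum s"
    by (rule dseries_sums[OF ac assms])
  then have V: "(\<lambda>n. complex_of_real (chi4_sum (Suc n)) * of_nat (Suc n) powr (- s)) sums dseries chi4_sum s"
    by (subst sums_Suc_iff) simp
  have "(\<lambda>n. complex_of_real (chi4 n) * of_nat n powr (- s)) sums dseries chi4 s"
    by (intro dseries_sums assms abs_conv_gt1_le_1 chi4_le_1)
  then have D: "(\<lambda>n. complex_of_real (chi4 (Suc n)) * of_nat (Suc n) powr (- s)) sums dseries chi4 s"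
    by (subst sums_Suc_iff) simp
  from sums_diff[OF V D]
  have "(\<lambda>n. complex_of_real (chi4_sum n) * of_nat (Suc n) powr (- s)) sums (dseries chi4_sum s - dseries chi4 s)"
    by (simp add: chi4_Suc algebra_simps)
  then have "(\<lambda>n. complex_of_real (chi4_sum (Suc n)) * of_nat (Suc (Suc n)) powr (- s)) sums (dseries chi4_sum s - dseries chi4 s)"
    by (subst sums_Suc_iff) (simp add: chi4_sum_def)
  from sums_diff[OF V this]
  have "(\<lambda>n. complex_of_real (chi4_sum (Suc n)) * (of_nat (Suc n) powr (- s) - of_nat (Suc (Suc n)) powr (- s))) sums dseries chi4 s"
    by (simp add: algebra_simps)
  then show ?thesis using L4_strip(3)[OF Re_gt1_strip[OF assms]] sums_unique2 by blast
qed

text \<open>After summation by parts all terms at a real point are nonnegative and the first one is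
  positive. The case \<open>x = 1\<close> is the nonvanishing of \<open>L(1, chi4)\<close>, without
  which \<open>zetaK\<close> would lose its pole.\<close>

lemma L4_real_nonzero:
  assumes "x \<ge> 1"
  shows "L4 (of_real x) \<noteq> 0"
proof -
  have s: "complex_of_real x \<in> strip" using assms by (simp add: strip_def)
  define t where "t = (\<lambda>n. chi4_sum (Suc n) * (real (Suc n) powr (- x) - real (Suc (Suc n)) powr (- x)))"
  have nr: "of_nat n powr (- complex_of_real x) = of_real (real n powr (- x))" for n
    by (metis of_nat_0_le_iff of_real_minus of_real_of_nat_eq powr_of_real)
  have "(\<lambda>n. complex_of_real (t n)) sums L4 (of_real x)"
    using L4_strip(3)[OF s] unfolding t_def nr by simp
  then have t: "t sums Re (L4 (of_real x))" using sums_Re by force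
  have nn: "t n \<ge> 0" for n
    unfolding t_def using assms by (intro mult_nonneg_nonneg) (auto simp: chi4_sum_def intro!: powr_mono2')
  have "2 powr (- x) < (1::real)" using assms by (simp add: powr_minus divide_simps)
  then have "t 0 > 0" by (simp add: t_def chi4_sum_def)
  then have "Re (L4 (of_real x)) > 0"
    using suminf_pos2[of t 0] t nn by (auto simp: sums_iff)
  then show ?thesis by auto
qed

definition zeta_ext :: "complex \<Rightarrow> complex" where "zeta_ext s = zeta_reg s / (s - 1)"

text \<open>\<open>zetaK\<close> is \<open>\<zeta>(s) L(s, \<chi>\<^sub>4)\<close>, the Dedekind zeta function of the Gaussian field.\<close>

definition zetaK_reg :: "complex \<Rightarrow> complex" where "zetaK_reg s = zeta_reg s * L4 s"

definition zetaK :: "complex \<Rightarrow> complex" where "zetaK s = zeta_ext s * L4 s"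

lemma zeta_ext_eq: "Re s > 1 \<Longrightarrow> zeta_ext s = dseries (\<lambda>_. 1) s"
  by (auto simp: zeta_ext_def zeta_reg_eq)

lemma zetaK_eq: "Re s > 1 \<Longrightarrow> zetaK s = dseries (\<lambda>_. 1) s * dseries chi4 s"
  by (simp add: zetaK_def zeta_ext_eq L4_eq)

lemma zetaK_reg_zetaK: "s \<noteq> 1 \<Longrightarrow> zetaK_reg s = (s - 1) * zetaK s"
  by (simp add: zetaK_reg_def zetaK_def zeta_ext_def)

lemma open_strip_minus: "open (strip - {1})"
  by (intro open_Diff open_strip) auto

lemma zeta_ext_holomorphic: "zeta_ext holomorphic_on strip - {1}"
  unfolding zeta_ext_def[abs_def]
  by (intro holomorphic_intros holomorphic_on_subset[OF zeta_reg_strip(1)]) auto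

lemma zetaK_holomorphic: "zetaK holomorphic_on strip - {1}"
  unfolding zetaK_def[abs_def]
  by (intro holomorphic_intros zeta_ext_holomorphic holomorphic_on_subset[OF L4_strip(1)]) auto

lemma zetaK_reg_holomorphic: "zetaK_reg holomorphic_on strip"
  unfolding zetaK_reg_def[abs_def] by (intro holomorphic_intros zeta_reg_strip(1) L4_strip(1))

text \<open>The coefficients of \<open>- zetaK' / zetaK\<close>. The factor
  \<open>1 + chi4 n\<close> is 2 for \<open>n\<close> = 1 modulo 4, 0 for \<open>n\<close> = 3
  modulo 4 and 1 for even \<open>n\<close>: it selects the split primes while staying nonnegative,
  as the 3-4-1 argument requires.\<close>

definition mangoldt4 :: "nat \<Rightarrow> real" where "mangoldt4 n = (1 + chi4 n) * mangoldt n"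

lemma mangoldt4_eq: "mangoldt4 = (\<lambda>n. 1 * mangoldt n + chi4 n * mangoldt n)"
  by (auto simp: mangoldt4_def algebra_simps)

lemma abs_conv_gt1_mangoldt4: "abs_conv_gt1 mangoldt4"
  unfolding mangoldt4_eq
  by (intro abs_conv_gt1_add abs_conv_gt1_mangoldt) (auto simp: chi4_le_1)

lemma mangoldt4_nonneg: "mangoldt4 n \<ge> 0"
  unfolding mangoldt4_def using mangoldt_nonneg[of n] by (intro mult_nonneg_nonneg) (auto simp: chi4_def)

lemma dseries_mangoldt4:
  assumes "Re s > 1"
  shows "dseries mangoldt4 s = dseries (\<lambda>n. 1 * mangoldt n) s + dseries (\<lambda>n. chi4 n * mangoldt n) s"
  unfolding mangoldt4_eq
  by (intro dseries_add abs_conv_gt1_mangoldt assms) (auto simp: chi4_le_1)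

lemma dseries_1_2_nonzero: "dseries (\<lambda>_. 1) 2 \<noteq> 0"
proof -
  have nr: "of_nat n powr (- 2 :: complex) = of_real (real n powr (- 2))" for n
    by (metis of_nat_0_le_iff of_real_minus of_real_of_nat_eq powr_of_real of_real_numeral)
  have "(\<lambda>n. of_real 1 * of_nat n powr (- 2)) sums dseries (\<lambda>_. 1) 2"
    by (intro dseries_sums abs_conv_gt1_const) auto
  then have "(\<lambda>n. complex_of_real (real n powr (- 2))) sums dseries (\<lambda>_. 1) 2"
    unfolding nr by simp
  then have t: "(\<lambda>n. real n powr (- 2)) sums Re (dseries (\<lambda>_. 1) 2)" using sums_Re by force
  have "Re (dseries (\<lambda>_. 1) 2) > 0"
    using suminf_pos2[of "\<lambda>n. real n powr (- 2)" 1] t by (auto simp: sums_iff)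
  then show ?thesis by auto
qed

text \<open>Neither constant from \<open>dseries_exp_log\<close> can be 0, since both Dirichlet
  series are nonzero at \<open>s = 2\<close>.\<close>

lemma zetaK_exp:
  obtains K where "K \<noteq> 0"
    "\<And>s. Re s > 1 \<Longrightarrow> zetaK s = K * exp (dseries (\<lambda>n. mangoldt4 n / ln (real n)) s)"
proof -
  obtain K1 where K1: "\<And>s. Re s > 1 \<Longrightarrow> dseries (\<lambda>_. 1) s = K1 * exp (dseries (\<lambda>n. 1 * mangoldt n / ln (real n)) s)"
    using dseries_exp_log[of "\<lambda>_. 1"] by auto
  obtain K2 where K2: "\<And>s. Re s > 1 \<Longrightarrow> dseries chi4 s = K2 * exp (dseries (\<lambda>n. chi4 n * mangoldt n / ln (real n)) s)"
    using dseries_exp_log[of chi4, OF chi4_mult chi4_le_1] by auto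
  have "K1 \<noteq> 0" using K1[of 2] dseries_1_2_nonzero by auto
  moreover have "K2 \<noteq> 0" using K2[of 2] L4_real_nonzero[of 2] L4_eq[of 2] by auto
  moreover have "zetaK s = (K1 * K2) * exp (dseries (\<lambda>n. mangoldt4 n / ln (real n)) s)" if "Re s > 1" for s
  proof -
    have "dseries (\<lambda>n. mangoldt4 n / ln (real n)) s =
      dseries (\<lambda>n. 1 * mangoldt n / ln (real n) + chi4 n * mangoldt n / ln (real n)) s"
      by (simp add: mangoldt4_def algebra_simps add_divide_distrib)
    also have "\<dots> = dseries (\<lambda>n. 1 * mangoldt n / ln (real n)) s + dseries (\<lambda>n. chi4 n * mangoldt n / ln (real n)) s"
      by (intro dseries_add abs_conv_gt1_mangoldt_div_ln that) (auto simp: chi4_le_1)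
    finally show ?thesis using zetaK_eq[OF that] K1[OF that] K2[OF that] by (simp add: exp_add)
  qed
  ultimately show ?thesis using that[of "K1 * K2"] by auto
qed

section \<open>The 3-4-1 inequality and lower bounds on the line Re s = 1\<close>

lemma Re_nat_powr: "Re (of_nat n powr (- s)) = real n powr (- Re s) * cos (Im s * ln (real n))"
proof (cases "n = 0")
  case False
  then have "Ln (of_nat n) = of_real (ln (real n))" using Ln_of_real[of "real n"] by simp
  then show ?thesis using False by (simp add: powr_def Re_exp mult.commute)
qed simp

text \<open>Termwise, \<open>3 + 4 cos a + cos (2 a) = 2 (1 + cos a)^2\<close>, multiplied by a
  nonnegative coefficient.\<close>

lemma dseries_341:
  assumes b: "abs_conv_gt1 b" "\<And>n. b n \<ge> 0" and \<sigma>: "\<sigma> > 1"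
  shows "3 * Re (dseries b (of_real \<sigma>)) + 4 * Re (dseries b (Complex \<sigma> t)) + Re (dseries b (Complex \<sigma> (2 * t))) \<ge> 0"
proof -
  have S: "(\<lambda>n. b n * (real n powr (- \<sigma>) * cos (u * ln (real n)))) sums Re (dseries b (Complex \<sigma> u))" for u
    using sums_Re[OF dseries_sums[OF b(1), of "Complex \<sigma> u"]] \<sigma> by (simp add: Re_nat_powr)
  have "(\<lambda>n. 3 * (b n * (real n powr (- \<sigma>) * cos (0 * ln (real n)))) + 4 * (b n * (real n powr (- \<sigma>) * cos (t * ln (real n))))
      + b n * (real n powr (- \<sigma>) * cos ((2 * t) * ln (real n)))) sums
     (3 * Re (dseries b (Complex \<sigma> 0)) + 4 * Re (dseries b (Complex \<sigma> t)) + Re (dseries b (Complex \<sigma> (2 * t))))"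
    by (intro sums_add sums_mult S)
  moreover have "3 * (b n * (real n powr (- \<sigma>) * cos (0 * ln (real n)))) + 4 * (b n * (real n powr (- \<sigma>) * cos (t * ln (real n))))
      + b n * (real n powr (- \<sigma>) * cos ((2 * t) * ln (real n))) \<ge> 0" for n
  proof -
    define c where "c = cos (t * ln (real n))"
    have c2: "cos ((2 * t) * ln (real n)) = 2 * c\<^sup>2 - 1"
      unfolding c_def using cos_double_cos[of "t * ln (real n)"] by (simp add: mult.assoc)
    have "3 * (b n * (real n powr (- \<sigma>) * cos (0 * ln (real n)))) + 4 * (b n * (real n powr (- \<sigma>) * cos (t * ln (real n))))
      + b n * (real n powr (- \<sigma>) * cos ((2 * t) * ln (real n))) = (b n * real n powr (- \<sigma>)) * (2 * (1 + c)\<^sup>2)"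
      unfolding c2 c_def[symmetric] by (simp add: power2_eq_square algebra_simps)
    then show ?thesis using b(2)[of n] by simp
  qed
  ultimately have "0 \<le> 3 * Re (dseries b (Complex \<sigma> 0)) + 4 * Re (dseries b (Complex \<sigma> t)) + Re (dseries b (Complex \<sigma> (2 * t)))"
    by (rule sums_le[OF _ sums_zero, rotated])
  then show ?thesis by (simp add: complex_of_real_def)
qed

lemma zetaK_341:
  obtains k where "k > 0"
    "\<And>\<sigma> t. \<sigma> > 1 \<Longrightarrow> norm (zetaK (of_real \<sigma>)) ^ 3 * norm (zetaK (Complex \<sigma> t)) ^ 4 * norm (zetaK (Complex \<sigma> (2 * t))) \<ge> k"
proof -
  obtain K where K: "K \<noteq> 0"
    "\<And>s. Re s > 1 \<Longrightarrow> zetaK s = K * exp (dseries (\<lambda>n. mangoldt4 n / ln (real n)) s)" by (rule zetaK_exp) blast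
  define b where "b = (\<lambda>n. mangoldt4 n / ln (real n))"
  have b: "abs_conv_gt1 b"
    unfolding b_def mangoldt4_eq add_divide_distrib
    by (intro abs_conv_gt1_add abs_conv_gt1_mangoldt_div_ln) (auto simp: chi4_le_1)
  have b0: "b n \<ge> 0" for n
    unfolding b_def using mangoldt4_nonneg by (cases "n = 0") auto
  have nZ: "norm (zetaK s) = norm K * exp (Re (dseries b s))" if "Re s > 1" for s
    using K(2)[OF that] by (simp add: norm_mult b_def)
  \<comment> \<open>The exponent 8 is 3 + 4 + 1: the unknown constant of the exponential form enters
    once with each factor.\<close>
  show ?thesis
  proof (rule that[of "norm K ^ 8"])
    show "norm K ^ 8 > 0" using K(1) by simp
    fix \<sigma> t :: real assume s: "\<sigma> > 1"
    have e: "exp (3 * x) = exp x ^ 3" "exp (4 * x) = exp x ^ 4" for x :: real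
      using exp_of_nat_mult[of 3 x] exp_of_nat_mult[of 4 x] by simp_all
    have "norm (zetaK (of_real \<sigma>)) ^ 3 * norm (zetaK (Complex \<sigma> t)) ^ 4 * norm (zetaK (Complex \<sigma> (2 * t)))
      = norm K ^ 8 * exp (3 * Re (dseries b (of_real \<sigma>)) + 4 * Re (dseries b (Complex \<sigma> t)) + Re (dseries b (Complex \<sigma> (2 * t))))"
      using s by (simp add: nZ power_mult_distrib exp_add e power_numeral_reduce)
    also have "\<dots> \<ge> norm K ^ 8 * 1"
      using dseries_341[OF b b0 s] by (intro mult_left_mono) auto
    finally show "norm (zetaK (of_real \<sigma>)) ^ 3 * norm (zetaK (Complex \<sigma> t)) ^ 4 * norm (zetaK (Complex \<sigma> (2 * t))) \<ge> norm K ^ 8" by simp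
  qed
qed

lemma zetaK_real_bound:
  obtains C where "C \<ge> 1" "\<And>\<sigma>. 1 < \<sigma> \<Longrightarrow> \<sigma> \<le> 2 \<Longrightarrow> norm (zetaK (of_real \<sigma>)) \<le> C / (\<sigma> - 1)"
proof -
  have "compact (complex_of_real ` {1..2})"
    by (intro compact_continuous_image continuous_intros) auto
  moreover have "continuous_on (complex_of_real ` {1..2}) zetaK_reg"
    by (rule holomorphic_on_imp_continuous_on[OF holomorphic_on_subset[OF zetaK_reg_holomorphic]]) (auto simp: strip_def)
  ultimately have "bounded (zetaK_reg ` complex_of_real ` {1..2})"
    using compact_continuous_image compact_imp_bounded by blast
  then obtain C where C: "\<And>\<sigma>. 1 \<le> \<sigma> \<Longrightarrow> \<sigma> \<le> 2 \<Longrightarrow> norm (zetaK_reg (of_real \<sigma>)) \<le> C"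
    unfolding bounded_iff by force
  show ?thesis
  proof (rule that[of "max C 1"])
    fix \<sigma> :: real assume s: "1 < \<sigma>" "\<sigma> \<le> 2"
    have "norm (zetaK_reg (of_real \<sigma>)) = norm (complex_of_real \<sigma> - 1) * norm (zetaK (of_real \<sigma>))"
      using zetaK_reg_zetaK[of "of_real \<sigma>"] s by (simp add: norm_mult)
    also have "norm (complex_of_real \<sigma> - 1) = \<sigma> - 1"
      using s norm_of_real[of "\<sigma> - 1", where ?'a = complex] by simp
    finally have "(\<sigma> - 1) * norm (zetaK (of_real \<sigma>)) \<le> max C 1" using C[of \<sigma>] s by simp
    then show "norm (zetaK (of_real \<sigma>)) \<le> max C 1 / (\<sigma> - 1)" using s by (simp add: field_simps)
  qed simp
qed

lemma Complex_in_strip: "\<sigma> \<ge> 1 \<Longrightarrow> t \<noteq> 0 \<Longrightarrow> Complex \<sigma> t \<in> strip - {1}"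
  by (auto simp: strip_def complex_eq_iff)

lemma zetaK_vector_derivative:
  assumes "\<sigma> \<ge> 1" "t \<noteq> 0"
  shows "((\<lambda>x. zetaK (Complex x t)) has_vector_derivative deriv zetaK (Complex \<sigma> t)) (at \<sigma>)"
proof -
  have "((\<lambda>z. zetaK (z + \<i> * of_real t)) has_field_derivative deriv zetaK (Complex \<sigma> t)) (at (of_real \<sigma>))"
  proof -
    have e: "of_real \<sigma> + \<i> * of_real t = Complex \<sigma> t" by (simp add: complex_eq_iff)
    have "(zetaK has_field_derivative deriv zetaK (Complex \<sigma> t)) (at (of_real \<sigma> + \<i> * of_real t))"
      unfolding e by (rule holomorphic_derivI[OF zetaK_holomorphic open_strip_minus Complex_in_strip[OF assms]])
    from DERIV_shift[THEN iffD1, OF this] show ?thesis .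
  qed
  from has_vector_derivative_real_field[OF this]
  show ?thesis by (simp add: Complex_eq)
qed

text \<open>
  The 3-4-1 inequality bounds \<open>zetaK (\<sigma> + it)\<close> from below for \<open>\<sigma> \<ge> 1 + c/M\<^sup>5\<close>; the bound on the
  derivative carries this over to \<open>1 < \<sigma> < 1 + c/M\<^sup>5\<close>.
\<close>

lemma zetaK_lower_bound:
  obtains c where "c > 0"
    "\<And>t M \<sigma>. t \<noteq> 0 \<Longrightarrow> M \<ge> 1 \<Longrightarrow> (\<And>\<sigma>. 1 < \<sigma> \<Longrightarrow> \<sigma> \<le> 2 \<Longrightarrow> norm (zetaK (Complex \<sigma> (2 * t))) \<le> M) \<Longrightarrow>
       (\<And>\<sigma>. 1 < \<sigma> \<Longrightarrow> \<sigma> \<le> 2 \<Longrightarrow> norm (deriv zetaK (Complex \<sigma> t)) \<le> M) \<Longrightarrow> 1 < \<sigma> \<Longrightarrow> \<sigma> \<le> 2 \<Longrightarrow>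
       norm (zetaK (Complex \<sigma> t)) \<ge> c / M ^ 4"
proof -
  obtain k where k: "k > 0" "\<And>\<sigma> t. \<sigma> > 1 \<Longrightarrow> norm (zetaK (of_real \<sigma>)) ^ 3 * norm (zetaK (Complex \<sigma> t)) ^ 4 * norm (zetaK (Complex \<sigma> (2 * t))) \<ge> k"
    by (rule zetaK_341) blast
  obtain C where C: "C \<ge> 1" "\<And>\<sigma>. 1 < \<sigma> \<Longrightarrow> \<sigma> \<le> 2 \<Longrightarrow> norm (zetaK (of_real \<sigma>)) \<le> C / (\<sigma> - 1)"
    by (rule zetaK_real_bound) blast
  \<comment> \<open>The largest value up to 1 with \<open>q ^ 4 * C ^ 3 \<le> k\<close>; it turns
    the constants of the 3-4-1 bound and of the pole into a fourth power.\<close>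
  define q where "q = min 1 (root 4 (k / C ^ 3))"
  have q0: "q > 0" using k C by (simp add: q_def)
  have q1: "q \<le> 1" by (simp add: q_def)
  have "q ^ 4 \<le> root 4 (k / C ^ 3) ^ 4" using q0 by (intro power_mono) (auto simp: q_def)
  also have "\<dots> = k / C ^ 3" using k C by (intro real_root_pow_pos2) auto
  finally have q4: "q ^ 4 * C ^ 3 \<le> k" using C by (simp add: field_simps)
  \<comment> \<open>Calibrated by \<open>q ^ 4 = 16 * c\<close>, so that with
    \<open>a = c / M ^ 5\<close> below one gets
    \<open>q ^ 4 * a ^ 3 / M = (2 * c / M ^ 4) ^ 4\<close>.\<close>
  define c where "c = (q / 2) ^ 4"
  have c0: "c > 0" using q0 by (simp add: c_def)
  show ?thesis
  proof (rule that[OF c0])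
    fix t M \<sigma> :: real
    assume t: "t \<noteq> 0" and M: "M \<ge> 1"
      and M1: "\<And>\<sigma>. 1 < \<sigma> \<Longrightarrow> \<sigma> \<le> 2 \<Longrightarrow> norm (zetaK (Complex \<sigma> (2 * t))) \<le> M"
      and M2: "\<And>\<sigma>. 1 < \<sigma> \<Longrightarrow> \<sigma> \<le> 2 \<Longrightarrow> norm (deriv zetaK (Complex \<sigma> t)) \<le> M"
      and \<sigma>: "1 < \<sigma>" "\<sigma> \<le> 2"
    \<comment> \<open>Moving across a distance \<open>a\<close> with derivative at most
      \<open>M\<close> changes the function by at most \<open>c / M ^ 4\<close>, which is half of
      the lower bound valid from \<open>1 + a\<close> onwards.\<close>
    define a where "a = c / M ^ 5"
    have a0: "a > 0" using c0 M by (simp add: a_def)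
    have c1: "c \<le> 1" unfolding c_def using q0 q1 by (intro power_le_one) auto
    have "1 \<le> M ^ 5" using M by simp
    then have "c \<le> M ^ 5" using c1 by linarith
    then have a1: "a \<le> 1" unfolding a_def using M by (simp add: field_simps)
    have far: "norm (zetaK (Complex y t)) \<ge> 2 * c / M ^ 4" if y: "1 + a \<le> y" "y \<le> 2" for y
    proof (rule power_le_imp_le_base[of _ 3])
      define z where "z = norm (zetaK (Complex y t))"
      have "q ^ 4 * C ^ 3 \<le> norm (zetaK (of_real y)) ^ 3 * z ^ 4 * norm (zetaK (Complex y (2 * t)))"
        using k(2)[of y t] q4 y a0 by (simp add: z_def)
      also have "\<dots> \<le> (C / (y - 1)) ^ 3 * z ^ 4 * M"
        using C(2)[of y] M1[of y] y a0 M C(1) by (intro mult_mono power_mono) (auto simp: z_def)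
      also have "\<dots> \<le> (C / a) ^ 3 * z ^ 4 * M"
        using C(1) a0 y M by (intro mult_right_mono power_mono divide_left_mono) (auto simp: z_def)
      finally have "q ^ 4 * C ^ 3 \<le> C ^ 3 * (z ^ 4 * M / a ^ 3)" by (simp add: power_divide field_simps)
      then have "C ^ 3 * q ^ 4 \<le> C ^ 3 * (z ^ 4 * M / a ^ 3)" by (simp only: mult.commute)
      moreover have "C ^ 3 > 0" using C(1) by simp
      ultimately have "q ^ 4 \<le> z ^ 4 * M / a ^ 3" by (simp only: mult_le_cancel_left_pos)
      then have "q ^ 4 * a ^ 3 / M \<le> z ^ 4" using a0 M by (simp add: field_simps)
      also have "q ^ 4 * a ^ 3 / M = (2 * c / M ^ 4) ^ 4"
      proof -
        have "q ^ 4 = 16 * c" by (simp add: c_def power_divide)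
        then have "q ^ 4 * a ^ 3 / M = 16 * c ^ 4 / (M ^ 15 * M)"
          unfolding a_def by (simp add: power_divide power_mult[symmetric] power_numeral_reduce)
        also have "\<dots> = (2 * c / M ^ 4) ^ 4"
          by (simp add: power_divide power_mult_distrib power_mult[symmetric] power_Suc2[symmetric])
        finally show ?thesis .
      qed
      finally show "(2 * c / M ^ 4) ^ Suc 3 \<le> norm (zetaK (Complex y t)) ^ Suc 3" by (simp add: z_def)
    qed simp
    show "norm (zetaK (Complex \<sigma> t)) \<ge> c / M ^ 4"
    proof (cases "1 + a \<le> \<sigma>")
      case True
      then have "2 * c / M ^ 4 \<le> norm (zetaK (Complex \<sigma> t))" using far \<sigma> by simp
      moreover have "c / M ^ 4 \<le> 2 * c / M ^ 4" using c0 M by (simp add: divide_right_mono)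
      ultimately show ?thesis by linarith
    next
      case False
      have "norm (zetaK (Complex (1 + a) t) - zetaK (Complex \<sigma> t)) \<le> M * (1 + a - \<sigma>)"
        using False \<sigma> a1 t
        by (intro norm_diff_le_vector_derivative[where f' = "\<lambda>\<sigma>. deriv zetaK (Complex \<sigma> t)"] zetaK_vector_derivative M2) auto
      also have "\<dots> \<le> M * a" using \<sigma> M by (intro mult_left_mono) auto
      also have "\<dots> = c / M ^ 4" using M by (simp add: a_def power_numeral_reduce field_simps)
      finally have "norm (zetaK (Complex (1 + a) t) - zetaK (Complex \<sigma> t)) \<le> c / M ^ 4" .
      moreover have "2 * c / M ^ 4 \<le> norm (zetaK (Complex (1 + a) t))" using far a1 by simp
      moreover have "norm (zetaK (Complex (1 + a) t)) \<le> norm (zetaK (Complex (1 + a) t) - zetaK (Complex \<sigma> t)) + norm (zetaK (Complex \<sigma> t))"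
        using norm_triangle_sub by (metis add.commute)
      ultimately show ?thesis by simp
    qed
  qed
qed

text \<open>\<open>\<bar>Im s\<bar> \<ge> 1/2\<close> keeps \<open>s\<close> away from the pole. The
  ranges are wider than \<open>1 \<le> Re s \<le> 2\<close>, \<open>\<bar>Im s\<bar> \<ge> 1\<close>
  to leave room for Cauchy circles.\<close>

lemma strip_growth:
  obtains C where "C \<ge> 1"
    "\<And>s. s \<in> strip \<Longrightarrow> Re s \<le> 3 \<Longrightarrow> \<bar>Im s\<bar> \<ge> 1/2 \<Longrightarrow> norm (zeta_ext s) \<le> C * (1 + \<bar>Im s\<bar>) powr (1/40)"
    "\<And>s. s \<in> strip \<Longrightarrow> Re s \<le> 3 \<Longrightarrow> \<bar>Im s\<bar> \<ge> 1/2 \<Longrightarrow> norm (L4 s) \<le> C * (1 + \<bar>Im s\<bar>) powr (1/40)"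
proof -
  define C where "C = 2 + 6 * powr_const"
  have C1: "C \<ge> 1" using powr_const_nonneg by (simp add: C_def)
  have bd: "norm s powr (1/40) \<le> 3 * (1 + \<bar>Im s\<bar>) powr (1/40)" if "s \<in> strip" "Re s \<le> 3" for s
  proof -
    have "norm s \<le> \<bar>Re s\<bar> + \<bar>Im s\<bar>" by (rule cmod_le)
    also have "\<dots> \<le> 3 * (1 + \<bar>Im s\<bar>)" using that stripD[OF that(1)] by auto
    finally have "norm s powr (1/40) \<le> (3 * (1 + \<bar>Im s\<bar>)) powr (1/40)" by (intro powr_mono2) auto
    also have "\<dots> = 3 powr (1/40) * (1 + \<bar>Im s\<bar>) powr (1/40)" by (subst powr_mult) auto
    also have "3 powr (1/40) \<le> (3::real) powr 1" by (rule powr_mono) auto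
    finally show ?thesis by (simp add: mult_right_mono)
  qed
  show ?thesis
  proof (rule that[OF C1])
    fix s assume s: "s \<in> strip" "Re s \<le> 3" "\<bar>Im s\<bar> \<ge> 1/2"
    let ?w = "(1 + \<bar>Im s\<bar>) powr (1/40)"
    have w1: "?w \<ge> 1" by (rule ge_one_powr_ge_zero) auto
    have "\<bar>Im (s - 1)\<bar> \<le> norm (s - 1)" by (rule abs_Im_le_cmod)
    then have n1: "norm (s - 1) \<ge> 1/2" using s by simp
    have "norm (zeta_ext s) \<le> (1 + 2 * norm (s - 1) * norm s powr (1/40) * powr_const) / norm (s - 1)"
      unfolding zeta_ext_def norm_divide using zeta_reg_strip(2)[OF s(1)] by (intro divide_right_mono) auto
    also have "\<dots> = 1 / norm (s - 1) + 2 * norm s powr (1/40) * powr_const" proof -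
      have "norm (s - 1) \<noteq> 0" using n1 by linarith
      then show ?thesis by (simp add: add_divide_distrib)
    qed
    also have "\<dots> \<le> 2 * ?w + 2 * (3 * ?w) * powr_const"
    proof (intro add_mono mult_right_mono mult_left_mono bd s powr_const_nonneg)
      have "1 / norm (s - 1) \<le> 1 / (1/2)" using n1 by (intro divide_left_mono) auto
      then have "1 / norm (s - 1) \<le> 2" by simp
      then show "1 / norm (s - 1) \<le> 2 * ?w" using w1 by linarith
    qed auto
    also have "\<dots> = C * ?w" by (simp add: C_def algebra_simps)
    finally show "norm (zeta_ext s) \<le> C * ?w" .
    have "norm (L4 s) \<le> 2 * norm s powr (1/40) * powr_const" by (rule L4_strip(2)[OF s(1)])
    also have "\<dots> \<le> 2 * (3 * ?w) * powr_const"
      by (intro mult_right_mono mult_left_mono bd s powr_const_nonneg) auto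
    also have "\<dots> \<le> C * ?w" using w1 by (simp add: C_def algebra_simps)
    finally show "norm (L4 s) \<le> C * ?w" .
  qed
qed

text \<open>Cauchy's inequality on circles of radius 1/100, which stay in the strip because 99/100 >
  79/80. Derivatives therefore grow no faster than the function. The constant is
  \<open>2! * 2 * 100 ^ 2\<close>, where the middle 2 covers the variation of \<open>Im\<close>
  along the circle.\<close>

lemma strip_deriv_bound:
  assumes hol: "f holomorphic_on strip - {1}"
    and bd: "\<And>s. s \<in> strip \<Longrightarrow> Re s \<le> 3 \<Longrightarrow> \<bar>Im s\<bar> \<ge> 1/2 \<Longrightarrow> norm (f s) \<le> B * (1 + \<bar>Im s\<bar>) powr \<alpha>"
    and a: "0 \<le> \<alpha>" "\<alpha> \<le> 1" and B: "B \<ge> 0"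
    and s: "1 \<le> Re s" "Re s \<le> 2" "\<bar>Im s\<bar> \<ge> 1" and n: "n \<le> 2"
  shows "norm ((deriv ^^ n) f s) \<le> 40000 * B * (1 + \<bar>Im s\<bar>) powr \<alpha>"
proof -
  define w where "w = (1 + \<bar>Im s\<bar>) powr \<alpha>"
  have cb: "z \<in> strip - {1} \<and> Re z \<le> 3 \<and> \<bar>Im z\<bar> \<ge> 1/2 \<and> \<bar>Im z\<bar> \<le> 1 + \<bar>Im s\<bar>" if "norm (s - z) \<le> 1/100" for z
  proof -
    have "\<bar>Re s - Re z\<bar> \<le> norm (s - z)" "\<bar>Im s - Im z\<bar> \<le> norm (s - z)"
      using abs_Re_le_cmod[of "s - z"] abs_Im_le_cmod[of "s - z"] by auto
    then show ?thesis using that s by (auto simp: strip_def)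
  qed
  have "norm ((deriv ^^ n) f s) \<le> fact n * (2 * B * w) / (1/100) ^ n"
  proof (rule Cauchy_inequality)
    have sub: "cball s (1/100) \<subseteq> strip - {1}"
    proof
      fix z assume "z \<in> cball s (1/100)"
      then show "z \<in> strip - {1}" using cb[of z] by (simp add: dist_norm)
    qed
    show "f holomorphic_on ball s (1/100)"
      using hol sub by (meson ball_subset_cball holomorphic_on_subset order.trans)
    show "continuous_on (cball s (1/100)) f"
      using hol sub by (meson holomorphic_on_imp_continuous_on holomorphic_on_subset)
    fix z assume "norm (s - z) = 1/100"
    then have z: "z \<in> strip" "Re z \<le> 3" "\<bar>Im z\<bar> \<ge> 1/2" "\<bar>Im z\<bar> \<le> 1 + \<bar>Im s\<bar>" using cb[of z] by auto
    have "norm (f z) \<le> B * (1 + \<bar>Im z\<bar>) powr \<alpha>" by (rule bd) (use z in auto)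
    also have "(1 + \<bar>Im z\<bar>) powr \<alpha> \<le> (2 * (1 + \<bar>Im s\<bar>)) powr \<alpha>" using z a by (intro powr_mono2) auto
    also have "\<dots> = 2 powr \<alpha> * w" by (subst powr_mult) (auto simp: w_def)
    also have "2 powr \<alpha> \<le> (2::real) powr 1" using a by (intro powr_mono) auto
    finally show "norm (f z) \<le> 2 * B * w" using B by (simp add: w_def mult_left_mono mult_right_mono mult_ac)
  qed simp
  also have "\<dots> = (fact n * 2 * 100 ^ n) * (B * w)" by (simp add: power_divide)
  also have "\<dots> \<le> 40000 * (B * w)"
  proof (rule mult_right_mono)
    have "n = 0 \<or> n = 1 \<or> n = 2" using n by auto
    then show "fact n * 2 * 100 ^ n \<le> (40000::real)" by (auto simp: fact_numeral)
  qed (use B in \<open>auto simp: w_def\<close>)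
  finally show ?thesis by (simp add: w_def mult.assoc)
qed

text \<open>To the right of the line this is the exponential form. On the line, the bound
  \<open>c / M ^ 4\<close> is uniform in \<open>\<sigma>\<close> and passes to the limit from the
  right.\<close>

lemma zetaK_nonzero:
  assumes "Re s \<ge> 1" "s \<noteq> 1"
  shows "zetaK s \<noteq> 0"
proof (cases "Re s > 1")
  case True
  obtain K where "K \<noteq> 0"
    "\<And>s. Re s > 1 \<Longrightarrow> zetaK s = K * exp (dseries (\<lambda>n. mangoldt4 n / ln (real n)) s)" by (rule zetaK_exp) blast
  then show ?thesis using True by simp
next
  case False
  then have Re1: "Re s = 1" using assms by simp
  define t where "t = Im s"
  have t: "t \<noteq> 0" using assms(2) Re1 by (auto simp: t_def complex_eq_iff)
  have s: "s = Complex 1 t" using Re1 by (simp add: t_def complex_eq_iff)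
  have cont: "continuous_on {1..2} (\<lambda>\<sigma>. f (Complex \<sigma> u))" if "f holomorphic_on strip - {1}" "u \<noteq> 0" for f u
  proof (rule continuous_on_compose2[OF holomorphic_on_imp_continuous_on[OF that(1)]])
    show "continuous_on {1..2} (\<lambda>\<sigma>. Complex \<sigma> u)"
      by (intro continuous_intros)
    show "(\<lambda>\<sigma>. Complex \<sigma> u) ` {1..2} \<subseteq> strip - {1}" using Complex_in_strip that(2) by auto
  qed
  have bdd: "\<exists>M. \<forall>\<sigma>\<in>{1..2}. norm (f (Complex \<sigma> u)) \<le> M" if "f holomorphic_on strip - {1}" "u \<noteq> 0" for f u
  proof -
    have "compact ((\<lambda>\<sigma>. f (Complex \<sigma> u)) ` {1..2})"
      by (rule compact_continuous_image[OF cont[OF that]]) auto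
    then have "bounded ((\<lambda>\<sigma>. f (Complex \<sigma> u)) ` {1..2})" by (rule compact_imp_bounded)
    then show ?thesis unfolding bounded_iff by blast
  qed
  have dh: "deriv zetaK holomorphic_on strip - {1}"
    by (rule holomorphic_deriv[OF zetaK_holomorphic open_strip_minus])
  have "2 * t \<noteq> 0" using t by simp
  then obtain M1 where M1: "\<And>\<sigma>. \<sigma> \<in> {1..2} \<Longrightarrow> norm (zetaK (Complex \<sigma> (2 * t))) \<le> M1"
    using bdd[OF zetaK_holomorphic, of "2 * t"] by blast
  obtain M2 where M2: "\<And>\<sigma>. \<sigma> \<in> {1..2} \<Longrightarrow> norm (deriv zetaK (Complex \<sigma> t)) \<le> M2"
    using bdd[OF dh t] by blast
  obtain c where c: "c > 0"
    "\<And>t M \<sigma>. t \<noteq> 0 \<Longrightarrow> M \<ge> 1 \<Longrightarrow> (\<And>\<sigma>. 1 < \<sigma> \<Longrightarrow> \<sigma> \<le> 2 \<Longrightarrow> norm (zetaK (Complex \<sigma> (2 * t))) \<le> M) \<Longrightarrow>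
       (\<And>\<sigma>. 1 < \<sigma> \<Longrightarrow> \<sigma> \<le> 2 \<Longrightarrow> norm (deriv zetaK (Complex \<sigma> t)) \<le> M) \<Longrightarrow> 1 < \<sigma> \<Longrightarrow> \<sigma> \<le> 2 \<Longrightarrow>
       norm (zetaK (Complex \<sigma> t)) \<ge> c / M ^ 4" by (rule zetaK_lower_bound) blast
  define M where "M = max 1 (max M1 M2)"
  have lb: "c / M ^ 4 \<le> norm (zetaK (Complex \<sigma> t))" if "\<sigma> \<in> {1<..2}" for \<sigma>
  proof (rule c(2)[OF t])
    show "M \<ge> 1" by (simp add: M_def)
    show "norm (zetaK (Complex \<sigma> (2 * t))) \<le> M" if "1 < \<sigma>" "\<sigma> \<le> 2" for \<sigma>
      using M1[of \<sigma>] that by (auto simp: M_def)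
    show "norm (deriv zetaK (Complex \<sigma> t)) \<le> M" if "1 < \<sigma>" "\<sigma> \<le> 2" for \<sigma>
      using M2[of \<sigma>] that by (auto simp: M_def)
  qed (use that in auto)
  have "continuous_on {1..2} (\<lambda>\<sigma>. norm (zetaK (Complex \<sigma> t)))"
    by (intro continuous_on_norm cont zetaK_holomorphic t)
  then have "((\<lambda>\<sigma>. norm (zetaK (Complex \<sigma> t))) \<longlongrightarrow> norm (zetaK (Complex 1 t))) (at 1 within {1..2})"
    by (auto simp: continuous_on_def)
  then have "((\<lambda>\<sigma>. norm (zetaK (Complex \<sigma> t))) \<longlongrightarrow> norm (zetaK (Complex 1 t))) (at_right 1)"
    by (simp add: at_within_Icc_at_right)
  moreover have "eventually (\<lambda>\<sigma>. c / M ^ 4 \<le> norm (zetaK (Complex \<sigma> t))) (at_right (1::real))"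
    using eventually_at_right_real[of 1 2] lb by (auto elim!: eventually_mono)
  ultimately have "c / M ^ 4 \<le> norm (zetaK (Complex 1 t))"
    by (rule tendsto_lowerbound) simp
  moreover have "c / M ^ 4 > 0" using c(1) by (simp add: M_def)
  ultimately show ?thesis unfolding s by auto
qed

lemma zetaK_reg_nonzero:
  assumes "Re s \<ge> 1"
  shows "zetaK_reg s \<noteq> 0"
proof (cases "s = 1")
  case True
  then show ?thesis using L4_real_nonzero[of 1] by (simp add: zetaK_reg_def zeta_reg_1)
next
  case False
  then show ?thesis using zetaK_nonzero[OF assms False] zetaK_reg_zetaK[OF False] by simp
qed

text \<open>Subtracting \<open>1\<close> removes the pole of the Dirichlet series at \<open>s = 1\<close>.\<close>

definition prime_coeff :: "nat \<Rightarrow> real" where "prime_coeff n = mangoldt4 n - 1"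

lemma abs_conv_gt1_prime_coeff: "abs_conv_gt1 prime_coeff"
proof -
  have "abs_conv_gt1 (\<lambda>n. mangoldt4 n + (-1))"
    by (intro abs_conv_gt1_add abs_conv_gt1_mangoldt4 abs_conv_gt1_const)
  then show ?thesis by (simp add: prime_coeff_def[abs_def])
qed

section \<open>Bounds for the logarithmic derivative and for its derivative\<close>

lemma zetaK_deriv_eq:
  assumes "Re s > 1"
  shows "deriv zetaK s = - dseries mangoldt4 s * zetaK s"
proof -
  have o: "open {s. Re s > 1}" by (rule open_halfspace_Re_gt)
  have "((\<lambda>s. dseries (\<lambda>_. 1) s * dseries chi4 s) has_field_derivative
     (- dseries (\<lambda>n. 1 * ln (real n)) s * dseries chi4 s + (- dseries (\<lambda>n. chi4 n * ln (real n)) s) * dseries (\<lambda>_. 1) s)) (at s)"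
    by (rule DERIV_mult[OF dseries_deriv[OF abs_conv_gt1_const assms] dseries_deriv[OF abs_conv_gt1_le_1[of chi4, OF chi4_le_1] assms]])
  then have "(zetaK has_field_derivative
     (- dseries (\<lambda>n. 1 * ln (real n)) s * dseries chi4 s + (- dseries (\<lambda>n. chi4 n * ln (real n)) s) * dseries (\<lambda>_. 1) s)) (at s)"
    by (rule has_field_derivative_transform_within_open[OF _ o]) (use assms in \<open>auto simp: zetaK_eq\<close>)
  note d = DERIV_imp_deriv[OF this]
  have c1: "dseries (\<lambda>n. 1 * ln (real n)) s = dseries (\<lambda>n. 1 * mangoldt n) s * dseries (\<lambda>_. 1) s"
    by (rule dseries_mangoldt_conv[of "\<lambda>_. 1" s, symmetric]) (use assms in auto)
  have c2: "dseries (\<lambda>n. chi4 n * ln (real n)) s = dseries (\<lambda>n. chi4 n * mangoldt n) s * dseries chi4 s"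
    by (rule dseries_mangoldt_conv[of chi4 s, OF chi4_mult chi4_le_1, symmetric]) (use assms in auto)
  show ?thesis
    unfolding d c1 c2 zetaK_eq[OF assms] dseries_mangoldt4[OF assms] by (simp add: algebra_simps)
qed

lemma prime_coeff_dseries:
  assumes "Re s > 1"
  shows "dseries prime_coeff s = - deriv zetaK s / zetaK s - zeta_ext s"
proof -
  have "dseries prime_coeff s = dseries (\<lambda>n. mangoldt4 n + (- 1)) s" by (simp add: prime_coeff_def[abs_def])
  also have "\<dots> = dseries mangoldt4 s + dseries (\<lambda>_. - 1) s"
    by (intro dseries_add abs_conv_gt1_mangoldt4 abs_conv_gt1_const assms)
  also have "dseries (\<lambda>_. - 1) s = - zeta_ext s"
    using dseries_minus[OF abs_conv_gt1_const[of 1] assms] zeta_ext_eq[OF assms] by simp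
  also have "dseries mangoldt4 s = - deriv zetaK s / zetaK s"
  proof -
    have "s \<noteq> 1" using assms by auto
    then show ?thesis using zetaK_deriv_eq[OF assms] zetaK_nonzero[of s] assms by (auto simp: field_simps)
  qed
  finally show ?thesis by simp
qed

text \<open>Near \<open>s = 1\<close> the simple poles of \<open>- zetaK' / zetaK\<close> and
  \<open>zeta_ext\<close> both have residue 1 and cancel. Rewritten with the regularised functions,
  the difference is holomorphic on a neighbourhood of a compact box, hence bounded there together
  with its derivative.\<close>

lemma prime_coeff_bound_small:
  obtains C where "\<And>s. 1 < Re s \<Longrightarrow> Re s \<le> 2 \<Longrightarrow> \<bar>Im s\<bar> \<le> 1 \<Longrightarrow>
     norm (dseries prime_coeff s) \<le> C \<and> norm (dseries (\<lambda>n. prime_coeff n * ln (real n)) s) \<le> C"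
proof -
  \<comment> \<open>\<open>g\<close> is \<open>zeta_ext s - 1 / (s - 1)\<close> with its removable
    singularity filled in, as \<open>zeta_reg 1 = 1\<close>.\<close>
  define g where "g = (\<lambda>s. if s = 1 then deriv zeta_reg 1 else (zeta_reg s - zeta_reg 1) / (s - 1))"
  have g: "g holomorphic_on strip"
    unfolding g_def by (rule pole_lemma_open[OF zeta_reg_strip(1) open_strip])
  define N where "N = {s \<in> strip. zetaK_reg s \<noteq> 0}"
  have N: "open N"
  proof -
    have "open (strip \<inter> zetaK_reg -` (- {0}))"
      by (rule continuous_open_preimage[OF holomorphic_on_imp_continuous_on[OF zetaK_reg_holomorphic] open_strip]) auto
    moreover have "strip \<inter> zetaK_reg -` (- {0}) = N" by (auto simp: N_def)
    ultimately show ?thesis by simp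
  qed
  define F where "F = (\<lambda>s. - deriv zetaK_reg s / zetaK_reg s - g s)"
  have sub: "N \<subseteq> strip" by (auto simp: N_def)
  have F: "F holomorphic_on N"
    unfolding F_def
    by (intro holomorphic_intros holomorphic_on_subset[OF holomorphic_deriv[OF zetaK_reg_holomorphic open_strip] sub]
        holomorphic_on_subset[OF zetaK_reg_holomorphic sub] holomorphic_on_subset[OF g sub]) (auto simp: N_def)
  have eq: "F s = dseries prime_coeff s" if s: "Re s > 1" for s
  proof -
    have s1: "s \<noteq> 1" using s by auto
    have z0: "zetaK s \<noteq> 0" using zetaK_nonzero[of s] s s1 by simp
    have "((\<lambda>s. (s - 1) * zetaK s) has_field_derivative (1 * zetaK s + deriv zetaK s * (s - 1))) (at s)"
      by (rule DERIV_mult[OF _ holomorphic_derivI[OF zetaK_holomorphic open_strip_minus]])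
         (use s s1 in \<open>auto intro!: derivative_eq_intros simp: strip_def\<close>)
    then have "(zetaK_reg has_field_derivative (1 * zetaK s + deriv zetaK s * (s - 1))) (at s)"
      by (rule has_field_derivative_transform_within_open[OF _ open_halfspace_Re_gt[of 1]])
         (use s in \<open>auto intro!: zetaK_reg_zetaK[symmetric]\<close>)
    note d = DERIV_imp_deriv[OF this]
    have "F s = - (1 * zetaK s + deriv zetaK s * (s - 1)) / ((s - 1) * zetaK s) - (zeta_reg s - 1) / (s - 1)"
      unfolding F_def d zetaK_reg_zetaK[OF s1] using s1 by (simp add: g_def zeta_reg_1)
    also have "\<dots> = - deriv zetaK s / zetaK s - zeta_ext s"
    proof -
      have "- (1 * z + d * a) / (a * z) - (r - 1) / a = - d / z - r / a" if "a \<noteq> 0" "z \<noteq> 0" for a z d r :: complex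
        using that by (simp add: field_simps)
      from this[of "s - 1" "zetaK s"] show ?thesis using s1 z0 unfolding zeta_ext_def by simp
    qed
    also have "\<dots> = dseries prime_coeff s" using prime_coeff_dseries[OF s] by simp
    finally show ?thesis .
  qed
  have deq: "deriv F s = - dseries (\<lambda>n. prime_coeff n * ln (real n)) s" if s: "Re s > 1" for s
  proof (rule DERIV_imp_deriv)
    show "(F has_field_derivative - dseries (\<lambda>n. prime_coeff n * ln (real n)) s) (at s)"
      by (rule has_field_derivative_transform_within_open[OF dseries_deriv[OF abs_conv_gt1_prime_coeff s] open_halfspace_Re_gt[of 1]])
         (use s eq in auto)
  qed
  define Q where "Q = cbox (Complex 1 (-1)) (Complex 2 1)"
  have Q: "z \<in> Q \<longleftrightarrow> 1 \<le> Re z \<and> Re z \<le> 2 \<and> -1 \<le> Im z \<and> Im z \<le> 1" for z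
    by (simp add: Q_def in_cbox_complex_iff)
  have QN: "Q \<subseteq> N" using zetaK_reg_nonzero by (auto simp: Q N_def strip_def)
  have cQ: "compact Q" by (simp add: Q_def)
  have bdd: "\<exists>M. \<forall>z\<in>Q. norm (f z) \<le> M" if "f holomorphic_on N" for f
  proof -
    have "compact (f ` Q)"
      by (rule compact_continuous_image[OF _ cQ]) (rule continuous_on_subset[OF holomorphic_on_imp_continuous_on[OF that] QN])
    then have "bounded (f ` Q)" by (rule compact_imp_bounded)
    then show ?thesis unfolding bounded_iff by blast
  qed
  obtain M1 where M1: "\<And>z. z \<in> Q \<Longrightarrow> norm (F z) \<le> M1" using bdd[OF F] by blast
  obtain M2 where M2: "\<And>z. z \<in> Q \<Longrightarrow> norm (deriv F z) \<le> M2" using bdd[OF holomorphic_deriv[OF F N]] by blast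
  show ?thesis
  proof (rule that[of "max M1 M2"])
    fix s assume s: "1 < Re s" "Re s \<le> 2" "\<bar>Im s\<bar> \<le> 1"
    then have "s \<in> Q" by (auto simp: Q)
    then show "norm (dseries prime_coeff s) \<le> max M1 M2 \<and> norm (dseries (\<lambda>n. prime_coeff n * ln (real n)) s) \<le> max M1 M2"
      using M1[of s] M2[of s] eq[OF s(1)] deq[OF s(1)] by auto
  qed
qed

text \<open>With \<open>zetaK\<close> and its first two derivatives bounded by \<open>M\<close>, the
  3-4-1 bound gives \<open>1 / norm (zetaK s) \<le> M ^ 4 / c\<close>. The worst term is the square
  of \<open>zetaK' / zetaK\<close>, of size \<open>M ^ 10\<close>; as \<open>M\<close> is of order
  \<open>(1 + \<bar>Im s\<bar>) powr (1/20)\<close>, the total exponent is 1/2.\<close>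

lemma prime_coeff_bound_large:
  obtains C where "\<And>s. 1 < Re s \<Longrightarrow> Re s \<le> 2 \<Longrightarrow> \<bar>Im s\<bar> \<ge> 1 \<Longrightarrow>
     norm (dseries prime_coeff s) \<le> C * (1 + \<bar>Im s\<bar>) powr (1/2) \<and>
     norm (dseries (\<lambda>n. prime_coeff n * ln (real n)) s) \<le> C * (1 + \<bar>Im s\<bar>) powr (1/2)"
proof -
  obtain C where C: "C \<ge> 1"
    "\<And>s. s \<in> strip \<Longrightarrow> Re s \<le> 3 \<Longrightarrow> \<bar>Im s\<bar> \<ge> 1/2 \<Longrightarrow> norm (zeta_ext s) \<le> C * (1 + \<bar>Im s\<bar>) powr (1/40)"
    "\<And>s. s \<in> strip \<Longrightarrow> Re s \<le> 3 \<Longrightarrow> \<bar>Im s\<bar> \<ge> 1/2 \<Longrightarrow> norm (L4 s) \<le> C * (1 + \<bar>Im s\<bar>) powr (1/40)"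
    by (rule strip_growth) blast
  obtain c where c: "c > 0"
    "\<And>t M \<sigma>. t \<noteq> 0 \<Longrightarrow> M \<ge> 1 \<Longrightarrow> (\<And>\<sigma>. 1 < \<sigma> \<Longrightarrow> \<sigma> \<le> 2 \<Longrightarrow> norm (zetaK (Complex \<sigma> (2 * t))) \<le> M) \<Longrightarrow>
       (\<And>\<sigma>. 1 < \<sigma> \<Longrightarrow> \<sigma> \<le> 2 \<Longrightarrow> norm (deriv zetaK (Complex \<sigma> t)) \<le> M) \<Longrightarrow> 1 < \<sigma> \<Longrightarrow> \<sigma> \<le> 2 \<Longrightarrow>
       norm (zetaK (Complex \<sigma> t)) \<ge> c / M ^ 4" by (rule zetaK_lower_bound) blast
  have Kbd: "norm (zetaK s) \<le> C\<^sup>2 * (1 + \<bar>Im s\<bar>) powr (1/20)" if "s \<in> strip" "Re s \<le> 3" "\<bar>Im s\<bar> \<ge> 1/2" for s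
  proof -
    have "norm (zetaK s) \<le> (C * (1 + \<bar>Im s\<bar>) powr (1/40)) * (C * (1 + \<bar>Im s\<bar>) powr (1/40))"
      unfolding zetaK_def norm_mult using C that by (intro mult_mono) auto
    also have "\<dots> = C\<^sup>2 * (1 + \<bar>Im s\<bar>) powr (1/20)"
      by (simp add: power2_eq_square powr_add[symmetric] mult_ac)
    finally show ?thesis .
  qed
  have zbd: "norm (zeta_ext s) \<le> C\<^sup>2 * (1 + \<bar>Im s\<bar>) powr (1/20)" if "s \<in> strip" "Re s \<le> 3" "\<bar>Im s\<bar> \<ge> 1/2" for s
  proof -
    have "norm (zeta_ext s) \<le> C * (1 + \<bar>Im s\<bar>) powr (1/40)" using C that by blast
    also have "\<dots> \<le> C\<^sup>2 * (1 + \<bar>Im s\<bar>) powr (1/20)"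
      using C(1) by (intro mult_mono powr_mono) (auto simp: power2_eq_square)
    finally show ?thesis .
  qed
  define D where "D = 40000 * C\<^sup>2"
  have D1: "D \<ge> 1"
  proof -
    have "C\<^sup>2 \<ge> 1" using C(1) by (rule one_le_power)
    then show ?thesis unfolding D_def by linarith
  qed
  have K: "norm ((deriv ^^ n) zetaK s) \<le> D * (1 + \<bar>Im s\<bar>) powr (1/20)"
    if "1 \<le> Re s" "Re s \<le> 2" "\<bar>Im s\<bar> \<ge> 1" "n \<le> 2" for s n
    unfolding D_def by (rule strip_deriv_bound[OF zetaK_holomorphic Kbd]) (use that in auto)
  have Z: "norm ((deriv ^^ n) zeta_ext s) \<le> D * (1 + \<bar>Im s\<bar>) powr (1/20)"
    if "1 \<le> Re s" "Re s \<le> 2" "\<bar>Im s\<bar> \<ge> 1" "n \<le> 2" for s n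
    unfolding D_def by (rule strip_deriv_bound[OF zeta_ext_holomorphic zbd]) (use that in auto)
  have fin: "norm (dseries prime_coeff s) \<le> (1/c + 1/c\<^sup>2 + 1) * (2 * D) ^ 10 * (1 + \<bar>Im s\<bar>) powr (1/2) \<and>
     norm (dseries (\<lambda>n. prime_coeff n * ln (real n)) s) \<le> (1/c + 1/c\<^sup>2 + 1) * (2 * D) ^ 10 * (1 + \<bar>Im s\<bar>) powr (1/2)"
    if s: "1 < Re s" "Re s \<le> 2" "\<bar>Im s\<bar> \<ge> 1" for s
  proof -
    define t where "t = Im s"
    define w where "w = (1 + \<bar>t\<bar>) powr (1/20)"
    \<comment> \<open>The factor 2 absorbs the growth from height \<open>t\<close> to
      \<open>2 * t\<close>, where the 3-4-1 inequality also needs an upper bound.\<close>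
    define M where "M = 2 * D * w"
    have w1: "w \<ge> 1" unfolding w_def by (rule ge_one_powr_ge_zero) auto
    have "2 * D * w \<ge> 2 * 1 * 1" using D1 w1 by (intro mult_mono) auto
    then have M1: "M \<ge> 1" by (simp add: M_def)
    have DM: "D * w \<le> M" using D1 w1 by (simp add: M_def)
    have se: "s = Complex (Re s) t" by (simp add: t_def)
    have lb: "c / M ^ 4 \<le> norm (zetaK s)"
    proof (subst se, rule c(2))
      show "norm (zetaK (Complex \<sigma> (2 * t))) \<le> M" if "1 < \<sigma>" "\<sigma> \<le> 2" for \<sigma>
      proof -
        have "norm (zetaK (Complex \<sigma> (2 * t))) \<le> D * (1 + \<bar>2 * t\<bar>) powr (1/20)"
          using K[of "Complex \<sigma> (2 * t)" 0] that s by (simp add: t_def)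
        also have "(1 + \<bar>2 * t\<bar>) powr (1/20) \<le> (2 * (1 + \<bar>t\<bar>)) powr (1/20)" by (intro powr_mono2) auto
        also have "\<dots> = 2 powr (1/20) * w" by (subst powr_mult) (auto simp: w_def)
        also have "2 powr (1/20) \<le> (2::real) powr 1" by (rule powr_mono) auto
        finally show ?thesis using D1 w1 by (simp add: M_def mult_ac mult_left_mono mult_right_mono)
      qed
      show "norm (deriv zetaK (Complex \<sigma> t)) \<le> M" if "1 < \<sigma>" "\<sigma> \<le> 2" for \<sigma>
        using K[of "Complex \<sigma> t" 1] that s DM by (simp add: t_def w_def)
    qed (use s M1 in \<open>auto simp: t_def\<close>)
    have z0: "zetaK s \<noteq> 0" using lb c(1) M1 by (auto simp: divide_simps)
    have inv: "1 / norm (zetaK s) \<le> M ^ 4 / c"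
    proof -
      have "c / M ^ 4 > 0" using c(1) M1 by simp
      then have "1 / norm (zetaK s) \<le> 1 / (c / M ^ 4)" using lb z0 by (intro divide_left_mono mult_pos_pos) auto
      then show ?thesis by simp
    qed
    have K1: "norm (deriv zetaK s) \<le> M" using K[of s 1] s DM by (simp add: t_def w_def)
    have K2: "norm (deriv (deriv zetaK) s) \<le> M" using K[of s 2] s DM by (simp add: t_def w_def numeral_2_eq_2)
    have Z0: "norm (zeta_ext s) \<le> M" using Z[of s 0] s DM by (simp add: t_def w_def)
    have Z1: "norm (deriv zeta_ext s) \<le> M" using Z[of s 1] s DM by (simp add: t_def w_def)
    have Mpow: "M ^ 10 = (2 * D) ^ 10 * (1 + \<bar>Im s\<bar>) powr (1/2)"
    proof -
      have "w ^ 10 = (1 + \<bar>Im s\<bar>) powr (1/20 * 10)"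
        unfolding w_def t_def by (simp add: powr_power)
      then show ?thesis by (simp add: M_def power_mult_distrib)
    qed
    have Mle: "M ^ k \<le> M ^ 10" if "k \<le> 10" for k using M1 that by (intro power_increasing) auto
    have q1: "norm (deriv zetaK s / zetaK s) \<le> M ^ 5 / c"
    proof -
      have "norm (deriv zetaK s) * (1 / norm (zetaK s)) \<le> M * (M ^ 4 / c)"
        using K1 inv M1 by (intro mult_mono) auto
      then show ?thesis by (simp add: norm_divide power_numeral_reduce)
    qed
    have q2: "norm (deriv (deriv zetaK) s / zetaK s) \<le> M ^ 5 / c"
    proof -
      have "norm (deriv (deriv zetaK) s) * (1 / norm (zetaK s)) \<le> M * (M ^ 4 / c)"
        using K2 inv M1 by (intro mult_mono) auto
      then show ?thesis by (simp add: norm_divide power_numeral_reduce)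
    qed
    have q3: "norm ((deriv zetaK s / zetaK s)\<^sup>2) \<le> M ^ 10 / c\<^sup>2"
    proof -
      have "norm ((deriv zetaK s / zetaK s)\<^sup>2) \<le> (M ^ 5 / c)\<^sup>2"
        unfolding norm_power using q1 by (intro power_mono) auto
      then show ?thesis by (simp add: power_divide power_mult[symmetric])
    qed
    have b5: "M ^ 5 / c \<le> M ^ 10 / c" using Mle[of 5] c(1) by (intro divide_right_mono) auto
    have b1: "M \<le> M ^ 10" using Mle[of 1] by simp
    have b0: "M ^ 10 / c\<^sup>2 \<ge> 0" using M1 c(1) by simp
    have "norm (dseries prime_coeff s) \<le> M ^ 10 / c + M ^ 10 / c\<^sup>2 + M ^ 10"
    proof -
      have "norm (dseries prime_coeff s) \<le> norm (deriv zetaK s / zetaK s) + norm (zeta_ext s)"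
        unfolding prime_coeff_dseries[OF s(1)] using norm_triangle_ineq4[of "- deriv zetaK s / zetaK s" "zeta_ext s"] by simp
      then show ?thesis using q1 Z0 b5 b1 b0 by linarith
    qed
    moreover have "norm (dseries (\<lambda>n. prime_coeff n * ln (real n)) s) \<le> M ^ 10 / c + M ^ 10 / c\<^sup>2 + M ^ 10"
    proof -
      have sS: "s \<in> strip - {1}" using s by (auto simp: strip_def)
      have "((\<lambda>s. - (deriv zetaK s / zetaK s) - zeta_ext s) has_field_derivative
          - ((deriv (deriv zetaK) s * zetaK s - deriv zetaK s * deriv zetaK s) / (zetaK s * zetaK s)) - deriv zeta_ext s) (at s)"
        by (intro DERIV_diff DERIV_minus DERIV_divide z0
            holomorphic_derivI[OF zetaK_holomorphic open_strip_minus sS]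
            holomorphic_derivI[OF zeta_ext_holomorphic open_strip_minus sS]
            holomorphic_derivI[OF holomorphic_deriv[OF zetaK_holomorphic open_strip_minus] open_strip_minus sS])
      then have "(dseries prime_coeff has_field_derivative
          - ((deriv (deriv zetaK) s * zetaK s - deriv zetaK s * deriv zetaK s) / (zetaK s * zetaK s)) - deriv zeta_ext s) (at s)"
        by (rule has_field_derivative_transform_within_open[OF _ open_halfspace_Re_gt[of 1]])
           (use s prime_coeff_dseries in auto)
      with dseries_deriv[OF abs_conv_gt1_prime_coeff s(1)]
      have "- dseries (\<lambda>n. prime_coeff n * ln (real n)) s =
         - ((deriv (deriv zetaK) s * zetaK s - deriv zetaK s * deriv zetaK s) / (zetaK s * zetaK s)) - deriv zeta_ext s"
        by (rule DERIV_unique)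
      also have "\<dots> = - (deriv (deriv zetaK) s / zetaK s) + (deriv zetaK s / zetaK s)\<^sup>2 - deriv zeta_ext s"
        using z0 by (simp add: field_simps power2_eq_square)
      finally have "norm (- dseries (\<lambda>n. prime_coeff n * ln (real n)) s) =
         norm (- (deriv (deriv zetaK) s / zetaK s) + (deriv zetaK s / zetaK s)\<^sup>2 - deriv zeta_ext s)" by simp
      also have "\<dots> \<le> norm (- (deriv (deriv zetaK) s / zetaK s)) + norm ((deriv zetaK s / zetaK s)\<^sup>2) + norm (deriv zeta_ext s)"
        by (rule order.trans[OF norm_triangle_ineq4]) (intro add_mono norm_triangle_ineq order_refl)
      also have "\<dots> \<le> M ^ 10 / c + M ^ 10 / c\<^sup>2 + M ^ 10"
        using q2 q3 Z1 b5 b1 by (simp only: norm_minus_cancel)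
      finally show ?thesis by simp
    qed
    moreover have "M ^ 10 / c + M ^ 10 / c\<^sup>2 + M ^ 10 = (1/c + 1/c\<^sup>2 + 1) * (2 * D) ^ 10 * (1 + \<bar>Im s\<bar>) powr (1/2)"
      unfolding Mpow by (simp add: algebra_simps)
    ultimately show ?thesis by simp
  qed
  show ?thesis by (rule that[OF fin])
qed

theorem prime_coeff_bound:
  obtains C where "C > 0" "\<And>s. 1 < Re s \<Longrightarrow> Re s \<le> 2 \<Longrightarrow>
     norm (dseries prime_coeff s) \<le> C * (1 + \<bar>Im s\<bar>) powr (1/2) \<and>
     norm (dseries (\<lambda>n. prime_coeff n * ln (real n)) s) \<le> C * (1 + \<bar>Im s\<bar>) powr (1/2)"
proof -
  obtain C1 where C1: "\<And>s. 1 < Re s \<Longrightarrow> Re s \<le> 2 \<Longrightarrow> \<bar>Im s\<bar> \<le> 1 \<Longrightarrow>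
     norm (dseries prime_coeff s) \<le> C1 \<and> norm (dseries (\<lambda>n. prime_coeff n * ln (real n)) s) \<le> C1"
    by (rule prime_coeff_bound_small) blast
  obtain C2 where C2: "\<And>s. 1 < Re s \<Longrightarrow> Re s \<le> 2 \<Longrightarrow> \<bar>Im s\<bar> \<ge> 1 \<Longrightarrow>
     norm (dseries prime_coeff s) \<le> C2 * (1 + \<bar>Im s\<bar>) powr (1/2) \<and>
     norm (dseries (\<lambda>n. prime_coeff n * ln (real n)) s) \<le> C2 * (1 + \<bar>Im s\<bar>) powr (1/2)"
    by (rule prime_coeff_bound_large) blast
  define C where "C = max 1 (max C1 C2)"
  show ?thesis
  proof (rule that[of C])
    show "C > 0" by (simp add: C_def)
    fix s assume s: "1 < Re s" "Re s \<le> 2"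
    have w1: "(1 + \<bar>Im s\<bar>) powr (1/2) \<ge> 1" by (rule ge_one_powr_ge_zero) auto
    have "C1 \<le> C * (1 + \<bar>Im s\<bar>) powr (1/2)"
    proof -
      have "C1 \<le> C * 1" by (simp add: C_def)
      also have "\<dots> \<le> C * (1 + \<bar>Im s\<bar>) powr (1/2)" using w1 by (intro mult_left_mono) (auto simp: C_def)
      finally show ?thesis .
    qed
    moreover have "C2 * (1 + \<bar>Im s\<bar>) powr (1/2) \<le> C * (1 + \<bar>Im s\<bar>) powr (1/2)"
      by (intro mult_right_mono) (auto simp: C_def)
    ultimately show "norm (dseries prime_coeff s) \<le> C * (1 + \<bar>Im s\<bar>) powr (1/2) \<and>
     norm (dseries (\<lambda>n. prime_coeff n * ln (real n)) s) \<le> C * (1 + \<bar>Im s\<bar>) powr (1/2)"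
      using C1[OF s] C2[OF s] by (meson linear order.trans)
  qed
qed

section \<open>A Tauberian estimate\<close>

lemma std_normal_density_char:
  "complex_of_real (exp (- (w\<^sup>2) / 2)) = (CLINT x|lborel. std_normal_density x *\<^sub>R iexp (w * x))"
proof -
  have "complex_of_real (exp (- (w\<^sup>2) / 2)) = char std_normal_distribution w"
    by (simp add: char_std_normal_distribution)
  also have "\<dots> = (CLINT x|lborel. std_normal_density x *\<^sub>R iexp (w * x))"
    unfolding char_def by (subst integral_density) (auto simp: normal_density_nonneg)
  finally show ?thesis .
qed

text \<open>The Gaussian is its own characteristic function, so averaging \<open>v\<close> against it is bounded by the Fourier transform of \<open>v\<close>.\<close>

lemma fourier_smoothing_bound:
  fixes v :: "real \<Rightarrow> complex"
  assumes cont: "continuous_on UNIV v" and int: "integrable lborel v"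
    and ft: "\<And>t. norm (CLINT u|lborel. v u * iexp (t * u)) \<le> k t" and k: "integrable lborel k"
    and e: "\<epsilon> > 0"
  shows "norm (CLINT w|lborel. v (u0 + \<epsilon> * w) * std_normal_density w) \<le> (LINT t|lborel. k t)"
proof -
  have vm [measurable]: "v \<in> borel_measurable borel" using cont by (rule borel_measurable_continuous_onI)
  have k0: "k t \<ge> 0" for t using ft[of t] norm_ge_zero order.trans by blast
  have intv: "integrable lborel (\<lambda>w. v (u0 + \<epsilon> * w))"
    using lborel_integrable_real_affine[OF int, of \<epsilon> u0] e by simp
  have n0: "0 \<le> std_normal_density x" for x by (rule normal_density_nonneg)
  have intn: "integrable lborel std_normal_density" by (rule integrable_normal_density) simp
  \<comment> \<open>The order of integration decides the meaning of \<open>f\<close>: over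
    \<open>x\<close> first it gives the Gaussian weight in \<open>w\<close>, over \<open>w\<close>
    first it gives, up to a factor of modulus 1 and a scaling, the Fourier transform of
    \<open>v\<close> at \<open>x / \<epsilon>\<close>.\<close>
  define f where "f = (\<lambda>w x. (std_normal_density x *\<^sub>R iexp (w * x)) * v (u0 + \<epsilon> * w))"
  have fm: "case_prod f \<in> borel_measurable (lborel \<Otimes>\<^sub>M lborel)"
    unfolding f_def by measurable
  have nf: "norm (f w x) = std_normal_density x * norm (v (u0 + \<epsilon> * w))" for w x
    using n0[of x] by (simp add: f_def norm_mult)
  have fi: "integrable (lborel \<Otimes>\<^sub>M lborel) (case_prod f)"
  proof (rule lborel_pair.Fubini_integrable[OF fm])
    have "(\<lambda>w. LINT x|lborel. norm (case_prod f (w, x))) = (\<lambda>w. norm (v (u0 + \<epsilon> * w)))"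
      by (simp add: nf)
    then show "integrable lborel (\<lambda>w. LINT x|lborel. norm (case_prod f (w, x)))"
      using intv by simp
    show "AE w in lborel. integrable lborel (\<lambda>x. case_prod f (w, x))"
    proof (rule AE_I2)
      fix w :: real
      have "integrable lborel (\<lambda>x. std_normal_density x * norm (v (u0 + \<epsilon> * w)))"
        using intn by (intro integrable_mult_left) auto
      then show "integrable lborel (\<lambda>x. case_prod f (w, x))"
        by (rule Bochner_Integration.integrable_bound) (use n0 in \<open>auto simp: nf abs_mult, auto simp: f_def\<close>)
    qed
  qed
  have inner: "norm (CLINT w|lborel. f w x) \<le> std_normal_density x * (k (x / \<epsilon>) / \<epsilon>)" for x
  proof -
    have "(CLINT u|lborel. v u * iexp (x / \<epsilon> * u)) = \<bar>\<epsilon>\<bar> *\<^sub>R (CLINT w|lborel. v (u0 + \<epsilon> * w) * iexp (x / \<epsilon> * (u0 + \<epsilon> * w)))"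
      by (rule lborel_integral_real_affine) (use e in simp)
    also have "(\<lambda>w. v (u0 + \<epsilon> * w) * iexp (x / \<epsilon> * (u0 + \<epsilon> * w))) = (\<lambda>w. iexp (x / \<epsilon> * u0) * (iexp (w * x) * v (u0 + \<epsilon> * w)))"
    proof
      fix w
      have "x / \<epsilon> * (u0 + \<epsilon> * w) = x / \<epsilon> * u0 + w * x" using e by (simp add: field_simps)
      then have "iexp (x / \<epsilon> * (u0 + \<epsilon> * w)) = iexp (x / \<epsilon> * u0) * iexp (w * x)"
        by (simp only: of_real_add distrib_left exp_add)
      then show "v (u0 + \<epsilon> * w) * iexp (x / \<epsilon> * (u0 + \<epsilon> * w)) = iexp (x / \<epsilon> * u0) * (iexp (w * x) * v (u0 + \<epsilon> * w))"
        by (simp only: mult_ac)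
    qed
    finally have "norm (CLINT u|lborel. v u * iexp (x / \<epsilon> * u)) = \<epsilon> * norm (CLINT w|lborel. iexp (w * x) * v (u0 + \<epsilon> * w))"
      using e by (simp add: norm_mult)
    then have "\<epsilon> * norm (CLINT w|lborel. iexp (w * x) * v (u0 + \<epsilon> * w)) \<le> k (x / \<epsilon>)" using ft[of "x / \<epsilon>"] by simp
    then have "norm (CLINT w|lborel. iexp (w * x) * v (u0 + \<epsilon> * w)) \<le> k (x / \<epsilon>) / \<epsilon>"
      using e by (simp add: field_simps)
    from mult_left_mono[OF this n0[of x]]
    have "std_normal_density x * norm (CLINT w|lborel. iexp (w * x) * v (u0 + \<epsilon> * w)) \<le> std_normal_density x * (k (x / \<epsilon>) / \<epsilon>)" .
    moreover have "(CLINT w|lborel. f w x) = std_normal_density x *\<^sub>R (CLINT w|lborel. iexp (w * x) * v (u0 + \<epsilon> * w))"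
      unfolding f_def by (simp add: scaleR_conv_of_real mult.assoc)
    ultimately show ?thesis using n0[of x] by (simp only: norm_scaleR abs_of_nonneg)
  qed
  have kint: "integrable lborel (\<lambda>x. k (x / \<epsilon>) / \<epsilon>)"
    using lborel_integrable_real_affine[OF k, of "1 / \<epsilon>" 0] e by simp
  have kval: "(LINT x|lborel. k (x / \<epsilon>) / \<epsilon>) = (LINT t|lborel. k t)"
    using lborel_integral_real_affine[of "1 / \<epsilon>" k 0] e by simp
  have nle: "std_normal_density x \<le> 1" for x
  proof -
    have "exp (- (x\<^sup>2) / 2) \<le> 1" by simp
    moreover have "sqrt (2 * pi) \<ge> 1" using pi_ge_two by simp
    ultimately have "1 / sqrt (2 * pi) * exp (- (x\<^sup>2) / 2) \<le> 1 * 1" by (intro mult_mono) (auto simp: divide_simps)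
    then show ?thesis by (simp add: std_normal_density_def)
  qed
  have "(CLINT w|lborel. v (u0 + \<epsilon> * w) * std_normal_density w) = (CLINT w|lborel. (1 / sqrt (2 * pi)) *\<^sub>R (CLINT x|lborel. f w x))"
  proof (intro Bochner_Integration.integral_cong refl)
    fix w
    have "(CLINT x|lborel. f w x) = complex_of_real (exp (- (w\<^sup>2) / 2)) * v (u0 + \<epsilon> * w)"
      unfolding f_def std_normal_density_char by (subst integral_mult_left_zero) auto
    then show "v (u0 + \<epsilon> * w) * complex_of_real (std_normal_density w) = (1 / sqrt (2 * pi)) *\<^sub>R (CLINT x|lborel. f w x)"
      by (simp add: std_normal_density_def scaleR_conv_of_real)
  qed
  also have "\<dots> = (1 / sqrt (2 * pi)) *\<^sub>R (CLINT w|lborel. CLINT x|lborel. f w x)" by simp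
  also have "(CLINT w|lborel. CLINT x|lborel. f w x) = (CLINT x|lborel. CLINT w|lborel. f w x)"
    by (rule lborel_pair.Fubini_integral[OF fi, symmetric])
  also have "norm ((1 / sqrt (2 * pi)) *\<^sub>R \<dots>) \<le> 1 * norm (CLINT x|lborel. CLINT w|lborel. f w x)"
    unfolding norm_scaleR using pi_ge_two by (intro mult_right_mono) (auto simp: divide_simps)
  also have "\<dots> \<le> 1 * (LINT x|lborel. norm (CLINT w|lborel. f w x))"
    by (intro mult_left_mono integral_norm_bound) auto
  also have "(LINT x|lborel. norm (CLINT w|lborel. f w x)) \<le> (LINT x|lborel. k (x / \<epsilon>) / \<epsilon>)"
  proof (rule integral_mono[OF _ kint])
    show "integrable lborel (\<lambda>x. norm (CLINT w|lborel. f w x))"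
      using lborel_pair.integrable_snd[OF fi] by simp
    fix x
    have "norm (CLINT w|lborel. f w x) \<le> std_normal_density x * (k (x / \<epsilon>) / \<epsilon>)" by (rule inner)
    also have "\<dots> \<le> 1 * (k (x / \<epsilon>) / \<epsilon>)" using k0 e nle by (intro mult_right_mono) auto
    finally show "norm (CLINT w|lborel. f w x) \<le> k (x / \<epsilon>) / \<epsilon>" by simp
  qed
  finally show ?thesis using kval by simp
qed

text \<open>As \<open>\<epsilon>\<close> tends to 0 the Gaussian averages converge to
  \<open>v u0\<close>, with \<open>B\<close> times the density as majorant. The supremum is thus
  controlled by the Fourier side without inverting the transform.\<close>

lemma fourier_sup_bound:
  fixes v :: "real \<Rightarrow> complex"
  assumes cont: "continuous_on UNIV v" and bdd: "\<And>u. norm (v u) \<le> B" and int: "integrable lborel v"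
    and ft: "\<And>t. norm (CLINT u|lborel. v u * iexp (t * u)) \<le> k t" and k: "integrable lborel k"
  shows "norm (v u0) \<le> (LINT t|lborel. k t)"
proof -
  have vm [measurable]: "v \<in> borel_measurable borel" using cont by (rule borel_measurable_continuous_onI)
  have intn: "integrable lborel std_normal_density" by (rule integrable_normal_density) simp
  have "(\<lambda>n. CLINT w|lborel. v (u0 + 1 / real (Suc n) * w) * std_normal_density w) \<longlonglongrightarrow> (CLINT w|lborel. v u0 * std_normal_density w)"
  proof (rule integral_dominated_convergence[where w = "\<lambda>w. B * std_normal_density w"])
    show "integrable lborel (\<lambda>w. B * std_normal_density w)" by (rule integrable_mult_right) (rule intn)
    show "AE w in lborel. norm (v (u0 + 1 / real (Suc n) * w) * complex_of_real (std_normal_density w)) \<le> B * std_normal_density w" for n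
      using bdd by (intro AE_I2) (auto simp: norm_mult intro!: mult_right_mono)
    show "AE w in lborel. (\<lambda>n. v (u0 + 1 / real (Suc n) * w) * complex_of_real (std_normal_density w)) \<longlonglongrightarrow> v u0 * std_normal_density w"
    proof (intro AE_I2 tendsto_mult tendsto_const)
      fix w :: real
      have "(\<lambda>n. u0 + 1 / real (Suc n) * w) \<longlonglongrightarrow> u0 + 0 * w"
        by (intro tendsto_intros LIMSEQ_Suc lim_1_over_n)
      then have l: "(\<lambda>n. u0 + 1 / real (Suc n) * w) \<longlonglongrightarrow> u0" by simp
      have "isCont v u0" using cont by (simp add: continuous_on_eq_continuous_at)
      from isCont_tendsto_compose[OF this l] show "(\<lambda>n. v (u0 + 1 / real (Suc n) * w)) \<longlonglongrightarrow> v u0" .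
    qed
  qed (auto intro!: borel_measurable_times)
  moreover have "(CLINT w|lborel. v u0 * std_normal_density w) = v u0"
  proof -
    have "(CLINT w|lborel. v u0 * std_normal_density w) = v u0 * (CLINT w|lborel. complex_of_real (std_normal_density w))" by simp
    also have "(CLINT w|lborel. complex_of_real (std_normal_density w)) = complex_of_real (LINT w|lborel. std_normal_density w)"
      by (rule integral_of_real[OF intn])
    finally show ?thesis by simp
  qed
  ultimately have "(\<lambda>n. CLINT w|lborel. v (u0 + 1 / real (Suc n) * w) * std_normal_density w) \<longlonglongrightarrow> v u0"
    by (simp only:)
  from tendsto_norm[OF this]
  have "(\<lambda>n. norm (CLINT w|lborel. v (u0 + 1 / real (Suc n) * w) * std_normal_density w)) \<longlonglongrightarrow> norm (v u0)" .
  then show ?thesis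
  proof (rule LIMSEQ_le_const2)
    show "\<exists>N. \<forall>n\<ge>N. norm (CLINT w|lborel. v (u0 + 1 / real (Suc n) * w) * std_normal_density w) \<le> (LINT t|lborel. k t)"
      by (intro exI[of _ 0] allI impI fourier_smoothing_bound[OF cont int ft k]) simp
  qed
qed

section \<open>Laplace transforms of the Cesaro terms\<close>

lemma integral_u_exp_real:
  fixes c a :: real assumes "c > 0" "a \<ge> 0"
  shows "set_integrable lborel {a<..} (\<lambda>u. u * exp (- c * u))"
    and "(LINT u:{a<..}|lborel. u * exp (- c * u)) = exp (- c * a) * (a / c + 1 / c\<^sup>2)"
proof -
  define F where "F = (\<lambda>u. - ((u / c + 1 / c\<^sup>2) * exp (- c * u)))"
  have F: "(F has_real_derivative u * exp (- c * u)) (at u)" for u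
    unfolding F_def using assms(1)
    by (auto intro!: derivative_eq_intros simp: field_simps power2_eq_square)
  have lim: "(F \<longlongrightarrow> 0) at_top" unfolding F_def using assms(1) by real_asymp
  have contF: "isCont F a" using F by (rule DERIV_isCont)
  have *: "set_integrable lborel (einterval (ereal a) \<infinity>) (\<lambda>u. u * exp (- c * u))"
    "(LBINT u=ereal a..\<infinity>. u * exp (- c * u)) = 0 - F a"
  proof -
    show "set_integrable lborel (einterval (ereal a) \<infinity>) (\<lambda>u. u * exp (- c * u))"
      by (rule interval_integral_FTC_nonneg(1)[where F = F and A = "F a" and B = 0])
         (use assms F lim contF in \<open>auto intro!: tendsto_eq_intros AE_I2 simp: at_left_PInf filterlim_filtermap ereal_tendsto_simps isCont_def
           filterlim_at_split continuous_intros\<close>)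
    show "(LBINT u=ereal a..\<infinity>. u * exp (- c * u)) = 0 - F a"
      by (rule interval_integral_FTC_nonneg(2)[where F = F and A = "F a" and B = 0])
         (use assms F lim contF in \<open>auto intro!: tendsto_eq_intros AE_I2 simp: ereal_tendsto_simps isCont_def
           filterlim_at_split continuous_intros\<close>)
  qed
  then show "set_integrable lborel {a<..} (\<lambda>u. u * exp (- c * u))" by simp
  show "(LINT u:{a<..}|lborel. u * exp (- c * u)) = exp (- c * a) * (a / c + 1 / c\<^sup>2)"
    using *(2) by (simp add: interval_lebesgue_integral_def F_def)
qed

lemma integral_u_exp_complex:
  fixes z :: complex and a :: real assumes "Re z > 0" "a \<ge> 0"
  shows "set_integrable lborel {a<..} (\<lambda>u. of_real u * exp (- z * of_real u))"
    and "(CLINT u:{a<..}|lborel. of_real u * exp (- z * of_real u)) = exp (- z * of_real a) * (of_real a / z + 1 / z\<^sup>2)"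
proof -
  define F where "F = (\<lambda>u::complex. - ((u / z + 1 / z\<^sup>2) * exp (- z * u)))"
  have z0: "z \<noteq> 0" using assms(1) by auto
  have F: "((\<lambda>u. F (of_real u)) has_vector_derivative of_real u * exp (- z * of_real u)) (at u)" for u :: real
  proof (rule has_vector_derivative_real_field)
    show "(F has_field_derivative of_real u * exp (- z * of_real u)) (at (of_real u))"
      unfolding F_def using z0
      by (auto intro!: derivative_eq_intros simp: field_simps power2_eq_square)
  qed
  show si: "set_integrable lborel {a<..} (\<lambda>u. of_real u * exp (- z * of_real u))"
    unfolding set_integrable_def
  proof (rule Bochner_Integration.integrable_bound[OF integral_u_exp_real(1)[OF assms, unfolded set_integrable_def]])
    show "AE u in lborel. norm (indicator {a<..} u *\<^sub>R (complex_of_real u * exp (- z * of_real u))) \<le> norm (indicator {a<..} u *\<^sub>R (u * exp (- Re z * u)))"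
      by (intro AE_I2) (simp add: norm_mult)
  qed auto
  have lim: "((\<lambda>u. F (of_real u)) \<longlongrightarrow> 0) at_top"
  proof (rule tendsto_norm_zero_cancel, rule tendsto_sandwich[OF _ _ tendsto_const])
    have "((\<lambda>u. (u / norm z + 1 / norm z ^ 2) * exp (- Re z * u)) \<longlongrightarrow> 0) at_top"
      using assms(1) z0 by real_asymp
    then show "((\<lambda>u. (\<bar>u\<bar> / norm z + 1 / norm z ^ 2) * exp (- Re z * u)) \<longlongrightarrow> 0) at_top"
      by (rule Lim_transform_eventually) (auto intro!: eventually_mono[OF eventually_ge_at_top[of 0]])
    show "\<forall>\<^sub>F u in at_top. norm (F (complex_of_real u)) \<le> (\<bar>u\<bar> / norm z + 1 / norm z ^ 2) * exp (- Re z * u)"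
    proof (rule always_eventually, rule allI)
      fix u :: real
      have "norm (complex_of_real u / z + 1 / z\<^sup>2) \<le> \<bar>u\<bar> / norm z + 1 / norm z ^ 2"
        by (rule order.trans[OF norm_triangle_ineq]) (simp add: norm_divide norm_power)
      then show "norm (F (complex_of_real u)) \<le> (\<bar>u\<bar> / norm z + 1 / norm z ^ 2) * exp (- Re z * u)"
        unfolding F_def by (simp add: norm_mult mult_right_mono)
    qed
  qed auto
  have contF: "isCont (\<lambda>u. F (of_real u)) a"
    using F by (rule has_vector_derivative_continuous)
  have "(CLBINT u=ereal a..\<infinity>. of_real u * exp (- z * of_real u)) = 0 - F (of_real a)"
    by (rule interval_integral_FTC_integrable[where F = "\<lambda>u. F (of_real u)"])
       (use si F lim contF in \<open>auto intro!: continuous_intros tendsto_eq_intros simp: ereal_tendsto_simps isCont_def filterlim_at_split\<close>)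
  then show "(CLINT u:{a<..}|lborel. of_real u * exp (- z * of_real u)) = exp (- z * of_real a) * (of_real a / z + 1 / z\<^sup>2)"
    by (simp add: interval_lebesgue_integral_def F_def)
qed

text \<open>With \<open>x = exp u\<close>, the terms add up to
  \<open>ln x * x powr (- \<sigma>)\<close> times the Cesaro sum of \<open>a n * (1 - n / x)\<close>
  over \<open>n \<le> x\<close>. The truncation by \<open>max\<close> makes every term continuous in
  \<open>u\<close>.\<close>

definition fterm :: "(nat \<Rightarrow> real) \<Rightarrow> real \<Rightarrow> nat \<Rightarrow> real \<Rightarrow> real" where
  "fterm a \<sigma> n u = (if n = 0 then 0 else a n * (u * exp (- \<sigma> * u) * max 0 (1 - real n * exp (- u))))"

lemma fterm_eq_0:
  assumes "exp u \<le> real n"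
  shows "fterm a \<sigma> n u = 0"
proof -
  have "exp (- u) * exp u \<le> exp (- u) * real n" using assms by (intro mult_left_mono) auto
  then have "1 - real n * exp (- u) \<le> 0" by (simp add: exp_minus mult.commute)
  then show ?thesis by (simp add: fterm_def max_def)
qed

text \<open>A term is nonzero only if \<open>n < exp u\<close>. A share
  \<open>exp (- \<eta> * u / 2)\<close> of the exponential absorbs the factor \<open>u\<close>, and
  the rest is at most a power of \<open>n\<close>; the bound is free of \<open>u\<close>.\<close>

lemma fterm_bound:
  assumes "\<eta> > 0"
  shows "\<bar>fterm a (1 + \<eta>) n u\<bar> \<le> (2 / \<eta>) * (\<bar>a n\<bar> * real n powr (- (1 + \<eta> / 2)))"
proof (cases "n = 0 \<or> exp u \<le> real n")
  case True
  then have "fterm a (1 + \<eta>) n u = 0" using fterm_eq_0[of u n a "1 + \<eta>"] by (cases "n = 0") (auto simp: fterm_def[of _ _ 0])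
  then show ?thesis using assms by simp
next
  case False
  then have n: "n \<ge> 1" and nu: "real n < exp u" by auto
  have "1 < exp u" using n nu by linarith
  then have u: "u > 0" by simp
  have "ln (real n) < ln (exp u)" using n nu by (subst ln_less_cancel_iff) auto
  then have ln: "ln (real n) < u" by simp
  have m: "0 \<le> max 0 (1 - real n * exp (- u))" "max 0 (1 - real n * exp (- u)) \<le> 1" by auto
  have "\<bar>fterm a (1 + \<eta>) n u\<bar> = \<bar>a n\<bar> * (u * exp (- (1 + \<eta>) * u) * max 0 (1 - real n * exp (- u)))"
    using n u by (simp add: fterm_def abs_mult)
  also have "\<dots> \<le> \<bar>a n\<bar> * (u * exp (- (1 + \<eta>) * u) * 1)"
    using m u by (intro mult_left_mono) auto
  finally have 1: "\<bar>fterm a (1 + \<eta>) n u\<bar> \<le> \<bar>a n\<bar> * (u * exp (- (1 + \<eta>) * u))" by simp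
  have "u * \<eta> / 2 \<le> exp (u * \<eta> / 2)" using exp_ge_add_one_self[of "u * \<eta> / 2"] by linarith
  then have "u \<le> (2 / \<eta>) * exp (u * \<eta> / 2)" using assms by (simp add: field_simps)
  then have "u * exp (- (1 + \<eta>) * u) \<le> (2 / \<eta>) * exp (u * \<eta> / 2) * exp (- (1 + \<eta>) * u)"
    by (intro mult_right_mono) auto
  also have "\<dots> = (2 / \<eta>) * exp (- (1 + \<eta> / 2) * u)"
    by (simp add: mult.assoc flip: exp_add) (simp add: algebra_simps)
  also have "\<dots> \<le> (2 / \<eta>) * real n powr (- (1 + \<eta> / 2))"
  proof (rule mult_left_mono)
    have "- (1 + \<eta> / 2) * u \<le> - (1 + \<eta> / 2) * ln (real n)"
      using ln assms by (intro mult_left_mono_neg) auto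
    then show "exp (- (1 + \<eta> / 2) * u) \<le> real n powr (- (1 + \<eta> / 2))" using n by (simp add: powr_def)
  qed (use assms in auto)
  finally have "\<bar>a n\<bar> * (u * exp (- (1 + \<eta>) * u)) \<le> \<bar>a n\<bar> * ((2 / \<eta>) * real n powr (- (1 + \<eta> / 2)))"
    by (rule mult_left_mono) simp
  also have "\<dots> = (2 / \<eta>) * (\<bar>a n\<bar> * real n powr (- (1 + \<eta> / 2)))" by (simp only: mult_ac)
  finally show ?thesis using 1 by linarith
qed

lemma fterm_complex:
  assumes "n > 0"
  shows "complex_of_real (fterm a \<sigma> n u) * iexp (t * u) = of_real (a n) *
     (indicator {ln (real n)<..} u *\<^sub>R (of_real u * exp (- Complex \<sigma> (- t) * of_real u))
      - of_nat n * (indicator {ln (real n)<..} u *\<^sub>R (of_real u * exp (- (Complex \<sigma> (- t) + 1) * of_real u))))"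
proof (cases "u > ln (real n)")
  case True
  then have "exp (ln (real n)) < exp u" by (simp only: exp_less_cancel_iff)
  then have "real n < exp u" using assms by simp
  then have "real n * exp (- u) < 1" by (simp add: exp_minus field_simps)
  then have m: "max 0 (1 - real n * exp (- u)) = 1 - real n * exp (- u)" by simp
  have e1: "exp (- Complex \<sigma> (- t) * of_real u) = of_real (exp (- \<sigma> * u)) * iexp (t * u)"
    by (simp add: Complex_eq exp_of_real[symmetric] exp_add[symmetric] algebra_simps del: exp_of_real)
  have e2: "exp (- (Complex \<sigma> (- t) + 1) * of_real u) = of_real (exp (- \<sigma> * u)) * of_real (exp (- u)) * iexp (t * u)"
    by (simp add: Complex_eq exp_of_real[symmetric] exp_add[symmetric] algebra_simps del: exp_of_real)
  show ?thesis unfolding e1 e2 using True assms by (simp add: fterm_def m algebra_simps)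
next
  case False
  then have "exp u \<le> exp (ln (real n))" by (simp only: exp_le_cancel_iff not_less)
  then have "exp u \<le> real n" using assms by simp
  then show ?thesis using fterm_eq_0[of u n a \<sigma>] False by simp
qed

lemma exp_ln_nat: "n > 0 \<Longrightarrow> exp (- z * complex_of_real (ln (real n))) = of_nat n powr (- z)"
  using Ln_of_real[of "real n"] by (simp add: powr_def mult.commute)

text \<open>The phase combines with the damping to \<open>exp (- s u)\<close> at
  \<open>s = \<sigma> - i t\<close>, which explains the sign in \<open>s\<close>. The lower limit
  \<open>ln n\<close> of the integral produces the factor \<open>ln n\<close>, that is, the
  derivative of the Dirichlet series. The norm bound serves to integrate the whole series
  termwise.\<close>

lemma fterm_integral:
  assumes "\<sigma> > 1"
  defines "s \<equiv> (\<lambda>t. Complex \<sigma> (- t))"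
  shows "integrable lborel (\<lambda>u. complex_of_real (fterm a \<sigma> n u) * iexp (t * u))" (is ?int)
    and "(CLINT u|lborel. complex_of_real (fterm a \<sigma> n u) * iexp (t * u)) =
       of_real (a n) * of_nat n powr (- s t) * ((of_real (ln (real n)) / s t + 1 / (s t)\<^sup>2) - (of_real (ln (real n)) / (s t + 1) + 1 / (s t + 1)\<^sup>2))"
      (is ?val)
    and "(LINT u|lborel. norm (complex_of_real (fterm a \<sigma> n u) * iexp (t * u))) \<le> \<bar>a n\<bar> * real n powr (- \<sigma>) * (ln (real n) + 1)"
      (is ?norm)
proof -
  have "?int \<and> ?val \<and> ?norm"
  proof (cases "n = 0")
    case True
    then show ?thesis by (simp add: fterm_def)
  next
    case False
    define l where "l = ln (real n)"
    have n: "n > 0" and l: "l \<ge> 0" using False by (auto simp: l_def)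
    have s0: "Re (s t) > 0" "Re (s t + 1) > 0" using assms by (auto simp: s_def)
    note I1 = integral_u_exp_complex[OF s0(1) l] and I2 = integral_u_exp_complex[OF s0(2) l]
    have i1: "integrable lborel (\<lambda>u. indicator {l<..} u *\<^sub>R (of_real u * exp (- s t * of_real u)))"
      using I1(1) by (simp add: set_integrable_def)
    have i2: "integrable lborel (\<lambda>u. of_nat n * (indicator {l<..} u *\<^sub>R (of_real u * exp (- (s t + 1) * of_real u))))"
      using I2(1) by (intro integrable_mult_right) (simp add: set_integrable_def)
    have eq: "(\<lambda>u. complex_of_real (fterm a \<sigma> n u) * iexp (t * u)) = (\<lambda>u. of_real (a n) *
     (indicator {l<..} u *\<^sub>R (of_real u * exp (- s t * of_real u))
      - of_nat n * (indicator {l<..} u *\<^sub>R (of_real u * exp (- (s t + 1) * of_real u)))))"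
      unfolding l_def s_def using fterm_complex[OF n] by (intro ext)
    have int: "integrable lborel (\<lambda>u. complex_of_real (fterm a \<sigma> n u) * iexp (t * u))"
      unfolding eq by (intro integrable_mult_right Bochner_Integration.integrable_diff i1 i2)
    have "(CLINT u|lborel. complex_of_real (fterm a \<sigma> n u) * iexp (t * u)) =
       of_real (a n) * ((CLINT u:{l<..}|lborel. of_real u * exp (- s t * of_real u)) - of_nat n * (CLINT u:{l<..}|lborel. of_real u * exp (- (s t + 1) * of_real u)))"
      unfolding eq set_lebesgue_integral_def
      by (subst integral_mult_right_zero) (subst Bochner_Integration.integral_diff[OF i1 i2], simp only: integral_mult_right_zero)
    also have "\<dots> = of_real (a n) * (of_nat n powr (- s t) * (of_real l / s t + 1 / (s t)\<^sup>2) - of_nat n * (of_nat n powr (- (s t + 1)) * (of_real l / (s t + 1) + 1 / (s t + 1)\<^sup>2)))"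
      unfolding I1(2) I2(2) using n by (simp only: l_def exp_ln_nat)
    also have "of_nat n * (of_nat n powr (- (s t + 1)) * (of_real l / (s t + 1) + 1 / (s t + 1)\<^sup>2)) = of_nat n powr (- s t) * (of_real l / (s t + 1) + 1 / (s t + 1)\<^sup>2)"
    proof -
      have "of_nat n powr (- (s t + 1)) = of_nat n powr (- s t) / (of_nat n :: complex)"
        using n by (simp add: powr_diff)
      then show ?thesis using n by simp
    qed
    finally have val: "(CLINT u|lborel. complex_of_real (fterm a \<sigma> n u) * iexp (t * u)) =
       of_real (a n) * of_nat n powr (- s t) * ((of_real l / s t + 1 / (s t)\<^sup>2) - (of_real l / (s t + 1) + 1 / (s t + 1)\<^sup>2))"
      by (simp add: algebra_simps)
    have "\<sigma> > 0" using assms by simp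
    note R = integral_u_exp_real[OF this l]
    have ri: "integrable lborel (\<lambda>u. \<bar>a n\<bar> * (indicator {l<..} u *\<^sub>R (u * exp (- \<sigma> * u))))"
      using R(1) by (intro integrable_mult_right) (simp add: set_integrable_def)
    have "(LINT u|lborel. norm (complex_of_real (fterm a \<sigma> n u) * iexp (t * u))) \<le> (LINT u|lborel. \<bar>a n\<bar> * (indicator {l<..} u *\<^sub>R (u * exp (- \<sigma> * u))))"
    proof (rule integral_mono[OF integrable_norm[OF int] ri])
      fix u
      show "norm (complex_of_real (fterm a \<sigma> n u) * iexp (t * u)) \<le> \<bar>a n\<bar> * (indicator {l<..} u *\<^sub>R (u * exp (- \<sigma> * u)))"
      proof (cases "u > l")
        case True
        then have u: "u > 0" using l by simp
        have m: "0 \<le> max 0 (1 - real n * exp (- u))" "max 0 (1 - real n * exp (- u)) \<le> 1" by auto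
        have "norm (complex_of_real (fterm a \<sigma> n u) * iexp (t * u)) = \<bar>fterm a \<sigma> n u\<bar>"
          by (simp add: norm_mult)
        also have "\<dots> = \<bar>a n\<bar> * (u * exp (- \<sigma> * u) * max 0 (1 - real n * exp (- u)))"
          using n u by (simp add: fterm_def abs_mult)
        also have "\<dots> \<le> \<bar>a n\<bar> * (u * exp (- \<sigma> * u) * 1)" using m u by (intro mult_left_mono) auto
        finally show ?thesis using True by simp
      next
        case False
        then have "exp u \<le> exp l" by simp
        then have "exp u \<le> real n" using n by (simp add: l_def)
        then show ?thesis using fterm_eq_0[of u n a \<sigma>] False by simp
      qed
    qed
    also have "\<dots> = \<bar>a n\<bar> * (exp (- \<sigma> * l) * (l / \<sigma> + 1 / \<sigma>\<^sup>2))"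
      using R(2) by (simp add: set_lebesgue_integral_def)
    also have "\<dots> \<le> \<bar>a n\<bar> * (exp (- \<sigma> * l) * (l + 1))"
    proof (intro mult_left_mono add_mono)
      have "l * 1 \<le> l * \<sigma>" using l assms(1) by (intro mult_left_mono) auto
      then show "l / \<sigma> \<le> l" using assms(1) by (simp add: field_simps)
      have "\<sigma>\<^sup>2 \<ge> 1" using assms(1) by (intro one_le_power) auto
      then show "1 / \<sigma>\<^sup>2 \<le> 1" by (simp add: divide_simps)
    qed auto
    also have "exp (- \<sigma> * l) = real n powr (- \<sigma>)" using n by (simp add: powr_def l_def)
    finally show ?thesis using int val unfolding l_def by (simp add: mult.assoc)
  qed
  then show ?int ?val ?norm by blast+
qed

text \<open>The exponent is the growth 1/2 of the Dirichlet series minus the decay 2 of the kernel.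
  Both half-lines come from one primitive; only the null set at 0 is missed.\<close>

lemma integrable_one_plus_abs_powr: "integrable lborel (\<lambda>t::real. (1 + \<bar>t\<bar>) powr (- (3/2)))"
proof -
  define F where "F = (\<lambda>t::real. - 2 * (1 + t) powr (- (1/2)))"
  have F: "(F has_real_derivative (1 + t) powr (- (3/2))) (at t)" if "t > -1" for t
  proof -
    have "((\<lambda>t. 1 + t) has_real_derivative 1) (at t)" by (auto intro!: derivative_eq_intros)
    from DERIV_fun_powr[OF this, of "- (1/2)"] that
    have "((\<lambda>t. (1 + t) powr (- (1/2))) has_real_derivative - (1/2) * (1 + t) powr (- (3/2))) (at t)" by simp
    from DERIV_cmult[OF this, of "- 2"] show ?thesis by (simp add: F_def)
  qed
  have lim: "(F \<longlongrightarrow> 0) at_top" unfolding F_def by real_asymp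
  have contF: "isCont F 0" using F[of 0] by (intro DERIV_isCont) auto
  have 1: "set_integrable lborel (einterval (ereal 0) \<infinity>) (\<lambda>t. (1 + t) powr (- (3/2)))"
    by (rule interval_integral_FTC_nonneg(1)[where F = F and A = "F 0" and B = 0])
       (use F lim contF in \<open>auto intro!: tendsto_eq_intros AE_I2 continuous_intros simp: ereal_tendsto_simps isCont_def
           filterlim_at_split\<close>)
  have "einterval (ereal 0) \<infinity> = {0::real<..}" by (auto simp: einterval_def)
  with 1 have i1: "integrable lborel (\<lambda>t::real. indicator {0<..} t * (1 + t) powr (- (3/2)))"
    by (simp only: set_integrable_def real_scaleR_def)
  have i2: "integrable lborel (\<lambda>t::real. indicator {0<..} (- t) * (1 + - t) powr (- (3/2)))"
    using lborel_integrable_real_affine[OF i1, of "-1" 0] by simp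
  have "integrable lborel (\<lambda>t::real. indicator {0<..} t * (1 + t) powr (- (3/2)) + indicator {0<..} (- t) * (1 + - t) powr (- (3/2)))"
    using i1 i2 by (rule Bochner_Integration.integrable_add)
  then show ?thesis
  proof (rule integrable_cong_AE_imp)
    show "AE t::real in lborel. indicator {0<..} t * (1 + t) powr (- (3/2)) + indicator {0<..} (- t) * (1 + - t) powr (- (3/2)) = (1 + \<bar>t\<bar>) powr (- (3/2))"
      using AE_lborel_singleton[of 0] by eventually_elim (auto simp: indicator_def)
  qed measurable
qed

text \<open>
  The factor \<open>u = log x\<close> in \<open>fterm\<close> is what saves a logarithm: on the Fourier side it differentiates the
  Dirichlet series once, and the derivative is still \<open>O(t\<^bsup>1/2\<^esup>)\<close> against the kernel \<open>1/(s(s+1))\<close>.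
  The bound does not depend on \<open>\<eta>\<close>.
\<close>

lemma fterm_series_bound:
  assumes ac: "abs_conv_gt1 a" and \<eta>: "\<eta> > 0" "\<eta> \<le> 1" and C: "C > 0"
    and bd: "\<And>s. 1 < Re s \<Longrightarrow> Re s \<le> 2 \<Longrightarrow> norm (dseries a s) \<le> C * (1 + \<bar>Im s\<bar>) powr (1/2) \<and>
     norm (dseries (\<lambda>n. a n * ln (real n)) s) \<le> C * (1 + \<bar>Im s\<bar>) powr (1/2)"
  shows "\<bar>\<Sum>n. fterm a (1 + \<eta>) n u\<bar> \<le> (LINT t|lborel. 12 * C * (1 + \<bar>t\<bar>) powr (- (3/2)))"
proof -
  define \<sigma> where "\<sigma> = 1 + \<eta>"
  have \<sigma>: "\<sigma> > 1" "\<sigma> \<le> 2" using \<eta> by (auto simp: \<sigma>_def)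
  define V where "V = (\<lambda>u. \<Sum>n. fterm a \<sigma> n u)"
  have sm0: "summable (\<lambda>n. (2 / \<eta>) * (\<bar>a n\<bar> * real n powr (- (1 + \<eta> / 2))))"
  proof (rule summable_mult)
    have "1 + \<eta> / 2 > 1" using \<eta> by simp
    then show "summable (\<lambda>n. \<bar>a n\<bar> * real n powr (- (1 + \<eta> / 2)))" using ac unfolding abs_conv_gt1_def by blast
  qed
  have sma: "summable (\<lambda>n. \<bar>fterm a \<sigma> n u\<bar>)" for u
    using fterm_bound[OF \<eta>(1)] unfolding \<sigma>_def by (intro summable_comparison_test'[OF sm0, of 0]) auto
  have sm: "summable (\<lambda>n. fterm a \<sigma> n u)" for u using sma[of u] by (rule summable_rabs_cancel)
  define B where "B = (\<Sum>n. (2 / \<eta>) * (\<bar>a n\<bar> * real n powr (- (1 + \<eta> / 2))))"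
  have VB: "\<bar>V u\<bar> \<le> B" for u
  proof -
    have "\<bar>V u\<bar> \<le> (\<Sum>n. \<bar>fterm a \<sigma> n u\<bar>)" unfolding V_def by (rule summable_rabs[OF sma])
    also have "\<dots> \<le> B" unfolding B_def by (rule suminf_le[OF _ sma sm0]) (use fterm_bound[OF \<eta>(1)] in \<open>auto simp: \<sigma>_def\<close>)
    finally show ?thesis .
  qed
  have cf: "isCont (\<lambda>u. fterm a \<sigma> n u) u" for n u
    unfolding fterm_def by (cases "n = 0") (auto intro!: continuous_intros continuous_max)
  \<comment> \<open>Locally in \<open>u\<close> the series is a finite sum, which is how
    \<open>V\<close> is seen to be continuous.\<close>
  have Vfin: "V u = (\<Sum>n<N. fterm a \<sigma> n u)" if "exp u \<le> real N" for u N
  proof -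
    have "fterm a \<sigma> n u = 0" if "n \<notin> {..<N}" for n
      using that \<open>exp u \<le> real N\<close> by (intro fterm_eq_0) (auto intro: order.trans)
    then show ?thesis unfolding V_def by (intro suminf_finite) auto
  qed
  have cV: "isCont V u" for u
  proof -
    obtain N where N: "exp (u + 1) \<le> real N" using real_arch_simple by blast
    have "\<forall>\<^sub>F y in nhds u. y < u + 1" using eventually_nhds_in_open[of "{..<u+1}" u] by simp
    then have ev: "\<forall>\<^sub>F y in nhds u. V y = (\<Sum>n<N. fterm a \<sigma> n y)"
    proof (rule eventually_mono)
      fix y assume "y < u + 1"
      then have "exp y \<le> real N" using N by (meson exp_le_cancel_iff less_imp_le order.trans)
      then show "V y = (\<Sum>n<N. fterm a \<sigma> n y)" by (rule Vfin)
    qed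
    have "isCont (\<lambda>y. \<Sum>n<N. fterm a \<sigma> n y) u" using cf by (intro continuous_intros)
    then show ?thesis using isCont_cong[OF ev] by simp
  qed
  define v where "v = (\<lambda>u. complex_of_real (V u))"
  have cv: "continuous_on UNIV v"
    unfolding v_def using cV by (intro continuous_intros continuous_at_imp_continuous_on) auto
  have vs: "(\<Sum>n. complex_of_real (fterm a \<sigma> n u) * iexp (t * u)) = v u * iexp (t * u)" for u t
  proof -
    have "(\<lambda>n. complex_of_real (fterm a \<sigma> n u)) sums v u"
      unfolding v_def V_def using sm by (intro sums_of_real summable_sums)
    then have "(\<lambda>n. complex_of_real (fterm a \<sigma> n u) * iexp (t * u)) sums (v u * iexp (t * u))"
      by (rule sums_mult2)
    then show ?thesis by (simp add: sums_iff)
  qed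
  have sI: "summable (\<lambda>n. LINT u|lborel. norm (complex_of_real (fterm a \<sigma> n u) * iexp (t * u)))" for t
  proof (rule summable_comparison_test'[where N = 0])
    have "summable (\<lambda>n. \<bar>a n * ln (real n)\<bar> * real n powr (- \<sigma>) + \<bar>a n\<bar> * real n powr (- \<sigma>))"
      using ac abs_conv_gt1_ln[OF ac] \<sigma>(1) unfolding abs_conv_gt1_def by (intro summable_add) blast+
    then show "summable (\<lambda>n. \<bar>a n\<bar> * real n powr (- \<sigma>) * (ln (real n) + 1))"
    proof (rule summable_cong[THEN iffD1, rotated], intro always_eventually allI)
      fix n :: nat
      show "\<bar>a n * ln (real n)\<bar> * real n powr (- \<sigma>) + \<bar>a n\<bar> * real n powr (- \<sigma>) = \<bar>a n\<bar> * real n powr (- \<sigma>) * (ln (real n) + 1)"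
        by (cases "n = 0") (auto simp: abs_mult algebra_simps)
    qed
    show "norm (LINT u|lborel. norm (complex_of_real (fterm a \<sigma> n u) * iexp (t * u))) \<le> \<bar>a n\<bar> * real n powr (- \<sigma>) * (ln (real n) + 1)" for n
      using fterm_integral(3)[OF \<sigma>(1)] by (simp add: integral_nonneg_AE)
  qed
  have sA: "AE u in lborel. summable (\<lambda>n. norm (complex_of_real (fterm a \<sigma> n u) * iexp (t * u)))" for t
    using sma by (intro AE_I2) (simp add: norm_mult)
  have int: "integrable lborel (\<lambda>u. v u * iexp (t * u))" for t
    using integrable_suminf[OF fterm_integral(1)[OF \<sigma>(1)] sA[of t] sI[of t]] unfolding vs .
  have intv: "integrable lborel v" using int[of 0] by simp
  have ft: "norm (CLINT u|lborel. v u * iexp (t * u)) \<le> 12 * C * (1 + \<bar>t\<bar>) powr (- (3/2))" for t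
  proof -
    define s where "s = Complex \<sigma> (- t)"
    have s: "Re s > 1" "Re s \<le> 2" "Im s = - t" using \<sigma> by (auto simp: s_def)
    define w where "w = 1 + \<bar>t\<bar>"
    have w1: "w \<ge> 1" by (simp add: w_def)
    have s0: "s \<noteq> 0" "s + 1 \<noteq> 0" using s(1) by (auto simp: complex_eq_iff)
    have ns: "norm s \<ge> w / 2"
      using abs_Re_le_cmod[of s] abs_Im_le_cmod[of s] s by (simp add: w_def)
    have ns1: "norm (s + 1) \<ge> w / 2"
      using abs_Re_le_cmod[of "s + 1"] abs_Im_le_cmod[of "s + 1"] s by (simp add: w_def)
    have i1: "1 / norm s \<le> 2 / w" and i2: "1 / norm (s + 1) \<le> 2 / w"
      using ns ns1 w1 s0 by (simp_all add: field_simps)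
    have t1: "(\<lambda>n. of_real (a n * ln (real n)) * of_nat n powr (- s)) sums dseries (\<lambda>n. a n * ln (real n)) s"
      by (rule dseries_sums[OF abs_conv_gt1_ln[OF ac] s(1)])
    have t2: "(\<lambda>n. of_real (a n) * of_nat n powr (- s)) sums dseries a s"
      by (rule dseries_sums[OF ac s(1)])
    have "(\<lambda>n. of_real (a n * ln (real n)) * of_nat n powr (- s) * (1 / s - 1 / (s + 1)) + of_real (a n) * of_nat n powr (- s) * (1 / s\<^sup>2 - 1 / (s + 1)\<^sup>2))
        sums (dseries (\<lambda>n. a n * ln (real n)) s * (1 / s - 1 / (s + 1)) + dseries a s * (1 / s\<^sup>2 - 1 / (s + 1)\<^sup>2))"
      by (intro sums_add sums_mult2 t1 t2)
    moreover have "of_real (a n * ln (real n)) * of_nat n powr (- s) * (1 / s - 1 / (s + 1)) + of_real (a n) * of_nat n powr (- s) * (1 / s\<^sup>2 - 1 / (s + 1)\<^sup>2)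
       = (CLINT u|lborel. complex_of_real (fterm a \<sigma> n u) * iexp (t * u))" for n
      unfolding fterm_integral(2)[OF \<sigma>(1)] s_def[symmetric] by (simp add: algebra_simps)
    ultimately have "(\<lambda>n. CLINT u|lborel. complex_of_real (fterm a \<sigma> n u) * iexp (t * u)) sums
       (dseries (\<lambda>n. a n * ln (real n)) s * (1 / s - 1 / (s + 1)) + dseries a s * (1 / s\<^sup>2 - 1 / (s + 1)\<^sup>2))"
      by (simp only:)
    moreover have "(\<lambda>n. CLINT u|lborel. complex_of_real (fterm a \<sigma> n u) * iexp (t * u)) sums (CLINT u|lborel. v u * iexp (t * u))"
      using sums_integral[OF fterm_integral(1)[OF \<sigma>(1)] sA[of t] sI[of t]] unfolding vs .
    ultimately have val: "(CLINT u|lborel. v u * iexp (t * u)) = dseries (\<lambda>n. a n * ln (real n)) s * (1 / s - 1 / (s + 1)) + dseries a s * (1 / s\<^sup>2 - 1 / (s + 1)\<^sup>2)"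
      by (rule sums_unique2[symmetric])
    have b: "norm (dseries (\<lambda>n. a n * ln (real n)) s) \<le> C * w powr (1/2)" "norm (dseries a s) \<le> C * w powr (1/2)"
      using bd[OF s(1,2)] s(3) by (auto simp: w_def)
    have r1: "norm (1 / s - 1 / (s + 1)) \<le> 4 / w\<^sup>2"
    proof -
      have "1 / s - 1 / (s + 1) = (1 / s) * (1 / (s + 1))" using s0 by (simp add: field_simps)
      then have "norm (1 / s - 1 / (s + 1)) = (1 / norm s) * (1 / norm (s + 1))" by (simp add: norm_divide norm_mult)
      also have "\<dots> \<le> (2 / w) * (2 / w)" using i1 i2 w1 by (intro mult_mono) auto
      finally show ?thesis by (simp add: power2_eq_square)
    qed
    have r2: "norm (1 / s\<^sup>2 - 1 / (s + 1)\<^sup>2) \<le> 8 / w\<^sup>2"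
    proof -
      have "norm (1 / s\<^sup>2 - 1 / (s + 1)\<^sup>2) \<le> norm (1 / s\<^sup>2) + norm (1 / (s + 1)\<^sup>2)" by (rule norm_triangle_ineq4)
      also have "\<dots> = (1 / norm s)\<^sup>2 + (1 / norm (s + 1))\<^sup>2" by (simp add: norm_divide norm_power power_divide)
      also have "\<dots> \<le> (2 / w)\<^sup>2 + (2 / w)\<^sup>2" using i1 i2 by (intro add_mono power_mono) auto
      finally show ?thesis by (simp add: power_divide)
    qed
    have "norm (CLINT u|lborel. v u * iexp (t * u)) \<le> (C * w powr (1/2)) * (4 / w\<^sup>2) + (C * w powr (1/2)) * (8 / w\<^sup>2)"
      unfolding val
    proof (rule order.trans[OF norm_triangle_ineq], rule add_mono)
      show "norm (dseries (\<lambda>n. a n * ln (real n)) s * (1 / s - 1 / (s + 1))) \<le> (C * w powr (1/2)) * (4 / w\<^sup>2)"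
        unfolding norm_mult using C by (intro mult_mono b r1) auto
      show "norm (dseries a s * (1 / s\<^sup>2 - 1 / (s + 1)\<^sup>2)) \<le> (C * w powr (1/2)) * (8 / w\<^sup>2)"
        unfolding norm_mult using C by (intro mult_mono b r2) auto
    qed
    also have "\<dots> = 12 * C * (w powr (1/2) / w\<^sup>2)" by (simp add: field_simps)
    also have "w powr (1/2) / w\<^sup>2 = w powr (1/2 - 2)"
      unfolding powr_diff using w1 powr_realpow[of w 2] by simp
    finally show ?thesis by (simp add: w_def)
  qed
  have "norm (v u) \<le> (LINT t|lborel. 12 * C * (1 + \<bar>t\<bar>) powr (- (3/2)))"
    by (rule fourier_sup_bound[OF cv _ intv ft])
       (use VB integrable_one_plus_abs_powr in \<open>auto simp: v_def\<close>)
  then show ?thesis by (simp add: v_def V_def \<sigma>_def)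
qed

text \<open>For fixed \<open>x\<close> the limit \<open>\<eta> \<rightarrow> 0\<close> can be taken
  because the bound on the series does not involve \<open>\<eta>\<close>; it leaves
  \<open>ln x / x\<close> times the Cesaro sum bounded.\<close>

theorem cesaro_sum_bound:
  assumes ac: "abs_conv_gt1 a" and C: "C > 0"
    and bd: "\<And>s. 1 < Re s \<Longrightarrow> Re s \<le> 2 \<Longrightarrow> norm (dseries a s) \<le> C * (1 + \<bar>Im s\<bar>) powr (1/2) \<and>
     norm (dseries (\<lambda>n. a n * ln (real n)) s) \<le> C * (1 + \<bar>Im s\<bar>) powr (1/2)"
  shows "\<exists>K. \<forall>x>1. \<bar>\<Sum>n\<in>{1..nat \<lfloor>x\<rfloor>}. a n * (1 - real n / x)\<bar> \<le> K * x / ln x"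
proof (intro exI allI impI)
  define K where "K = (LINT t|lborel. 12 * C * (1 + \<bar>t\<bar>) powr (- (3/2)))"
  fix x :: real assume x: "x > 1"
  define u where "u = ln x"
  have u: "u > 0" and eu: "exp u = x" using x by (auto simp: u_def)
  define S where "S = (\<Sum>n\<in>{1..nat \<lfloor>x\<rfloor>}. a n * (1 - real n / x))"
  have eq: "(\<Sum>n. fterm a \<sigma> n u) = u * exp (- \<sigma> * u) * S" for \<sigma>
  proof -
    have "(\<Sum>n. fterm a \<sigma> n u) = (\<Sum>n\<in>{1..nat \<lfloor>x\<rfloor>}. fterm a \<sigma> n u)"
    proof (rule suminf_finite)
      fix n assume n: "n \<notin> {1..nat \<lfloor>x\<rfloor>}"
      show "fterm a \<sigma> n u = 0"
      proof (cases "n = 0")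
        case False
        then have "n > nat \<lfloor>x\<rfloor>" using n by auto
        then have "x \<le> real n" using x by linarith
        then show ?thesis using eu by (intro fterm_eq_0) simp
      qed (simp add: fterm_def)
    qed simp
    also have "\<dots> = (\<Sum>n\<in>{1..nat \<lfloor>x\<rfloor>}. u * exp (- \<sigma> * u) * (a n * (1 - real n / x)))"
    proof (rule sum.cong[OF refl])
      fix n assume n: "n \<in> {1..nat \<lfloor>x\<rfloor>}"
      then have "n \<le> nat \<lfloor>x\<rfloor>" by simp
      then have "real n \<le> x" using x by linarith
      then have "1 - real n / x \<ge> 0" using x by (simp add: field_simps)
      moreover have "exp (- u) = 1 / x" using eu by (simp add: exp_minus field_simps)
      ultimately show "fterm a \<sigma> n u = u * exp (- \<sigma> * u) * (a n * (1 - real n / x))"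
        using n by (simp add: fterm_def max_def)
    qed
    finally show ?thesis by (simp add: S_def sum_distrib_left)
  qed
  have b: "\<bar>u * exp (- (1 + \<eta>) * u) * S\<bar> \<le> K" if "\<eta> > 0" "\<eta> \<le> 1" for \<eta>
    using fterm_series_bound[OF ac that C bd, of u] unfolding eq K_def by simp
  have "(\<lambda>m. \<bar>u * exp (- (1 + 1 / real (Suc m)) * u) * S\<bar>) \<longlonglongrightarrow> \<bar>u * exp (- (1 + 0) * u) * S\<bar>"
    by (intro tendsto_intros LIMSEQ_Suc lim_1_over_n)
  then have "\<bar>u * exp (- (1 + 0) * u) * S\<bar> \<le> K"
    by (rule LIMSEQ_le_const2) (use b in \<open>auto intro!: exI[of _ 0]\<close>)
  then have "u * \<bar>S\<bar> / x \<le> K" using u eu x by (simp add: abs_mult exp_minus divide_inverse mult_ac abs_of_pos)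
  then show "\<bar>S\<bar> \<le> K * x / ln x" using u x by (simp add: u_def[symmetric] field_simps)
qed

section \<open>Primes congruent to 1 modulo 4\<close>

definition split_primes_le :: "real \<Rightarrow> nat set" where
  "split_primes_le x = {q \<in> primes_1mod4. real q \<le> x}"

lemma finite_split_primes_le [simp]: "finite (split_primes_le x)"
proof (rule finite_subset)
  show "split_primes_le x \<subseteq> {..nat \<lfloor>x\<rfloor>}" by (auto simp: split_primes_le_def le_nat_floor)
qed simp

lemma split_primes_le_mono: "x \<le> y \<Longrightarrow> split_primes_le x \<subseteq> split_primes_le y"
  by (auto simp: split_primes_le_def)

lemma primes_1mod4_ge_5: "q \<in> primes_1mod4 \<Longrightarrow> q \<ge> 5"
proof -
  assume q: "q \<in> primes_1mod4"
  then have "q mod 4 = 1" "q > 1" using prime_gt_1_nat[of q] by (auto simp: primes_1mod4_def)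
  then show "q \<ge> 5" by presburger
qed

lemma split_primes_le_subset: "split_primes_le x \<subseteq> {1..nat \<lfloor>x\<rfloor>}"
  by (auto simp: split_primes_le_def le_nat_floor dest: primes_1mod4_ge_5)

text \<open>The integral from 0 to \<open>x\<close> of the counting function of the primes congruent
  to 1 modulo 4.\<close>

definition pi1 :: "real \<Rightarrow> real" where
  "pi1 x = (\<Sum>q\<in>split_primes_le x. x - real q)"

text \<open>The mean over the interval from 0 to \<open>x\<close> of the Chebyshev function of these
  primes, which is what the Tauberian estimate delivers.\<close>

definition theta1 :: "real \<Rightarrow> real" where
  "theta1 x = (\<Sum>q\<in>split_primes_le x. ln (real q) * (1 - real q / x))"

lemma card_split_primes_le: "x \<ge> 0 \<Longrightarrow> real (card (split_primes_le x)) \<le> x"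
proof -
  assume x: "x \<ge> 0"
  have "card (split_primes_le x) \<le> card {1..nat \<lfloor>x\<rfloor>}" by (intro card_mono split_primes_le_subset) auto
  then have "card (split_primes_le x) \<le> nat \<lfloor>x\<rfloor>" by simp
  then show ?thesis using x by linarith
qed

text \<open>A proper prime power up to \<open>x\<close> has its base at most \<open>sqrt x\<close>
  and its exponent at most \<open>log 2 x\<close>; pairs are counted.\<close>

lemma higher_prime_powers_card:
  assumes "x \<ge> 1"
  shows "real (card {n\<in>{1..nat \<lfloor>x\<rfloor>}. primepow n \<and> \<not> prime n}) \<le> (sqrt x + 1) * (log 2 x + 1)"
proof -
  define A where "A = {..nat \<lfloor>sqrt x\<rfloor>}"
  have "{n\<in>{1..nat \<lfloor>x\<rfloor>}. primepow n \<and> \<not> prime n} \<subseteq> (\<lambda>(p, k). p ^ k) ` (A \<times> {1..nat \<lfloor>log 2 x\<rfloor>})"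
  proof
    fix n assume n: "n \<in> {n\<in>{1..nat \<lfloor>x\<rfloor>}. primepow n \<and> \<not> prime n}"
    then obtain p k where pk: "prime p" "k > 0" "n = p ^ k" by (auto simp: primepow_def)
    have "k \<noteq> 1" using n pk by auto
    then have k2: "k \<ge> 2" using pk(2) by simp
    have "n \<le> nat \<lfloor>x\<rfloor>" using n by simp
    then have nx: "real n \<le> x" using assms by linarith
    have p2: "p \<ge> 2" using pk(1) by (rule prime_ge_2_nat)
    have "real (p ^ 2) \<le> real (p ^ k)" using p2 k2 by (intro of_nat_mono power_increasing) auto
    then have "(real p)\<^sup>2 \<le> x" using nx pk(3) by simp
    then have "real p \<le> sqrt x" by (rule real_le_rsqrt)
    then have "p \<in> A" unfolding A_def by (simp add: le_nat_floor)
    moreover have "(2::real) ^ k \<le> x"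
    proof -
      have "(2::real) ^ k \<le> real p ^ k" using p2 by (intro power_mono) auto
      then show ?thesis using nx pk(3) by simp
    qed
    then have "real k \<le> log 2 x" using assms by (simp add: le_log_iff powr_realpow)
    then have "k \<in> {1..nat \<lfloor>log 2 x\<rfloor>}" using pk(2) by (simp add: le_nat_floor)
    ultimately show "n \<in> (\<lambda>(p, k). p ^ k) ` (A \<times> {1..nat \<lfloor>log 2 x\<rfloor>})" using pk(3) by force
  qed
  then have "card {n\<in>{1..nat \<lfloor>x\<rfloor>}. primepow n \<and> \<not> prime n} \<le> card ((\<lambda>(p, k). p ^ k) ` (A \<times> {1..nat \<lfloor>log 2 x\<rfloor>}))"
    by (intro card_mono) (auto simp: A_def)
  also have "\<dots> \<le> card (A \<times> {1..nat \<lfloor>log 2 x\<rfloor>})" by (intro card_image_le) (auto simp: A_def)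
  also have "\<dots> = (nat \<lfloor>sqrt x\<rfloor> + 1) * nat \<lfloor>log 2 x\<rfloor>" by (simp add: A_def card_cartesian_product)
  finally have "real (card {n\<in>{1..nat \<lfloor>x\<rfloor>}. primepow n \<and> \<not> prime n}) \<le> real (nat \<lfloor>sqrt x\<rfloor> + 1) * real (nat \<lfloor>log 2 x\<rfloor>)"
    by (metis of_nat_le_iff of_nat_mult)
  also have "\<dots> \<le> (sqrt x + 1) * (log 2 x + 1)"
  proof (rule mult_mono)
    have "log 2 x \<ge> 0" using assms by simp
    then show "real (nat \<lfloor>log 2 x\<rfloor>) \<le> log 2 x + 1" by linarith
    have "sqrt x \<ge> 0" using assms by simp
    then show "real (nat \<lfloor>sqrt x\<rfloor> + 1) \<le> sqrt x + 1" by linarith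
  qed (use assms in auto)
  finally show ?thesis .
qed

text \<open>Primes congruent to 1 modulo 4 carry the weight 2 and those congruent to 3 the weight 0.
  What remains is the prime 2 and the proper prime powers, each contributing at most
  \<open>2 * ln x\<close>.\<close>

lemma mangoldt4_sum_theta1:
  assumes "x \<ge> 2"
  shows "\<bar>(\<Sum>n\<in>{1..nat \<lfloor>x\<rfloor>}. mangoldt4 n * (1 - real n / x)) - 2 * theta1 x\<bar> \<le> 2 * ln x * ((sqrt x + 1) * (log 2 x + 1) + 1)"
proof -
  define N where "N = {1..nat \<lfloor>x\<rfloor>}"
  define R where "R = {n\<in>N. primepow n \<and> \<not> prime n}"
  have fN: "finite N" by (simp add: N_def)
  have sub: "split_primes_le x \<subseteq> N" unfolding N_def by (rule split_primes_le_subset)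
  have Nx: "real n \<le> x" if "n \<in> N" for n
  proof -
    have "n \<le> nat \<lfloor>x\<rfloor>" using that by (simp add: N_def)
    then show ?thesis using assms by linarith
  qed
  have "(\<Sum>n\<in>N. mangoldt4 n * (1 - real n / x)) = (\<Sum>n\<in>split_primes_le x. mangoldt4 n * (1 - real n / x)) + (\<Sum>n\<in>N - split_primes_le x. mangoldt4 n * (1 - real n / x))"
    using sum.subset_diff[OF sub fN] by (simp add: add.commute)
  also have "(\<Sum>n\<in>split_primes_le x. mangoldt4 n * (1 - real n / x)) = 2 * theta1 x"
    unfolding theta1_def sum_distrib_left
    by (intro sum.cong) (auto simp: split_primes_le_def primes_1mod4_def mangoldt4_def chi4_def)
  also have "(\<Sum>n\<in>N - split_primes_le x. mangoldt4 n * (1 - real n / x)) = (\<Sum>n\<in>(N - split_primes_le x) \<inter> insert 2 R. mangoldt4 n * (1 - real n / x))"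
  proof (rule sum.mono_neutral_right)
    show "\<forall>n\<in>N - split_primes_le x - (N - split_primes_le x) \<inter> insert 2 R. mangoldt4 n * (1 - real n / x) = 0"
    proof
      fix n assume n: "n \<in> N - split_primes_le x - (N - split_primes_le x) \<inter> insert 2 R"
      then have nN: "n \<in> N" "n \<notin> split_primes_le x" "n \<noteq> 2" "n \<notin> R" by auto
      show "mangoldt4 n * (1 - real n / x) = 0"
      proof (cases "primepow n")
        case False
        then show ?thesis by (simp add: mangoldt4_def mangoldt_def)
      next
        case True
        then have p: "prime n" using nN by (auto simp: R_def)
        then have "n mod 4 \<noteq> 1" using nN Nx by (auto simp: split_primes_le_def primes_1mod4_def)
        moreover have "odd n" using p nN(3) primes_dvd_imp_eq two_is_prime_nat by blast
        ultimately have "n mod 4 = 3" by presburger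
        then show ?thesis by (simp add: mangoldt4_def chi4_def)
      qed
    qed
  qed (auto simp: fN)
  finally have "\<bar>(\<Sum>n\<in>N. mangoldt4 n * (1 - real n / x)) - 2 * theta1 x\<bar> = \<bar>\<Sum>n\<in>(N - split_primes_le x) \<inter> insert 2 R. mangoldt4 n * (1 - real n / x)\<bar>"
    by simp
  also have "\<dots> \<le> (\<Sum>n\<in>(N - split_primes_le x) \<inter> insert 2 R. 2 * ln x)"
  proof (rule order.trans[OF sum_abs sum_mono])
    fix n assume "n \<in> (N - split_primes_le x) \<inter> insert 2 R"
    then have nN: "n \<in> N" by simp
    then have n1: "n \<ge> 1" by (simp add: N_def)
    have "mangoldt n \<le> ln (real n)" using mangoldt_le[of n] n1 by simp
    also have "\<dots> \<le> ln x" using Nx[OF nN] n1 by simp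
    finally have m: "mangoldt n \<le> ln x" .
    have "1 + chi4 n \<le> 2" "1 + chi4 n \<ge> 0" by (auto simp: chi4_def)
    then have "mangoldt4 n \<le> 2 * ln x" unfolding mangoldt4_def using m mangoldt_nonneg[of n] by (intro mult_mono) auto
    moreover have "0 \<le> 1 - real n / x" "1 - real n / x \<le> 1" using Nx[OF nN] assms by (auto simp: field_simps)
    ultimately have "mangoldt4 n * (1 - real n / x) \<le> 2 * ln x * 1"
      using assms mangoldt4_nonneg[of n] by (intro mult_mono) auto
    then show "\<bar>mangoldt4 n * (1 - real n / x)\<bar> \<le> 2 * ln x"
      using mangoldt4_nonneg[of n] \<open>0 \<le> 1 - real n / x\<close> by simp
  qed
  also have "\<dots> = 2 * ln x * real (card ((N - split_primes_le x) \<inter> insert 2 R))" by simp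
  also have "\<dots> \<le> 2 * ln x * ((sqrt x + 1) * (log 2 x + 1) + 1)"
  proof (rule mult_left_mono)
    have fR: "finite R" by (simp add: R_def fN)
    have "card ((N - split_primes_le x) \<inter> insert 2 R) \<le> card (insert 2 R)" using fR by (intro card_mono) auto
    also have "\<dots> \<le> card R + 1" using fR by (simp add: card_insert_if)
    finally show "real (card ((N - split_primes_le x) \<inter> insert 2 R)) \<le> (sqrt x + 1) * (log 2 x + 1) + 1"
      using higher_prime_powers_card[of x] assms unfolding R_def N_def by linarith
  qed (use assms in auto)
  finally show ?thesis unfolding N_def .
qed

lemma cesaro_const_sum:
  assumes "x \<ge> 1"
  shows "\<bar>(\<Sum>n\<in>{1..nat \<lfloor>x\<rfloor>}. 1 - real n / x) - x / 2\<bar> \<le> 1"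
proof -
  define m where "m = nat \<lfloor>x\<rfloor>"
  have m: "real m \<le> x" "x < real m + 1" using assms unfolding m_def by linarith+
  have "(\<Sum>n\<in>{1..m}. real n) = real m * (real m + 1) / 2"
    by (induction m) (auto simp: field_simps)
  then have "(\<Sum>n\<in>{1..m}. real n) / x = real m * (real m + 1) / (2 * x)" by (simp only: divide_divide_eq_left)
  then have s: "(\<Sum>n\<in>{1..m}. 1 - real n / x) = real m - real m * (real m + 1) / (2 * x)"
    by (simp add: sum_subtractf flip: sum_divide_distrib)
  define d where "d = x - real m"
  have d: "0 \<le> d" "d < 1" using m by (auto simp: d_def)
  have "real m - real m * (real m + 1) / (2 * x) - x / 2 = (- d\<^sup>2 - x + d) / (2 * x)"
    using assms unfolding d_def by (simp add: field_simps power2_eq_square)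
  moreover have "\<bar>- d\<^sup>2 - x + d\<bar> \<le> 2 * x"
  proof -
    have "d\<^sup>2 \<le> 1" "d\<^sup>2 \<ge> 0" using d by (auto simp: power_le_one)
    then show ?thesis using d assms by linarith
  qed
  ultimately show ?thesis unfolding m_def[symmetric] s using assms by (simp add: abs_divide divide_simps)
qed

text \<open>In \<open>x / 4\<close> one factor 1/2 is the density of the residue class among the
  primes, the other is the average of the weight \<open>1 - n / x\<close>.\<close>

lemma theta1_asymp:
  "\<exists>K>0. eventually (\<lambda>x. \<bar>theta1 x - x / 4\<bar> \<le> K * (x / ln x)) at_top"
proof -
  obtain C where C: "C > 0" "\<And>s. 1 < Re s \<Longrightarrow> Re s \<le> 2 \<Longrightarrow>
     norm (dseries prime_coeff s) \<le> C * (1 + \<bar>Im s\<bar>) powr (1/2) \<and>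
     norm (dseries (\<lambda>n. prime_coeff n * ln (real n)) s) \<le> C * (1 + \<bar>Im s\<bar>) powr (1/2)"
    by (rule prime_coeff_bound) blast
  obtain K where K: "\<And>x. x > 1 \<Longrightarrow> \<bar>\<Sum>n\<in>{1..nat \<lfloor>x\<rfloor>}. prime_coeff n * (1 - real n / x)\<bar> \<le> K * x / ln x"
    using cesaro_sum_bound[OF abs_conv_gt1_prime_coeff C] by blast
  have ev: "eventually (\<lambda>x::real. 1 + 2 * ln x * ((sqrt x + 1) * (log 2 x + 1) + 1) \<le> x / ln x) at_top"
    by real_asymp
  show ?thesis
  proof (intro exI[of _ "\<bar>K\<bar> + 1"] conjI)
    show "eventually (\<lambda>x. \<bar>theta1 x - x / 4\<bar> \<le> (\<bar>K\<bar> + 1) * (x / ln x)) at_top"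
      using ev eventually_ge_at_top[of 2]
    proof eventually_elim
      case (elim x)
      define M where "M = (\<Sum>n\<in>{1..nat \<lfloor>x\<rfloor>}. mangoldt4 n * (1 - real n / x))"
      define U where "U = (\<Sum>n\<in>{1..nat \<lfloor>x\<rfloor>}. 1 - real n / x)"
      have xl: "x / ln x > 0" using elim by simp
      have "(\<Sum>n\<in>{1..nat \<lfloor>x\<rfloor>}. prime_coeff n * (1 - real n / x)) = M - U"
        unfolding M_def U_def prime_coeff_def by (simp only: left_diff_distrib mult_1 sum_subtractf)
      then have "\<bar>M - U\<bar> \<le> K * (x / ln x)" using K[of x] elim by simp
      also have "\<dots> \<le> \<bar>K\<bar> * (x / ln x)" using xl by (intro mult_right_mono) auto
      finally have 1: "\<bar>M - U\<bar> \<le> \<bar>K\<bar> * (x / ln x)" .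
      have 2: "\<bar>U - x / 2\<bar> \<le> 1" unfolding U_def using elim by (intro cesaro_const_sum) simp
      have 3: "\<bar>M - 2 * theta1 x\<bar> \<le> 2 * ln x * ((sqrt x + 1) * (log 2 x + 1) + 1)"
        unfolding M_def by (rule mangoldt4_sum_theta1) (use elim in simp)
      have "\<bar>2 * theta1 x - x / 2\<bar> \<le> \<bar>K\<bar> * (x / ln x) + x / ln x" using 1 2 3 elim(1) by linarith
      moreover have "0 \<le> \<bar>K\<bar> * (x / ln x)" using xl by (intro mult_nonneg_nonneg) auto
      ultimately show "\<bar>theta1 x - x / 4\<bar> \<le> (\<bar>K\<bar> + 1) * (x / ln x)" using xl unfolding distrib_right by linarith
    qed
  qed simp
qed

text \<open>The weight in \<open>theta1 (2 * x)\<close> is at least 1/2 for every prime up to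
  \<open>x\<close>.\<close>

lemma chebyshev_upper:
  "\<exists>C>0. \<forall>x\<ge>1. (\<Sum>q\<in>split_primes_le x. ln (real q)) \<le> C * x"
proof -
  obtain K where K: "K > 0" "eventually (\<lambda>x. \<bar>theta1 x - x / 4\<bar> \<le> K * (x / ln x)) at_top"
    using theta1_asymp by blast
  have "eventually (\<lambda>x::real. x / ln x \<le> x) at_top" by real_asymp
  from eventually_conj[OF K(2) this] obtain x0 where x0: "\<And>x. x \<ge> x0 \<Longrightarrow> \<bar>theta1 x - x / 4\<bar> \<le> K * (x / ln x) \<and> x / ln x \<le> x"
    unfolding eventually_at_top_linorder by blast
  define y where "y = max x0 1"
  have ln0: "ln (real q) \<ge> 0" if "q \<in> split_primes_le x" for q x
    using that primes_1mod4_ge_5[of q] by (auto simp: split_primes_le_def)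
  have big: "(\<Sum>q\<in>split_primes_le x. ln (real q)) \<le> (1 + 4 * K) * x" if x: "x \<ge> y" for x
  proof -
    have x1: "x \<ge> 1" "2 * x \<ge> x0" using x by (auto simp: y_def)
    have "(\<Sum>q\<in>split_primes_le x. ln (real q)) = 2 * (\<Sum>q\<in>split_primes_le x. ln (real q) * (1/2))"
      by (simp only: sum_distrib_right[symmetric])
    also have "(\<Sum>q\<in>split_primes_le x. ln (real q) * (1/2)) \<le> (\<Sum>q\<in>split_primes_le x. ln (real q) * (1 - real q / (2 * x)))"
      using x1 ln0 by (intro sum_mono mult_left_mono) (auto simp: split_primes_le_def field_simps)
    also have "\<dots> \<le> theta1 (2 * x)" unfolding theta1_def
    proof (rule sum_mono2[OF finite_split_primes_le split_primes_le_mono])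
      fix q assume "q \<in> split_primes_le (2 * x) - split_primes_le x"
      then have q: "q \<in> split_primes_le (2 * x)" by simp
      have "real q \<le> 2 * x" using q by (simp add: split_primes_le_def)
      then have "0 \<le> 1 - real q / (2 * x)" using x1 by (simp add: field_simps)
      then show "0 \<le> ln (real q) * (1 - real q / (2 * x))" using ln0[OF q] by simp
    qed (use x1 in simp)
    also have "\<dots> \<le> (2 * x) / 4 + K * (2 * x / ln (2 * x))" using x0[OF x1(2)] by linarith
    also have "K * (2 * x / ln (2 * x)) \<le> K * (2 * x)" using x0[OF x1(2)] K(1) by (intro mult_left_mono) auto
    finally show ?thesis by (simp add: algebra_simps)
  qed
  define D where "D = (\<Sum>q\<in>split_primes_le y. ln (real q))"
  have D0: "D \<ge> 0" unfolding D_def using ln0 by (intro sum_nonneg)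
  show ?thesis
  proof (intro exI[of _ "1 + 4 * K + D"] conjI allI impI)
    show "1 + 4 * K + D > 0" using K(1) D0 by simp
    fix x :: real assume x: "x \<ge> 1"
    show "(\<Sum>q\<in>split_primes_le x. ln (real q)) \<le> (1 + 4 * K + D) * x"
    proof (cases "x \<ge> y")
      case True
      have "D * x \<ge> 0" using D0 x by simp
      then show ?thesis using big[OF True] by (simp add: algebra_simps)
    next
      case False
      have "(\<Sum>q\<in>split_primes_le x. ln (real q)) \<le> D" unfolding D_def
        using False ln0 by (intro sum_mono2 split_primes_le_mono) auto
      also have "\<dots> \<le> D * x" using D0 x mult_left_mono[of 1 x D] by simp
      also have "\<dots> \<le> (1 + 4 * K + D) * x" using K(1) x by (intro mult_right_mono) auto
      finally show ?thesis .
    qed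
  qed
qed

text \<open>Dyadic induction: passing from \<open>x\<close> to \<open>x / 2\<close> costs at most
  one Chebyshev sum, since \<open>ln 2 \<le> 1\<close>, and the costs form a geometric series.
  Bounding \<open>ln (x / q)\<close> by \<open>ln x\<close> would lose a logarithm.\<close>

lemma log_weighted_chebyshev:
  "\<exists>C>0. \<forall>x\<ge>1. (\<Sum>q\<in>split_primes_le x. ln (real q) * ln (x / real q)) \<le> C * x"
proof -
  obtain C where C: "C > 0" "\<And>x. x \<ge> 1 \<Longrightarrow> (\<Sum>q\<in>split_primes_le x. ln (real q)) \<le> C * x"
    using chebyshev_upper by blast
  have q5: "real q \<ge> 5" if "q \<in> split_primes_le x" for q x
    using that primes_1mod4_ge_5[of q] by (auto simp: split_primes_le_def)
  have main: "(\<Sum>q\<in>split_primes_le x. ln (real q) * ln (x / real q)) \<le> 2 * C * x" if "x \<ge> 1" "x \<le> 2 ^ n" for n x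
    using that
  proof (induction n arbitrary: x)
    case 0
    then have "split_primes_le x = {}" using q5[of _ x] by (force simp: split_primes_le_def)
    then show ?case using C(1) 0 by simp
  next
    case (Suc n)
    show ?case
    proof (cases "x < 2")
      case True
      then have "split_primes_le x = {}" using q5[of _ x] by (force simp: split_primes_le_def)
      then show ?thesis using C(1) Suc by simp
    next
      case False
      have IH: "(\<Sum>q\<in>split_primes_le (x / 2). ln (real q) * ln (x / 2 / real q)) \<le> 2 * C * (x / 2)"
        by (rule Suc.IH) (use False Suc.prems in auto)
      have sub: "split_primes_le (x / 2) \<subseteq> split_primes_le x" using False by (intro split_primes_le_mono) auto
      have "(\<Sum>q\<in>split_primes_le x. ln (real q) * ln (x / real q)) \<le>
         (\<Sum>q\<in>split_primes_le x. ln (real q) + (if q \<in> split_primes_le (x / 2) then ln (real q) * ln (x / 2 / real q) else 0))"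
      proof (rule sum_mono)
        fix q assume q: "q \<in> split_primes_le x"
        have q0: "real q \<ge> 5" "ln (real q) \<ge> 0" "real q \<le> x" using q5[OF q] q by (auto simp: split_primes_le_def)
        have "ln 2 \<le> (1::real)" using ln_2_less_1 by simp
        have "ln (x / real q) = ln 2 + ln (x / 2 / real q)"
          using q0 by (simp add: ln_div ln_mult)
        moreover have "ln (x / 2 / real q) \<le> 0" if "q \<notin> split_primes_le (x / 2)"
          using that q q0 by (auto simp: split_primes_le_def field_simps)
        ultimately have "ln (x / real q) \<le> 1 + (if q \<in> split_primes_le (x / 2) then ln (x / 2 / real q) else 0)"
          using \<open>ln 2 \<le> 1\<close> by auto
        from mult_left_mono[OF this q0(2)]
        show "ln (real q) * ln (x / real q) \<le> ln (real q) + (if q \<in> split_primes_le (x / 2) then ln (real q) * ln (x / 2 / real q) else 0)"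
          by (auto simp: algebra_simps split: if_splits)
      qed
      also have "\<dots> = (\<Sum>q\<in>split_primes_le x. ln (real q)) + (\<Sum>q\<in>split_primes_le (x / 2). ln (real q) * ln (x / 2 / real q))"
        using sub by (simp add: sum.distrib sum.inter_restrict[symmetric] Int_absorb1)
      also have "\<dots> \<le> C * x + 2 * C * (x / 2)" using C(2)[of x] IH Suc.prems by (intro add_mono) auto
      finally show ?thesis by simp
    qed
  qed
  show ?thesis
  proof (intro exI[of _ "2 * C"] conjI allI impI)
    fix x :: real assume x: "x \<ge> 1"
    obtain n where "x < 2 ^ n" using real_arch_pow[of 2 x] by auto
    then show "(\<Sum>q\<in>split_primes_le x. ln (real q) * ln (x / real q)) \<le> 2 * C * x" using main[of x n] x by simp
  qed (use C in simp)
qed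

text \<open>A discrete partial summation: \<open>ln x\<close> is split as
  \<open>ln q + ln (x / q)\<close>.\<close>

lemma pi1_theta1:
  assumes "x > 1"
  shows "ln x * pi1 x = x * theta1 x + x * (\<Sum>q\<in>split_primes_le x. (1 - real q / x) * ln (x / real q))"
proof -
  have "ln x * pi1 x = (\<Sum>q\<in>split_primes_le x. ln x * (x - real q))" by (simp add: pi1_def sum_distrib_left)
  also have "\<dots> = (\<Sum>q\<in>split_primes_le x. x * (ln (real q) * (1 - real q / x)) + x * ((1 - real q / x) * ln (x / real q)))"
  proof (rule sum.cong[OF refl])
    fix q assume "q \<in> split_primes_le x"
    then have "real q > 0" using primes_1mod4_ge_5[of q] by (auto simp: split_primes_le_def)
    then have l: "ln (x / real q) = ln x - ln (real q)" using assms by (simp add: ln_div)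
    have "x * (1 - real q / x) = x - real q" using assms by (simp add: field_simps)
    then have "x - real q = x * (1 - real q / x)" by simp
    then show "ln x * (x - real q) = x * (ln (real q) * (1 - real q / x)) + x * ((1 - real q / x) * ln (x / real q))"
      unfolding l by (simp only:) (simp only: algebra_simps)
  qed
  also have "\<dots> = x * theta1 x + x * (\<Sum>q\<in>split_primes_le x. (1 - real q / x) * ln (x / real q))"
    by (simp only: sum.distrib theta1_def sum_distrib_left)
  finally show ?thesis .
qed

lemma pi1_asymp_eventually:
  "\<exists>K>0. eventually (\<lambda>x. \<bar>pi1 x - x\<^sup>2 / (4 * ln x)\<bar> \<le> K * (x\<^sup>2 / (ln x)\<^sup>2)) at_top"
proof -
  obtain K where K: "K > 0" "eventually (\<lambda>x. \<bar>theta1 x - x / 4\<bar> \<le> K * (x / ln x)) at_top"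
    using theta1_asymp by blast
  obtain C where C: "C > 0" "\<And>x. x \<ge> 1 \<Longrightarrow> (\<Sum>q\<in>split_primes_le x. ln (real q) * ln (x / real q)) \<le> C * x"
    using log_weighted_chebyshev by blast
  have ev: "eventually (\<lambda>x::real. sqrt x * ln x \<le> x / ln x) at_top" by real_asymp
  show ?thesis
  proof (intro exI[of _ "K + 2 * C + 1"] conjI)
    show "eventually (\<lambda>x. \<bar>pi1 x - x\<^sup>2 / (4 * ln x)\<bar> \<le> (K + 2 * C + 1) * (x\<^sup>2 / (ln x)\<^sup>2)) at_top"
      using K(2) ev eventually_ge_at_top[of 3]
    proof eventually_elim
      case (elim x)
      have x: "x > 1" and lx: "ln x > 0" using elim by auto
      define R where "R = (\<Sum>q\<in>split_primes_le x. (1 - real q / x) * ln (x / real q))"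
      have q: "real q \<ge> 5" "real q \<le> x" if "q \<in> split_primes_le x" for q
        using that primes_1mod4_ge_5[of q] by (auto simp: split_primes_le_def)
      have lq: "ln (x / real q) \<ge> 0" if "q \<in> split_primes_le x" for q
        using q[OF that] by (simp add: field_simps)
      have R0: "R \<ge> 0" unfolding R_def using x q lq by (intro sum_nonneg mult_nonneg_nonneg) (auto simp: field_simps)
      \<comment> \<open>Primes up to \<open>sqrt x\<close> are estimated trivially; beyond
        \<open>sqrt x\<close> the weight \<open>ln q\<close>, needed for the Chebyshev-type bound,
        is inserted by \<open>1 \<le> 2 * ln q / ln x\<close>.\<close>
      have "R \<le> (\<Sum>q\<in>split_primes_le x. (if q \<in> split_primes_le (sqrt x) then ln x else 0) + (2 / ln x) * (ln (real q) * ln (x / real q)))"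
        unfolding R_def
      proof (rule sum_mono)
        fix p assume p: "p \<in> split_primes_le x"
        have lp: "ln (real p) \<ge> 0" using q[OF p] by simp
        have "(1 - real p / x) * ln (x / real p) \<le> 1 * ln (x / real p)"
          using lq[OF p] x by (intro mult_right_mono) auto
        also have "\<dots> \<le> (if p \<in> split_primes_le (sqrt x) then ln x else 0) + (2 / ln x) * (ln (real p) * ln (x / real p))"
        proof (cases "p \<in> split_primes_le (sqrt x)")
          case True
          have "ln (x / real p) \<le> ln x" using q[OF p] x lp by (simp add: ln_div)
          moreover have "(2 / ln x) * (ln (real p) * ln (x / real p)) \<ge> 0" using lx lp lq[OF p] by simp
          ultimately show ?thesis using True by simp
        next
          case False
          then have "sqrt x < real p" using p by (auto simp: split_primes_le_def)
          then have "ln (sqrt x) \<le> ln (real p)" using x q[OF p] by (subst ln_le_cancel_iff) auto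
          then have "ln x \<le> 2 * ln (real p)" using x by (simp add: ln_sqrt)
          then have "1 \<le> (2 / ln x) * ln (real p)" using lx by (simp add: field_simps)
          from mult_right_mono[OF this lq[OF p]] show ?thesis using False by (simp add: mult.assoc)
        qed
        finally show "(1 - real p / x) * ln (x / real p) \<le> (if p \<in> split_primes_le (sqrt x) then ln x else 0) + (2 / ln x) * (ln (real p) * ln (x / real p))" .
      qed
      also have "\<dots> = (\<Sum>q\<in>split_primes_le x. if q \<in> split_primes_le (sqrt x) then ln x else 0) + (2 / ln x) * (\<Sum>q\<in>split_primes_le x. ln (real q) * ln (x / real q))"
        by (simp only: sum.distrib sum_distrib_left)
      also have "(\<Sum>q\<in>split_primes_le x. if q \<in> split_primes_le (sqrt x) then ln x else 0) = real (card (split_primes_le x \<inter> split_primes_le (sqrt x))) * ln x"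
        by (simp add: sum.inter_restrict[symmetric])
      also have "\<dots> \<le> sqrt x * ln x"
      proof (rule mult_right_mono)
        have "card (split_primes_le x \<inter> split_primes_le (sqrt x)) \<le> card (split_primes_le (sqrt x))" by (intro card_mono) auto
        then show "real (card (split_primes_le x \<inter> split_primes_le (sqrt x))) \<le> sqrt x"
          using card_split_primes_le[of "sqrt x"] x by simp
      qed (use lx in simp)
      also have "(2 / ln x) * (\<Sum>q\<in>split_primes_le x. ln (real q) * ln (x / real q)) \<le> (2 / ln x) * (C * x)"
        using C(2)[of x] x lx by (intro mult_left_mono) auto
      finally have R1: "R \<le> (2 * C + 1) * (x / ln x)" using elim(2) by (simp add: algebra_simps)
      have "ln x * pi1 x - x\<^sup>2 / 4 = x * (theta1 x - x / 4) + x * R"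
        using pi1_theta1[OF x] by (simp add: R_def algebra_simps power2_eq_square)
      then have "\<bar>ln x * pi1 x - x\<^sup>2 / 4\<bar> \<le> x * \<bar>theta1 x - x / 4\<bar> + x * R"
        using x R0 abs_triangle_ineq[of "x * (theta1 x - x / 4)" "x * R"] by (simp add: abs_mult)
      also have "\<dots> \<le> x * (K * (x / ln x)) + x * ((2 * C + 1) * (x / ln x))"
        using elim(1) R1 x by (intro add_mono mult_left_mono) auto
      also have "\<dots> = (K + 2 * C + 1) * (x\<^sup>2 / ln x)" by (simp add: algebra_simps power2_eq_square add_divide_distrib)
      finally have "\<bar>ln x * pi1 x - x\<^sup>2 / 4\<bar> / ln x \<le> (K + 2 * C + 1) * (x\<^sup>2 / ln x) / ln x"
        using lx by (intro divide_right_mono) auto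
      moreover have "\<bar>ln x * pi1 x - x\<^sup>2 / 4\<bar> / ln x = \<bar>pi1 x - x\<^sup>2 / (4 * ln x)\<bar>"
      proof -
        have "pi1 x - x\<^sup>2 / (4 * ln x) = (ln x * pi1 x - x\<^sup>2 / 4) / ln x" using lx by (simp add: field_simps)
        then show ?thesis using lx by (simp add: abs_divide)
      qed
      ultimately show "\<bar>pi1 x - x\<^sup>2 / (4 * ln x)\<bar> \<le> (K + 2 * C + 1) * (x\<^sup>2 / (ln x)\<^sup>2)"
        by (simp add: power2_eq_square)
    qed
  qed (use K C in simp)
qed

lemma pi1_nonneg: "pi1 x \<ge> 0"
  unfolding pi1_def by (intro sum_nonneg) (auto simp: split_primes_le_def)

lemma pi1_le_card: "x \<ge> 0 \<Longrightarrow> pi1 x \<le> x * real (card (split_primes_le x))"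
proof -
  have "pi1 x \<le> (\<Sum>q\<in>split_primes_le x. x)" unfolding pi1_def by (intro sum_mono) auto
  then show ?thesis by (simp add: mult.commute)
qed

lemma pi1_le_square: "x \<ge> 0 \<Longrightarrow> pi1 x \<le> x\<^sup>2"
  using pi1_le_card[of x] mult_left_mono[OF card_split_primes_le[of x], of x] by (simp add: power2_eq_square)

text \<open>\<open>pi1 x\<close> is at most \<open>x\<close> times the number of primes. Half of its
  main term is given up to the error.\<close>

lemma card_split_primes_lower:
  "eventually (\<lambda>x. real (card (split_primes_le x)) \<ge> x / (8 * ln x)) at_top"
proof -
  obtain K where K: "K > 0" "eventually (\<lambda>x. \<bar>pi1 x - x\<^sup>2 / (4 * ln x)\<bar> \<le> K * (x\<^sup>2 / (ln x)\<^sup>2)) at_top"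
    using pi1_asymp_eventually by blast
  have "filterlim (\<lambda>x::real. ln x) at_top at_top" by (rule ln_at_top)
  then have "eventually (\<lambda>x::real. ln x \<ge> 8 * K) at_top" by (simp add: filterlim_at_top)
  with K(2) show ?thesis using eventually_gt_at_top[of 1]
  proof eventually_elim
    case (elim x)
    have lx: "ln x > 0" using elim by simp
    have "K * (x\<^sup>2 / (ln x)\<^sup>2) \<le> x\<^sup>2 / (8 * ln x)"
      using elim lx by (simp add: field_simps power2_eq_square)
    moreover have "x\<^sup>2 / (4 * ln x) = 2 * (x\<^sup>2 / (8 * ln x))" by simp
    ultimately have "x\<^sup>2 / (8 * ln x) \<le> pi1 x" using elim(1) by linarith
    also have "\<dots> \<le> x * real (card (split_primes_le x))" using elim by (intro pi1_le_card) auto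
    finally have "x * (x / (8 * ln x)) \<le> x * real (card (split_primes_le x))" by (simp add: power2_eq_square)
    then show ?case using elim(3) by (simp only: mult_le_cancel_left_pos)
  qed
qed

section \<open>The dual problem\<close>

text \<open>\<open>lstep l\<close> is the gain \<open>ln (l + 2) - ln (l + 1)\<close> of raising a multiplicity from \<open>l\<close> to \<open>l + 1\<close>.\<close>

definition lstep :: "nat \<Rightarrow> real" where "lstep l = ln (1 + 1 / real (Suc l))"

text \<open>In the notation of the theorem, \<open>c = sqrt (8 * S2)\<close>.\<close>

definition S2 :: real where "S2 = (\<Sum>l. (lstep l)\<^sup>2)"

text \<open>Collects the errors of the estimate for \<open>pi1\<close> at the arguments
  \<open>T * lstep l\<close>. It converges since 3/2 > 1, whereas the sum of the
  \<open>lstep l\<close> themselves diverges.\<close>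

definition S3 :: real where "S3 = (\<Sum>l. lstep l powr (3/2))"

lemma lstep_pos: "lstep l > 0"
  unfolding lstep_def by (intro ln_gt_zero) simp

lemma lstep_le: "lstep l \<le> 1 / real (Suc l)"
  unfolding lstep_def by (rule ln_add_one_self_le_self) simp

lemma lstep_le_1: "lstep l \<le> 1"
proof -
  have "1 / real (Suc l) \<le> 1" by simp
  then show ?thesis using lstep_le[of l] by linarith
qed

lemma lstep_antimono:
  assumes "k \<le> l" shows "lstep l \<le> lstep k"
proof -
  have "1 / real (Suc l) \<le> 1 / real (Suc k)" using assms by (intro divide_left_mono) auto
  then have "1 + 1 / real (Suc l) \<le> 1 + 1 / real (Suc k)" by simp
  then show ?thesis unfolding lstep_def by (subst ln_le_cancel_iff) (auto intro!: add_pos_nonneg)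
qed

lemma sum_lstep: "(\<Sum>l<b. lstep l) = ln (real b + 1)"
proof (induction b)
  case (Suc b)
  have "1 + 1 / real (Suc b) = (real (Suc b) + 1) / real (Suc b)" by (simp add: field_simps)
  then have "lstep b = ln (real (Suc b) + 1) - ln (real (Suc b))"
    unfolding lstep_def by (simp add: ln_div)
  then show ?case using Suc by simp
qed simp

lemma summable_lstep_3: "summable (\<lambda>l. lstep l powr (3/2))"
proof (rule summable_comparison_test'[where N = 0])
  show "summable (\<lambda>l. real (Suc l) powr (- (3/2)))"
    using summable_real_powr_iff[of "- (3/2)"] summable_Suc_iff[of "\<lambda>n. real n powr (- (3/2))"] by simp
  fix l
  have "lstep l powr (3/2) \<le> (1 / real (Suc l)) powr (3/2)"
    using lstep_le[of l] lstep_pos[of l] by (intro powr_mono2) auto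
  also have "\<dots> = real (Suc l) powr (- (3/2))" by (simp add: powr_divide powr_minus_divide)
  finally show "norm (lstep l powr (3/2)) \<le> real (Suc l) powr (- (3/2))" by simp
qed

lemma square_le_powr: "0 < y \<Longrightarrow> y \<le> 1 \<Longrightarrow> y\<^sup>2 \<le> y powr (3/2)" for y :: real
proof -
  assume y: "0 < y" "y \<le> 1"
  have "y\<^sup>2 = y powr 2" using y by simp
  also have "\<dots> \<le> y powr (3/2)" using y by (intro powr_mono') auto
  finally show ?thesis .
qed

lemma summable_lstep_2: "summable (\<lambda>l. (lstep l)\<^sup>2)"
  by (rule summable_comparison_test'[OF summable_lstep_3, of 0])
     (use square_le_powr lstep_pos lstep_le_1 in auto)

lemma S2_pos: "S2 > 0"
  unfolding S2_def by (intro suminf_pos summable_lstep_2) (use lstep_pos in \<open>auto simp: less_le\<close>)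

lemma S3_nonneg: "S3 \<ge> 0"
  unfolding S3_def by (intro suminf_nonneg summable_lstep_3) auto

section \<open>The integrated prime count uniformly on the interval from 0 to T\<close>

lemma split_primes_le_empty: "y < 5 \<Longrightarrow> split_primes_le y = {}"
  using primes_1mod4_ge_5 by (force simp: split_primes_le_def)

lemma pi1_small: "y < 5 \<Longrightarrow> pi1 y = 0"
  by (simp add: pi1_def split_primes_le_empty)

lemma pi1_mono:
  assumes "x \<le> y" shows "pi1 x \<le> pi1 y"
proof -
  have "pi1 x \<le> (\<Sum>q\<in>split_primes_le x. y - real q)" unfolding pi1_def using assms by (intro sum_mono) auto
  also have "\<dots> \<le> pi1 y" unfolding pi1_def using assms
    by (intro sum_mono2 split_primes_le_mono finite_split_primes_le) (auto simp: split_primes_le_def)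
  finally show ?thesis .
qed

lemma pi1_step: "y \<ge> 0 \<Longrightarrow> pi1 (y + 1) \<le> pi1 y + (y + 1)"
proof -
  assume y: "y \<ge> 0"
  have "pi1 (y + 1) = (\<Sum>q\<in>split_primes_le (y + 1). y + 1 - real q)" by (simp add: pi1_def)
  also have "\<dots> \<le> (\<Sum>q\<in>split_primes_le (y + 1). (if q \<in> split_primes_le y then y - real q else 0) + 1)"
    by (intro sum_mono) (auto simp: split_primes_le_def)
  also have "\<dots> = pi1 y + real (card (split_primes_le (y + 1)))"
    unfolding pi1_def using split_primes_le_mono[of y "y + 1"]
    by (simp add: sum.distrib sum.inter_restrict[symmetric] Int_absorb1)
  also have "real (card (split_primes_le (y + 1))) \<le> y + 1" using y by (intro card_split_primes_le) simp
  finally show ?thesis by simp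
qed

lemma ln_le_2_sqrt: "z > 0 \<Longrightarrow> ln z \<le> 2 * sqrt z" for z :: real
proof -
  assume z: "z > 0"
  have "ln (sqrt z) \<le> sqrt z" using z ln_le_minus_one[of "sqrt z"] by simp
  then show ?thesis using z by (simp add: ln_sqrt)
qed

lemma powr_three_half: "y \<ge> 0 \<Longrightarrow> y powr (3/2) = y * sqrt y" for y :: real
  using powr_add[of y 1 "1/2"] by (cases "y = 0") (auto simp: powr_half_sqrt)

text \<open>Replaces \<open>ln y\<close> by \<open>ln T\<close> for all \<open>y\<close> up to
  \<open>T\<close> at once. For \<open>y \<le> sqrt T\<close> the trivial bound \<open>y^2\<close>
  is small enough; for larger \<open>y\<close> the logarithms are comparable, and
  \<open>ln (T / y) \<le> 2 * sqrt (T / y)\<close> trades the discrepancy for half a power of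
  \<open>T / y\<close>. The shift \<open>d\<close> allows for prices \<open>q\<close> as well as
  \<open>q - 1\<close>.\<close>

lemma pi1_uniform:
  "\<exists>C>0. eventually (\<lambda>T. \<forall>y d. 0 \<le> y \<longrightarrow> y \<le> T \<longrightarrow> 0 \<le> d \<longrightarrow> d \<le> 1 \<longrightarrow>
      \<bar>pi1 (y + d) - y\<^sup>2 / (4 * ln T)\<bar> \<le> C * (y powr (3/2) * sqrt T / (ln T)\<^sup>2)) at_top"
proof -
  obtain K where K: "K > 0" "eventually (\<lambda>x. \<bar>pi1 x - x\<^sup>2 / (4 * ln x)\<bar> \<le> K * (x\<^sup>2 / (ln x)\<^sup>2)) at_top"
    using pi1_asymp_eventually by blast
  then obtain x0 where x0: "\<And>x. x \<ge> x0 \<Longrightarrow> \<bar>pi1 x - x\<^sup>2 / (4 * ln x)\<bar> \<le> K * (x\<^sup>2 / (ln x)\<^sup>2)"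
    unfolding eventually_at_top_linorder by blast
  have e1: "eventually (\<lambda>T::real. sqrt T \<ge> x0) at_top"
    using sqrt_at_top by (simp add: filterlim_at_top)
  have e2: "eventually (\<lambda>T::real. (ln T)\<^sup>2 \<le> sqrt (sqrt T)) at_top" by real_asymp
  have e3: "eventually (\<lambda>T::real. (ln T)\<^sup>2 \<le> sqrt T) at_top" by real_asymp
  have e4: "eventually (\<lambda>T::real. ln T \<ge> 1) at_top" by real_asymp
  define C where "C = 4 * K + 8"
  show ?thesis
  proof (intro exI[of _ C] conjI)
    show "C > 0" using K by (simp add: C_def)
    show "eventually (\<lambda>T. \<forall>y d. 0 \<le> y \<longrightarrow> y \<le> T \<longrightarrow> 0 \<le> d \<longrightarrow> d \<le> 1 \<longrightarrow>
      \<bar>pi1 (y + d) - y\<^sup>2 / (4 * ln T)\<bar> \<le> C * (y powr (3/2) * sqrt T / (ln T)\<^sup>2)) at_top"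
      using e1 e2 e3 e4 eventually_ge_at_top[of 25]
    proof eventually_elim
      case (elim T)
      have lT: "ln T > 0" using elim by simp
      show ?case
      proof (intro allI impI)
        fix y d :: real assume y: "0 \<le> y" "y \<le> T" and d: "0 \<le> d" "d \<le> 1"
        define W where "W = y powr (3/2) * sqrt T / (ln T)\<^sup>2"
        have Wn: "W = y * (sqrt y * sqrt T) / (ln T)\<^sup>2" unfolding W_def using y by (simp add: powr_three_half)
        have W0: "W \<ge> 0" unfolding Wn using y elim by simp
        show "\<bar>pi1 (y + d) - y\<^sup>2 / (4 * ln T)\<bar> \<le> C * (y powr (3/2) * sqrt T / (ln T)\<^sup>2)"
          unfolding W_def[symmetric]
        proof (cases "y \<le> sqrt T")
          case True
          have p: "pi1 (y + d) \<le> 4 * y\<^sup>2"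
          \<comment> \<open>Below 4 the argument \<open>y + d\<close> is less than 5, the smallest
            prime congruent to 1 modulo 4; from 4 on, the shift is at most \<open>y\<close>
            itself.\<close>
          proof (cases "y < 4")
            case True
            then show ?thesis using d by (simp add: pi1_small)
          next
            case False
            have "pi1 (y + d) \<le> (y + d)\<^sup>2" using y d by (intro pi1_le_square) simp
            also have "\<dots> \<le> (2 * y)\<^sup>2" using False d by (intro power_mono) auto
            finally show ?thesis by (simp add: power_mult_distrib)
          qed
          have "y\<^sup>2 / (4 * ln T) \<le> y\<^sup>2 / 1" using elim(4) by (intro divide_left_mono) auto
          then have "y\<^sup>2 / (4 * ln T) \<le> y\<^sup>2" by simp
          moreover have "y\<^sup>2 / (4 * ln T) \<ge> 0" using lT by simp
          ultimately have "\<bar>pi1 (y + d) - y\<^sup>2 / (4 * ln T)\<bar> \<le> 4 * y\<^sup>2" using p pi1_nonneg[of "y + d"] zero_le_power2[of y] by linarith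
          also have "y\<^sup>2 \<le> W"
          proof -
            have "sqrt y \<le> sqrt (sqrt T)" using True by simp
            moreover have "sqrt y \<ge> 0" using y by simp
            ultimately have "sqrt y * (ln T)\<^sup>2 \<le> sqrt (sqrt T) * sqrt (sqrt T)"
              using elim(2) elim(5) by (intro mult_mono) auto
            also have "\<dots> = sqrt T" using elim(5) by simp
            finally have "y * sqrt y * (sqrt y * (ln T)\<^sup>2) \<le> y * sqrt y * sqrt T"
              using y by (intro mult_left_mono) auto
            moreover have "y * sqrt y * (sqrt y * (ln T)\<^sup>2) = y\<^sup>2 * (ln T)\<^sup>2"
            proof -
              have "y * sqrt y * (sqrt y * (ln T)\<^sup>2) = y * (sqrt y * sqrt y) * (ln T)\<^sup>2" by (simp only: mult.assoc)
              also have "sqrt y * sqrt y = y" using y by simp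
              finally show ?thesis by (simp add: power2_eq_square)
            qed
            ultimately have "y\<^sup>2 * (ln T)\<^sup>2 \<le> y * sqrt y * sqrt T" by (simp only:)
            then show ?thesis unfolding Wn using lT by (simp add: pos_le_divide_eq mult.assoc)
          qed
          finally have "\<bar>pi1 (y + d) - y\<^sup>2 / (4 * ln T)\<bar> \<le> 4 * W" by simp
          also have "\<dots> \<le> C * W" using W0 K(1) by (intro mult_right_mono) (auto simp: C_def)
          finally show "\<bar>pi1 (y + d) - y\<^sup>2 / (4 * ln T)\<bar> \<le> C * W" .
        next
          case False
          then have yT: "y > sqrt T" by simp
          have sT: "sqrt T \<ge> 5" using elim by (intro real_le_rsqrt) auto
          have y1: "y \<ge> 5" using yT sT by simp
          have "ln (sqrt T) \<le> ln y" using yT elim y1 by (subst ln_le_cancel_iff) auto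
          then have ly: "ln y \<ge> ln T / 2" using elim by (simp add: ln_sqrt)
          have ly0: "ln y > 0" using y1 by simp
          have y2W: "y\<^sup>2 / (ln T)\<^sup>2 \<le> W"
          proof -
            have "sqrt y * sqrt y \<le> sqrt y * sqrt T" using y by (intro mult_left_mono) auto
            then have "y * y \<le> y * (sqrt y * sqrt T)" using y by (intro mult_left_mono) auto
            then show ?thesis unfolding Wn by (intro divide_right_mono) (auto simp: power2_eq_square)
          qed
          have a1: "\<bar>pi1 (y + d) - pi1 y\<bar> \<le> 2 * W"
          proof -
            have "pi1 y \<le> pi1 (y + d)" using d by (intro pi1_mono) simp
            moreover have "pi1 (y + d) \<le> pi1 (y + 1)" using d by (intro pi1_mono) simp
            ultimately have "\<bar>pi1 (y + d) - pi1 y\<bar> \<le> y + 1" using pi1_step[of y] y by linarith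
            also have "\<dots> \<le> 2 * y" using y1 by simp
            also have "y \<le> W"
            proof -
              have "sqrt y \<ge> 1" using y1 by simp
              then have "1 * sqrt T \<le> sqrt y * sqrt T" using elim(5) by (intro mult_right_mono) auto
              then have "(ln T)\<^sup>2 \<le> sqrt y * sqrt T" using elim(3) by linarith
              then have "y * (ln T)\<^sup>2 \<le> y * (sqrt y * sqrt T)" using y by (intro mult_left_mono) auto
              then show ?thesis unfolding Wn using lT by (simp add: field_simps)
            qed
            finally show ?thesis by simp
          qed
          have a2: "\<bar>pi1 y - y\<^sup>2 / (4 * ln y)\<bar> \<le> 4 * K * W"
          proof -
            have "\<bar>pi1 y - y\<^sup>2 / (4 * ln y)\<bar> \<le> K * (y\<^sup>2 / (ln y)\<^sup>2)" using x0[of y] yT elim(1) by simp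
            also have "y\<^sup>2 / (ln y)\<^sup>2 \<le> y\<^sup>2 / (ln T / 2)\<^sup>2"
              using ly lT ly0 by (intro divide_left_mono power_mono) auto
            also have "\<dots> = 4 * (y\<^sup>2 / (ln T)\<^sup>2)" by (simp add: power_divide)
            also have "\<dots> \<le> 4 * W" using y2W by simp
            finally show ?thesis using K(1) by (simp add: mult_left_mono)
          qed
          have a3: "\<bar>y\<^sup>2 / (4 * ln y) - y\<^sup>2 / (4 * ln T)\<bar> \<le> W"
          proof -
            have r: "ln (T / y) = ln T - ln y" using y1 elim by (simp add: ln_div)
            have lTy: "ln y \<le> ln T" using y y1 by simp
            have "y\<^sup>2 / (4 * ln y) - y\<^sup>2 / (4 * ln T) = y\<^sup>2 * ln (T / y) / (4 * ln y * ln T)"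
              unfolding r using ly0 lT by (simp add: field_simps)
            moreover have "0 \<le> y\<^sup>2 * ln (T / y) / (4 * ln y * ln T)"
              using ly0 lT lTy unfolding r by simp
            ultimately have "\<bar>y\<^sup>2 / (4 * ln y) - y\<^sup>2 / (4 * ln T)\<bar> = y\<^sup>2 * ln (T / y) / (4 * ln y * ln T)"
              by (simp only: abs_of_nonneg)
            also have "\<dots> \<le> y\<^sup>2 * (2 * sqrt (T / y)) / (4 * (ln T / 2) * ln T)"
            proof (rule frac_le)
              show "y\<^sup>2 * ln (T / y) \<le> y\<^sup>2 * (2 * sqrt (T / y))"
                using y1 elim by (intro mult_left_mono ln_le_2_sqrt) auto
              show "4 * (ln T / 2) * ln T \<le> 4 * ln y * ln T" using ly lT by (intro mult_right_mono) auto
            qed (use lT y elim in auto)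
            also have "\<dots> = y\<^sup>2 * sqrt (T / y) / (ln T)\<^sup>2" by (simp add: power2_eq_square)
            also have "y\<^sup>2 * sqrt (T / y) = y * (sqrt y * sqrt T)"
            proof -
              define w where "w = sqrt y"
              have w: "w > 0" "y = w * w" using y1 by (auto simp: w_def)
              have e1: "y\<^sup>2 = (w * w) * (w * w)" unfolding power2_eq_square by (simp only: w(2)[symmetric])
              have e2: "sqrt (T / y) = sqrt T / w" by (simp add: real_sqrt_divide w_def)
              have "y\<^sup>2 * sqrt (T / y) = (w * w) * (w * sqrt T)" unfolding e1 e2 using w(1) by (simp add: field_simps)
              also have "\<dots> = y * (sqrt y * sqrt T)" by (simp only: w(2)[symmetric] w_def[symmetric])
              finally show ?thesis .
            qed
            finally show ?thesis by (simp add: Wn)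
          qed
          have "\<bar>pi1 (y + d) - y\<^sup>2 / (4 * ln T)\<bar> \<le> 2 * W + 4 * K * W + W" using a1 a2 a3 by linarith
          also have "\<dots> \<le> C * W" using W0 by (simp add: C_def algebra_simps)
          finally show "\<bar>pi1 (y + d) - y\<^sup>2 / (4 * ln T)\<bar> \<le> C * W" .
        qed
      qed
    qed
  qed
qed

text \<open>The conjugate term of the dual problem: the total surplus of all units whose gain,
  valued at \<open>T\<close>, exceeds their price. The price of a unit of \<open>q\<close> is
  \<open>q - 1\<close> for \<open>d = 1\<close> (upper bound) and \<open>q\<close> for
  \<open>d = 0\<close> (greedy solution).\<close>

definition Phi :: "real \<Rightarrow> real \<Rightarrow> real" where
  "Phi d T = (\<Sum>l. pi1 (T * lstep l + d))"

lemma pi1_lstep_finite: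
  assumes "T \<ge> 0" "d \<le> 1" "l \<ge> nat \<lceil>T\<rceil>"
  shows "pi1 (T * lstep l + d) = 0"
proof (rule pi1_small)
  have "T \<le> real l" using assms(3) by linarith
  have "T * lstep l \<le> T * (1 / real (Suc l))" using assms(1) lstep_le by (intro mult_left_mono) auto
  also have "\<dots> \<le> 1" using \<open>T \<le> real l\<close> by (simp add: field_simps)
  finally show "T * lstep l + d < 5" using assms(2) by simp
qed

lemma summable_Phi: "T \<ge> 0 \<Longrightarrow> d \<le> 1 \<Longrightarrow> summable (\<lambda>l. pi1 (T * lstep l + d))"
  by (rule summable_finite[of "{..<nat \<lceil>T\<rceil>}"]) (simp_all only: finite_lessThan lessThan_iff not_less pi1_lstep_finite)

text \<open>The uniform estimate at \<open>y = T * lstep l\<close> has error of order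
  \<open>T^2 * lstep l powr (3/2) / (ln T)^2\<close>, and these errors sum to a multiple of
  \<open>S3\<close>.\<close>

lemma Phi_asymp:
  "\<exists>C>0. eventually (\<lambda>T. \<forall>d. 0 \<le> d \<longrightarrow> d \<le> 1 \<longrightarrow> \<bar>Phi d T - T\<^sup>2 * S2 / (4 * ln T)\<bar> \<le> C * (T\<^sup>2 / (ln T)\<^sup>2)) at_top"
proof -
  obtain C where C: "C > 0" "eventually (\<lambda>T. \<forall>y d. 0 \<le> y \<longrightarrow> y \<le> T \<longrightarrow> 0 \<le> d \<longrightarrow> d \<le> 1 \<longrightarrow>
      \<bar>pi1 (y + d) - y\<^sup>2 / (4 * ln T)\<bar> \<le> C * (y powr (3/2) * sqrt T / (ln T)\<^sup>2)) at_top"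
    using pi1_uniform by blast
  show ?thesis
  proof (intro exI[of _ "C * S3 + 1"] conjI)
    show "C * S3 + 1 > 0" using C(1) S3_nonneg by (simp add: add_nonneg_pos)
    show "eventually (\<lambda>T. \<forall>d. 0 \<le> d \<longrightarrow> d \<le> 1 \<longrightarrow> \<bar>Phi d T - T\<^sup>2 * S2 / (4 * ln T)\<bar> \<le> (C * S3 + 1) * (T\<^sup>2 / (ln T)\<^sup>2)) at_top"
      using C(2) eventually_gt_at_top[of 1]
    proof eventually_elim
      case (elim T)
      show ?case
      proof (intro allI impI)
        fix d :: real assume d: "0 \<le> d" "d \<le> 1"
        have T: "T > 1" "ln T > 0" using elim by auto
        have bd: "\<bar>pi1 (T * lstep l + d) - T\<^sup>2 / (4 * ln T) * (lstep l)\<^sup>2\<bar> \<le> C * (T\<^sup>2 / (ln T)\<^sup>2) * lstep l powr (3/2)" for l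
        proof -
          have y: "0 \<le> T * lstep l" "T * lstep l \<le> T" using T lstep_pos[of l] lstep_le_1[of l] by auto
          have "\<bar>pi1 (T * lstep l + d) - (T * lstep l)\<^sup>2 / (4 * ln T)\<bar> \<le> C * ((T * lstep l) powr (3/2) * sqrt T / (ln T)\<^sup>2)"
            using elim(1) y d by blast
          moreover have "(T * lstep l) powr (3/2) * sqrt T = T\<^sup>2 * lstep l powr (3/2)"
          proof -
            have "(T * lstep l) powr (3/2) = T powr (3/2) * lstep l powr (3/2)"
              using T lstep_pos[of l] by (subst powr_mult) auto
            moreover have "T powr (3/2) * sqrt T = T\<^sup>2" using T by (simp add: powr_three_half power2_eq_square)
            ultimately show ?thesis by simp
          qed
          ultimately show ?thesis by (simp add: power_mult_distrib mult_ac)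
        qed
        have s1: "summable (\<lambda>l. pi1 (T * lstep l + d))" using T d by (intro summable_Phi) auto
        have s2: "summable (\<lambda>l. T\<^sup>2 / (4 * ln T) * (lstep l)\<^sup>2)" by (intro summable_mult summable_lstep_2)
        have s3: "summable (\<lambda>l. C * (T\<^sup>2 / (ln T)\<^sup>2) * lstep l powr (3/2))" by (intro summable_mult summable_lstep_3)
        have "Phi d T - T\<^sup>2 / (4 * ln T) * S2 = (\<Sum>l. pi1 (T * lstep l + d) - T\<^sup>2 / (4 * ln T) * (lstep l)\<^sup>2)"
          unfolding Phi_def S2_def suminf_mult[OF summable_lstep_2, symmetric] by (rule suminf_diff[OF s1 s2])
        also have "\<bar>\<dots>\<bar> \<le> (\<Sum>l. C * (T\<^sup>2 / (ln T)\<^sup>2) * lstep l powr (3/2))"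
          using norm_suminf_le[OF _ s3, of "\<lambda>l. pi1 (T * lstep l + d) - T\<^sup>2 / (4 * ln T) * (lstep l)\<^sup>2"] bd by simp
        also have "\<dots> = C * (T\<^sup>2 / (ln T)\<^sup>2) * S3" unfolding S3_def by (rule suminf_mult[OF summable_lstep_3])
        also have "\<dots> \<le> (C * S3 + 1) * (T\<^sup>2 / (ln T)\<^sup>2)"
        proof -
          have "0 \<le> T\<^sup>2 / (ln T)\<^sup>2" by simp
          moreover have "C * (T\<^sup>2 / (ln T)\<^sup>2) * S3 = (C * S3) * (T\<^sup>2 / (ln T)\<^sup>2)" by (simp only: mult_ac)
          ultimately show ?thesis unfolding distrib_right by linarith
        qed
        finally show "\<bar>Phi d T - T\<^sup>2 * S2 / (4 * ln T)\<bar> \<le> (C * S3 + 1) * (T\<^sup>2 / (ln T)\<^sup>2)" by simp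
      qed
    qed
  qed
qed

section \<open>The upper bound\<close>

text \<open>Writing \<open>ln (b + 1)\<close> as a sum of steps makes both objective and cost
  additive over units \<open>(q, l)\<close>. Each unit has net value
  \<open>T * lstep l - (q - 1)\<close>; the negative ones are dropped and all positive ones are
  included.\<close>

lemma weak_duality:
  assumes A: "finite A" "A \<subseteq> primes_1mod4" and T: "T > 0"
  shows "(\<Sum>q\<in>A. ln (real (b q) + 1)) \<le> ((\<Sum>q\<in>A. real (b q) * (real q - 1)) + Phi 1 T) / T"
proof -
  \<comment> \<open>A common bound for the multiplicities, so that the order of the two sums can be
    exchanged.\<close>
  define B where "B = Suc (Max (insert 0 (b ` A)))"
  have bB: "b q \<le> B" if "q \<in> A" for q
  proof -
    have "b q \<le> Max (insert 0 (b ` A))" using A(1) that by (intro Max_ge) auto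
    then show ?thesis by (simp add: B_def)
  qed
  have "T * (\<Sum>q\<in>A. ln (real (b q) + 1)) - (\<Sum>q\<in>A. real (b q) * (real q - 1)) = (\<Sum>q\<in>A. \<Sum>l<b q. T * lstep l - (real q - 1))"
    by (simp add: sum_subtractf sum_distrib_left[symmetric] sum_lstep)
  also have "\<dots> \<le> (\<Sum>q\<in>A. \<Sum>l<B. max 0 (T * lstep l - (real q - 1)))"
  proof (rule sum_mono)
    fix q assume q: "q \<in> A"
    have "(\<Sum>l<b q. T * lstep l - (real q - 1)) \<le> (\<Sum>l<b q. max 0 (T * lstep l - (real q - 1)))"
      by (intro sum_mono) auto
    also have "\<dots> \<le> (\<Sum>l<B. max 0 (T * lstep l - (real q - 1)))"
      using bB[OF q] by (intro sum_mono2) auto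
    finally show "(\<Sum>l<b q. T * lstep l - (real q - 1)) \<le> (\<Sum>l<B. max 0 (T * lstep l - (real q - 1)))" .
  qed
  also have "\<dots> = (\<Sum>l<B. \<Sum>q\<in>A. max 0 (T * lstep l - (real q - 1)))" by (rule sum.swap)
  also have "\<dots> \<le> (\<Sum>l<B. pi1 (T * lstep l + 1))"
  proof (rule sum_mono)
    fix l
    have "(\<Sum>q\<in>A. max 0 (T * lstep l - (real q - 1))) = (\<Sum>q\<in>A \<inter> split_primes_le (T * lstep l + 1). max 0 (T * lstep l - (real q - 1)))"
      using A by (intro sum.mono_neutral_right) (auto simp: split_primes_le_def)
    also have "\<dots> = (\<Sum>q\<in>A \<inter> split_primes_le (T * lstep l + 1). T * lstep l + 1 - real q)"
      by (intro sum.cong) (auto simp: split_primes_le_def)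
    also have "\<dots> \<le> pi1 (T * lstep l + 1)" unfolding pi1_def
      by (intro sum_mono2 finite_split_primes_le) (auto simp: split_primes_le_def)
    finally show "(\<Sum>q\<in>A. max 0 (T * lstep l - (real q - 1))) \<le> pi1 (T * lstep l + 1)" .
  qed
  also have "\<dots> \<le> Phi 1 T" unfolding Phi_def
    using T by (intro sum_le_suminf summable_Phi) (auto simp: pi1_nonneg)
  finally show ?thesis using T by (simp add: field_simps)
qed

section \<open>Exponents needed for prescribed prime factors\<close>

lemma prod_prime_powers_le:
  fixes k :: nat
  assumes "k > 0" "finite A" "\<And>q. q \<in> A \<Longrightarrow> prime q"
  shows "(\<Prod>q\<in>A. q ^ multiplicity q k) \<le> k"
proof -
  have "(\<Prod>q\<in>A. q ^ multiplicity q k) = (\<Prod>q\<in>A \<inter> prime_factors k. q ^ multiplicity q k)"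
  proof (rule prod.mono_neutral_right)
    show "\<forall>q\<in>A - A \<inter> prime_factors k. q ^ multiplicity q k = 1"
    proof
      fix q assume "q \<in> A - A \<inter> prime_factors k"
      then have "\<not> q dvd k" using assms by (auto simp: in_prime_factors_iff)
      then show "q ^ multiplicity q k = 1" by (simp add: not_dvd_imp_multiplicity_0)
    qed
  qed (use assms in auto)
  also have "\<dots> dvd (\<Prod>q\<in>prime_factors k. q ^ multiplicity q k)" by (intro prod_dvd_prod_subset) auto
  also have "\<dots> = k" using assms(1) prime_factorization_nat[of k] by simp
  finally show ?thesis using assms(1) by (intro dvd_imp_le) auto
qed

text \<open>Bernoulli's inequality for each prime power, then
  \<open>(1 + u) (1 + s) \<ge> 1 + u + s\<close> for nonnegative numbers.\<close>

lemma bernoulli_prod: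
  fixes e :: "nat \<Rightarrow> nat"
  assumes "finite A" "\<And>q. q \<in> A \<Longrightarrow> q \<ge> 1"
  shows "1 + (\<Sum>q\<in>A. real (e q) * (real q - 1)) \<le> real (\<Prod>q\<in>A. q ^ e q)"
  using assms
proof (induction A rule: finite_induct)
  case (insert q A)
  define s where "s = (\<Sum>q\<in>A. real (e q) * (real q - 1))"
  have s0: "s \<ge> 0" unfolding s_def using insert.prems by (intro sum_nonneg) auto
  have q1: "real q \<ge> 1" using insert.prems by simp
  have a0: "real (e q) * (real q - 1) \<ge> 0" using q1 by simp
  have "1 + real (e q) * (real q - 1) \<le> (1 + (real q - 1)) ^ e q"
    using q1 by (intro Bernoulli_inequality) simp
  then have p: "1 + real (e q) * (real q - 1) \<le> real q ^ e q" by simp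
  have "1 + (real (e q) * (real q - 1) + s) \<le> (1 + real (e q) * (real q - 1)) * (1 + s)"
    using mult_nonneg_nonneg[OF a0 s0] unfolding distrib_left distrib_right by simp
  also have "\<dots> \<le> real q ^ e q * real (\<Prod>q\<in>A. q ^ e q)"
    using p s0 a0 insert by (intro mult_mono) (auto simp: s_def)
  finally show ?case using insert.hyps by (simp add: s_def)
qed simp

lemma sum_multiplicity_ln_le:
  assumes "k > 0" "finite A" "\<And>q. q \<in> A \<Longrightarrow> prime (q::nat)"
  shows "(\<Sum>q\<in>A. real (multiplicity q k) * ln (real q)) \<le> ln (real k)"
proof -
  have q0: "q > 0" if "q \<in> A" for q using assms(3)[OF that] by (rule prime_gt_0_nat)
  have "(\<Sum>q\<in>A. real (multiplicity q k) * ln (real q)) = (\<Sum>q\<in>A. ln (real q ^ multiplicity q k))"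
    by (simp add: ln_realpow q0)
  also have "\<dots> = ln (\<Prod>q\<in>A. real q ^ multiplicity q k)" using q0 assms(2) by (subst ln_prod) auto
  also have "(\<Prod>q\<in>A. real q ^ multiplicity q k) = real (\<Prod>q\<in>A. q ^ multiplicity q k)" by simp
  also have "ln \<dots> \<le> ln (real k)"
  proof (subst ln_le_cancel_iff)
    show "0 < real (\<Prod>q\<in>A. q ^ multiplicity q k)" using q0 by (simp add: prod_pos)
    show "real (\<Prod>q\<in>A. q ^ multiplicity q k) \<le> real k" using prod_prime_powers_le[OF assms] by (simp only: of_nat_le_iff)
  qed (use assms in auto)
  finally show ?thesis .
qed

text \<open>With \<open>k\<close> one more than an exponent in \<open>n\<close>, the exponent is at
  least the sum of \<open>q - 1\<close> over the prime factors of \<open>k\<close>. Packing several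
  of them into one exponent never beats paying for each separately.\<close>

lemma sum_multiplicity_minus_one_le:
  assumes "k > 0" "finite A" "\<And>q. q \<in> A \<Longrightarrow> prime (q::nat)"
  shows "(\<Sum>q\<in>A. real (multiplicity q k) * (real q - 1)) \<le> real k - 1"
proof -
  have "1 + (\<Sum>q\<in>A. real (multiplicity q k) * (real q - 1)) \<le> real (\<Prod>q\<in>A. q ^ multiplicity q k)"
    by (rule bernoulli_prod) (use assms prime_ge_1_nat in auto)
  also have "\<dots> \<le> real k" using prod_prime_powers_le[OF assms] by (simp only: of_nat_le_iff)
  finally show ?thesis by simp
qed

lemma one_le_ln_5: "1 \<le> ln (5::real)"
proof -
  have "exp (1::real) \<le> 5" using exp_le by simp
  then show ?thesis by (subst ln_ge_iff) auto
qed

text \<open>The primes dividing \<open>n\<close> are split at \<open>y\<close>, and the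
  multiplicities of \<open>delta n\<close> accordingly as \<open>b1 + b2\<close>. There are at most
  \<open>y\<close> small primes, each contributing at most \<open>ln (ln x + 1)\<close>. For the
  large ones the exponents add up to at most \<open>ln x / ln y\<close>, and weak duality applies to
  \<open>b2\<close>.\<close>

lemma delta_delta_upper:
  assumes n: "n \<ge> 1" "real n \<le> x" and pos: "delta_delta n > 0" and x: "x > 1" and y: "y > 1" and T: "T > 0"
  shows "ln (real_of_rat (delta_delta n)) \<le> y * ln (ln x + 1) + (ln x / ln y + Phi 1 T) / T"
proof -
  have Phi0: "Phi 1 T \<ge> 0" unfolding Phi_def
    using T by (intro suminf_nonneg summable_Phi) (auto simp: pi1_nonneg)
  have rhs0: "y * ln (ln x + 1) + (ln x / ln y + Phi 1 T) / T \<ge> 0"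
    using x y T Phi0 by (intro add_nonneg_nonneg mult_nonneg_nonneg divide_nonneg_nonneg) auto
  show ?thesis
  proof (cases "delta n = 0")
    case True
    \<comment> \<open>Here \<open>delta_delta n = delta 0 = 1 / 4\<close>, whose logarithm is negative.\<close>
    have "sq_reps 0 = {(0, 0)}" by (auto simp: sq_reps_def sum_power2_eq_zero_iff)
    then have "delta_delta n = 1 / 4" using True by (simp add: delta_delta_def delta_sq_reps)
    then have "real_of_rat (delta_delta n) = 1 / 4" by (simp only: of_rat_divide of_rat_1 of_rat_numeral_eq)
    then have "ln (real_of_rat (delta_delta n)) = ln (1 / 4)" by (simp only:)
    also have "ln (1 / 4 :: real) \<le> 0" by (simp add: ln_div)
    finally show ?thesis using rhs0 by linarith
  next
    case False
    define m where "m = split_part n"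
    have dn: "delta n = of_nat m" unfolding m_def using n False by (intro delta_eq_split_part) auto
    have dd: "delta_delta n = delta m" by (simp add: delta_delta_def dn)
    have m0: "m > 0" unfolding m_def split_part_def by (intro prod_pos) auto
    have dm: "delta m = of_nat (split_part m)" using m0 pos dd by (intro delta_eq_split_part) auto
    define A where "A = {q \<in> prime_factors m. q mod 4 = 1}"
    define Q where "Q = {p \<in> prime_factors n. p mod 4 = 1}"
    define a where "a = (\<lambda>p. multiplicity p n)"
    have fA: "finite A" and fQ: "finite Q" by (auto simp: A_def Q_def)
    have AP: "A \<subseteq> primes_1mod4" and QP: "Q \<subseteq> primes_1mod4" by (auto simp: A_def Q_def primes_1mod4_def in_prime_factors_iff)
    have prA: "prime q" if "q \<in> A" for q using AP that by (auto simp: primes_1mod4_def)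
    have prQ: "prime q" if "q \<in> Q" for q using QP that by (auto simp: primes_1mod4_def)
    have mQ: "m = (\<Prod>p\<in>Q. a p + 1)" by (simp add: m_def split_part_def Q_def a_def)
    \<comment> \<open>The share of the prime \<open>q\<close> that the exponent of \<open>p\<close>
      contributes to \<open>delta n\<close>.\<close>
    define v where "v = (\<lambda>q p. multiplicity q (a p + 1))"
    have mv: "multiplicity q m = (\<Sum>p\<in>Q. v q p)" if "q \<in> A" for q
      unfolding mQ v_def using prA[OF that] fQ by (intro prime_elem_multiplicity_prod_distrib) auto
    define Q1 where "Q1 = {p\<in>Q. real p \<le> y}"
    define Q2 where "Q2 = {p\<in>Q. real p > y}"
    have QQ: "Q = Q1 \<union> Q2" "Q1 \<inter> Q2 = {}" "finite Q1" "finite Q2" using fQ by (auto simp: Q1_def Q2_def)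
    define b1 where "b1 = (\<lambda>q. \<Sum>p\<in>Q1. v q p)"
    define b2 where "b2 = (\<lambda>q. \<Sum>p\<in>Q2. v q p)"
    have mb: "multiplicity q m = b1 q + b2 q" if "q \<in> A" for q
      unfolding mv[OF that] b1_def b2_def QQ(1) using QQ by (intro sum.union_disjoint) auto
    have lnx: "(\<Sum>p\<in>Q. real (a p) * ln (real p)) \<le> ln x"
    proof -
      have "(\<Sum>p\<in>Q. real (a p) * ln (real p)) \<le> ln (real n)" unfolding a_def
        using n fQ prQ by (intro sum_multiplicity_ln_le) auto
      also have "\<dots> \<le> ln x" using n by simp
      finally show ?thesis .
    qed
    have lnp: "ln (real p) \<ge> 1" if "p \<in> Q \<or> p \<in> A" for p
    proof -
      have "p \<ge> 5" using that AP QP primes_1mod4_ge_5 by blast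
      then have "ln 5 \<le> ln (real p)" by simp
      then show ?thesis using one_le_ln_5 by linarith
    qed
    have "ln (real_of_rat (delta_delta n)) = ln (real (split_part m))" by (simp add: dd dm)
    also have "real (split_part m) = (\<Prod>q\<in>A. real (multiplicity q m) + 1)"
      by (simp add: split_part_def A_def add.commute)
    also have "ln \<dots> = (\<Sum>q\<in>A. ln (real (multiplicity q m) + 1))"
      using fA by (subst ln_prod) (auto intro!: add_nonneg_pos)
    also have "\<dots> \<le> (\<Sum>q\<in>A. ln (real (b1 q) + 1) + ln (real (b2 q) + 1))"
    proof (rule sum_mono)
      fix q assume q: "q \<in> A"
      have "ln (real (b1 q) + 1) + ln (real (b2 q) + 1) = ln ((real (b1 q) + 1) * (real (b2 q) + 1))"
        by (simp add: ln_mult add_nonneg_pos)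
      also have "\<dots> \<ge> ln (real (multiplicity q m) + 1)"
      proof -
        have p: "0 < real k + 1" for k :: nat by (simp add: add_nonneg_pos)
        have "real (multiplicity q m) + 1 \<le> (real (b1 q) + 1) * (real (b2 q) + 1)"
          unfolding mb[OF q] by (simp add: algebra_simps)
        then show ?thesis using p mult_pos_pos[OF p[of "b1 q"] p[of "b2 q"]] by (subst ln_le_cancel_iff) auto
      qed
      finally show "ln (real (multiplicity q m) + 1) \<le> ln (real (b1 q) + 1) + ln (real (b2 q) + 1)" .
    qed
    also have "\<dots> = (\<Sum>q\<in>A. ln (real (b1 q) + 1)) + (\<Sum>q\<in>A. ln (real (b2 q) + 1))" by (rule sum.distrib)
    also have "(\<Sum>q\<in>A. ln (real (b1 q) + 1)) \<le> y * ln (ln x + 1)"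
    proof -
      \<comment> \<open>The passage to \<open>ln q \<ge> ln 5 \<ge> 1\<close> is wasteful but linear
        in \<open>b1\<close>, so the sum can be regrouped by \<open>p\<close> and compared with
        \<open>ln (a p + 1)\<close>.\<close>
      have "(\<Sum>q\<in>A. ln (real (b1 q) + 1)) \<le> (\<Sum>q\<in>A. real (b1 q) * ln (real q))"
      proof (rule sum_mono)
        fix q assume q: "q \<in> A"
        have "ln (real (b1 q) + 1) \<le> real (b1 q)" using ln_add_one_self_le_self[of "real (b1 q)"] by (simp add: add.commute)
        also have "\<dots> \<le> real (b1 q) * ln (real q)" using lnp[of q] q mult_left_mono[of 1 "ln (real q)" "real (b1 q)"] by simp
        finally show "ln (real (b1 q) + 1) \<le> real (b1 q) * ln (real q)" .
      qed
      also have "\<dots> = (\<Sum>q\<in>A. \<Sum>p\<in>Q1. real (v q p) * ln (real q))" by (simp add: b1_def sum_distrib_right)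
      also have "\<dots> = (\<Sum>p\<in>Q1. \<Sum>q\<in>A. real (v q p) * ln (real q))" by (rule sum.swap)
      also have "\<dots> \<le> (\<Sum>p\<in>Q1. ln (ln x + 1))"
      proof (rule sum_mono)
        fix p assume p: "p \<in> Q1"
        have "(\<Sum>q\<in>A. real (v q p) * ln (real q)) \<le> ln (real (a p + 1))"
          unfolding v_def using fA prA by (intro sum_multiplicity_ln_le) auto
        also have "\<dots> \<le> ln (ln x + 1)"
        proof -
          have pQ: "p \<in> Q" using p by (simp add: Q1_def)
          have "real (a p) \<le> real (a p) * ln (real p)" using lnp[of p] pQ mult_left_mono[of 1 "ln (real p)" "real (a p)"] by simp
          also have "\<dots> \<le> (\<Sum>p\<in>Q. real (a p) * ln (real p))"
          proof (rule member_le_sum[OF pQ _ fQ])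
            fix p' assume "p' \<in> Q - {p}"
            then have "ln (real p') \<ge> 1" using lnp by blast
            then show "0 \<le> real (a p') * ln (real p')" by simp
          qed
          also have "\<dots> \<le> ln x" by (rule lnx)
          finally show ?thesis by (subst ln_le_cancel_iff) (use x in \<open>auto intro!: add_pos_pos\<close>)
        qed
        finally show "(\<Sum>q\<in>A. real (v q p) * ln (real q)) \<le> ln (ln x + 1)" .
      qed
      also have "\<dots> = real (card Q1) * ln (ln x + 1)" by simp
      also have "\<dots> \<le> y * ln (ln x + 1)"
      proof (rule mult_right_mono)
        have "Q1 \<subseteq> split_primes_le y" using QP by (auto simp: Q1_def split_primes_le_def)
        then have "card Q1 \<le> card (split_primes_le y)" by (intro card_mono) auto
        then show "real (card Q1) \<le> y" using card_split_primes_le[of y] y by simp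
        show "0 \<le> ln (ln x + 1)" using x by simp
      qed
      finally show ?thesis .
    qed
    also have "(\<Sum>q\<in>A. ln (real (b2 q) + 1)) \<le> (ln x / ln y + Phi 1 T) / T"
    proof -
      have "(\<Sum>q\<in>A. real (b2 q) * (real q - 1)) = (\<Sum>q\<in>A. \<Sum>p\<in>Q2. real (v q p) * (real q - 1))"
        by (simp add: b2_def sum_distrib_right)
      also have "\<dots> = (\<Sum>p\<in>Q2. \<Sum>q\<in>A. real (v q p) * (real q - 1))" by (rule sum.swap)
      also have "\<dots> \<le> (\<Sum>p\<in>Q2. real (a p))"
      proof (rule sum_mono)
        fix p
        have "(\<Sum>q\<in>A. real (v q p) * (real q - 1)) \<le> real (a p + 1) - 1"
          unfolding v_def using fA prA by (intro sum_multiplicity_minus_one_le) auto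
        then show "(\<Sum>q\<in>A. real (v q p) * (real q - 1)) \<le> real (a p)" by simp
      qed
      also have "\<dots> \<le> (\<Sum>p\<in>Q2. real (a p) * ln (real p) / ln y)"
      proof (rule sum_mono)
        fix p assume p: "p \<in> Q2"
        then have "ln y \<le> ln (real p)" using y by (auto simp: Q2_def)
        then have "real (a p) * ln y \<le> real (a p) * ln (real p)" by (intro mult_left_mono) auto
        then show "real (a p) \<le> real (a p) * ln (real p) / ln y" using y by (simp add: field_simps)
      qed
      also have "\<dots> = (\<Sum>p\<in>Q2. real (a p) * ln (real p)) / ln y" by (simp add: sum_divide_distrib)
      also have "\<dots> \<le> ln x / ln y"
      proof (rule divide_right_mono)
        have "(\<Sum>p\<in>Q2. real (a p) * ln (real p)) \<le> (\<Sum>p\<in>Q. real (a p) * ln (real p))"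
        proof (rule sum_mono2[OF fQ])
          show "Q2 \<subseteq> Q" by (auto simp: Q2_def)
          fix p assume "p \<in> Q - Q2"
          then have "ln (real p) \<ge> 1" using lnp by blast
          then show "0 \<le> real (a p) * ln (real p)" by simp
        qed
        then show "(\<Sum>p\<in>Q2. real (a p) * ln (real p)) \<le> ln x" using lnx by linarith
      qed (use y in simp)
      finally have "((\<Sum>q\<in>A. real (b2 q) * (real q - 1)) + Phi 1 T) / T \<le> (ln x / ln y + Phi 1 T) / T"
        using T by (intro divide_right_mono add_right_mono) auto
      then show ?thesis using weak_duality[OF fA AP T, of b2] by linarith
    qed
    finally show ?thesis by simp
  qed
qed

section \<open>The lower bound\<close>

text \<open>
  The greedy solution: the unit \<open>(q, l)\<close>, which raises the multiplicity of \<open>q\<close> from \<open>l\<close> to \<open>l + 1\<close>, is bought iff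
  its price \<open>q\<close> is at most \<open>T\<close> times its gain. It attains equality in weak duality.
\<close>

definition mult_count :: "real \<Rightarrow> nat \<Rightarrow> nat" where
  "mult_count T q = card {l. real q \<le> T * lstep l}"

text \<open>As the steps decrease, these are the primes of which at least the first unit is
  bought.\<close>

definition base_primes :: "real \<Rightarrow> nat set" where
  "base_primes T = split_primes_le (T * lstep 0)"

text \<open>Charging \<open>q\<close> rather than \<open>q - 1\<close> per unit only overestimates
  the exponents of the constructed \<open>n\<close>.\<close>

definition cost :: "real \<Rightarrow> real" where
  "cost T = (\<Sum>q\<in>base_primes T. real (mult_count T q) * real q)"

lemma downward_closed_eq_lessThan_card:
  fixes A :: "nat set"
  assumes "finite A" "\<And>k l. k \<le> l \<Longrightarrow> l \<in> A \<Longrightarrow> k \<in> A"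
  shows "A = {..<card A}"
proof -
  define n where "n = (LEAST n. n \<notin> A)"
  obtain m where m: "m \<notin> A" using assms(1) ex_new_if_finite infinite_UNIV_nat by blast
  then have n: "n \<notin> A" unfolding n_def by (rule LeastI)
  have "A = {..<n}"
  proof (intro equalityI subsetI)
    fix k assume "k \<in> A"
    then show "k \<in> {..<n}" using assms(2)[of n k] n by (metis lessThan_iff not_less)
  next
    fix k assume "k \<in> {..<n}"
    then show "k \<in> A" unfolding n_def using not_less_Least by blast
  qed
  then show ?thesis by simp
qed

lemma index_set_eq:
  assumes "T \<ge> 0" "q \<ge> 1"
  shows "{l. real q \<le> T * lstep l} = {..<mult_count T q}"
  unfolding mult_count_def
proof (rule downward_closed_eq_lessThan_card)
  show "finite {l. real q \<le> T * lstep l}"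
  proof (rule finite_subset)
    show "{l. real q \<le> T * lstep l} \<subseteq> {..nat \<lceil>T\<rceil>}"
    proof
      fix l assume "l \<in> {l. real q \<le> T * lstep l}"
      then have "1 \<le> T * lstep l" using assms(2) by auto
      also have "\<dots> \<le> T * (1 / real (Suc l))" using assms(1) lstep_le by (intro mult_left_mono) auto
      finally have "real (Suc l) \<le> T" by (simp add: field_simps)
      then show "l \<in> {..nat \<lceil>T\<rceil>}" by simp linarith
    qed
  qed simp
  fix k l assume "k \<le> l" "l \<in> {l. real q \<le> T * lstep l}"
  then show "k \<in> {l. real q \<le> T * lstep l}"
    using mult_left_mono[OF lstep_antimono[of k l] assms(1)] by auto
qed

text \<open>Double counting of the bought units \<open>(q, l)\<close>, by prime and by level. Levels
  from \<open>T\<close> on are empty, so any \<open>M \<ge> T\<close> serves as cutoff.\<close>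

lemma items_swap:
  fixes h :: "nat \<Rightarrow> nat \<Rightarrow> real"
  assumes T: "T \<ge> 0" and M: "T \<le> real M"
  shows "(\<Sum>q\<in>base_primes T. \<Sum>l<mult_count T q. h q l) = (\<Sum>l<M. \<Sum>q\<in>split_primes_le (T * lstep l). h q l)"
proof -
  have "(\<Sum>q\<in>base_primes T. \<Sum>l<mult_count T q. h q l) = (\<Sum>q\<in>base_primes T. \<Sum>l<M. if real q \<le> T * lstep l then h q l else 0)"
  proof (rule sum.cong[OF refl])
    fix q assume "q \<in> base_primes T"
    then have q: "q \<ge> 5" using primes_1mod4_ge_5 by (auto simp: base_primes_def split_primes_le_def)
    have sub: "{..<mult_count T q} \<subseteq> {..<M}"
    proof (rule subsetI)
      fix l assume "l \<in> {..<mult_count T q}"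
      moreover have "q \<ge> 1" using q by simp
      ultimately have "l \<in> {l. real q \<le> T * lstep l}" by (simp only: index_set_eq[OF T])
      then have "real q \<le> T * lstep l" by simp
      then have "5 \<le> T * lstep l" using q by simp
      also have "\<dots> \<le> T * (1 / real (Suc l))" using T lstep_le by (intro mult_left_mono) auto
      finally have "real (Suc l) \<le> T" by (simp add: field_simps)
      then show "l \<in> {..<M}" using M by simp
    qed
    have "(\<Sum>l<M. if real q \<le> T * lstep l then h q l else 0) = (\<Sum>l\<in>{..<M} \<inter> {l. real q \<le> T * lstep l}. h q l)"
      by (subst sum.inter_restrict) auto
    also have "{..<M} \<inter> {l. real q \<le> T * lstep l} = {..<mult_count T q}"
    proof -
      have "q \<ge> 1" using q by simp
      from index_set_eq[OF T this] show ?thesis using Int_absorb1[OF sub] by (simp only:)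
    qed
    finally show "(\<Sum>l<mult_count T q. h q l) = (\<Sum>l<M. if real q \<le> T * lstep l then h q l else 0)" by simp
  qed
  also have "\<dots> = (\<Sum>l<M. \<Sum>q\<in>base_primes T. if real q \<le> T * lstep l then h q l else 0)" by (rule sum.swap)
  also have "\<dots> = (\<Sum>l<M. \<Sum>q\<in>split_primes_le (T * lstep l). h q l)"
  proof (rule sum.cong[OF refl])
    fix l
    have sub: "split_primes_le (T * lstep l) \<subseteq> base_primes T" unfolding base_primes_def
      using T lstep_antimono[of 0 l] by (intro split_primes_le_mono mult_left_mono) auto
    have "(\<Sum>q\<in>base_primes T. if real q \<le> T * lstep l then h q l else 0) = (\<Sum>q\<in>base_primes T \<inter> {q. real q \<le> T * lstep l}. h q l)"
      by (subst sum.inter_restrict) (auto simp: base_primes_def)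
    also have "base_primes T \<inter> {q. real q \<le> T * lstep l} = split_primes_le (T * lstep l)"
      using sub by (auto simp: base_primes_def split_primes_le_def)
    finally show "(\<Sum>q\<in>base_primes T. if real q \<le> T * lstep l then h q l else 0) = (\<Sum>q\<in>split_primes_le (T * lstep l). h q l)" .
  qed
  finally show ?thesis .
qed

text \<open>The units of level \<open>l\<close> that are bought are exactly those with nonnegative
  surplus \<open>T * lstep l - q\<close>, and these surpluses add up to
  \<open>pi1 (T * lstep l)\<close>.\<close>

lemma gain_eq:
  assumes "T \<ge> 0"
  shows "T * (\<Sum>q\<in>base_primes T. ln (real (mult_count T q) + 1)) = Phi 0 T + cost T"
proof -
  define M where "M = nat \<lceil>T\<rceil>"
  have M: "T \<le> real M" unfolding M_def by linarith
  have "T * (\<Sum>q\<in>base_primes T. ln (real (mult_count T q) + 1)) - cost T = (\<Sum>q\<in>base_primes T. \<Sum>l<mult_count T q. T * lstep l - real q)"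
    by (simp add: cost_def sum_subtractf sum_distrib_left[symmetric] sum_lstep)
  also have "\<dots> = (\<Sum>l<M. pi1 (T * lstep l))" unfolding items_swap[OF assms M] pi1_def ..
  also have "\<dots> = Phi 0 T"
  proof -
    have "pi1 (T * lstep l + 0) = 0" if "l \<notin> {..<M}" for l
    proof (rule pi1_lstep_finite[OF assms])
      show "nat \<lceil>T\<rceil> \<le> l" using that by (simp only: M_def lessThan_iff not_less)
    qed simp
    then show ?thesis unfolding Phi_def by (subst suminf_finite[of "{..<M}"]) auto
  qed
  finally show ?thesis by simp
qed

section \<open>Size and increments of the greedy cost\<close>

definition prime_sum :: "real \<Rightarrow> real" where
  "prime_sum y = (\<Sum>q\<in>split_primes_le y. real q)"

lemma cost_eq:
  assumes "T \<ge> 0" "T \<le> real M"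
  shows "cost T = (\<Sum>l<M. prime_sum (T * lstep l))"
  using items_swap[OF assms, of "\<lambda>q l. real q"] by (simp add: cost_def prime_sum_def)

lemma prime_sum_nonneg: "prime_sum y \<ge> 0"
  unfolding prime_sum_def by (intro sum_nonneg) auto

lemma prime_sum_le: "y \<ge> 0 \<Longrightarrow> prime_sum y \<le> y\<^sup>2"
proof -
  assume y: "y \<ge> 0"
  have "prime_sum y \<le> (\<Sum>q\<in>split_primes_le y. y)" unfolding prime_sum_def by (intro sum_mono) (auto simp: split_primes_le_def)
  also have "\<dots> = real (card (split_primes_le y)) * y" by simp
  also have "\<dots> \<le> y * y" using card_split_primes_le[OF y] y by (intro mult_right_mono) auto
  finally show ?thesis by (simp add: power2_eq_square)
qed

text \<open>A half-open interval of length at most 1 contains at most one integer, of size at most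
  \<open>y'\<close>. The weaker exponent 3/2 is taken since the bound is later summed over
  \<open>y' = (T + 1) * lstep l\<close>.\<close>

lemma prime_sum_step:
  assumes "0 \<le> y" "y \<le> y'" "y' \<le> y + 1"
  shows "prime_sum y' \<le> prime_sum y + y' powr (3/2)"
proof (cases "y' < 5")
  case True
  then show ?thesis using prime_sum_nonneg[of y] by (simp add: prime_sum_def[of y'] split_primes_le_empty)
next
  case False
  have sub: "split_primes_le y' - split_primes_le y \<subseteq> {nat \<lfloor>y'\<rfloor>}"
  proof
    fix q assume "q \<in> split_primes_le y' - split_primes_le y"
    then have "real q \<le> y'" "y < real q" by (auto simp: split_primes_le_def)
    then have "q = nat \<lfloor>y'\<rfloor>" using assms by linarith
    then show "q \<in> {nat \<lfloor>y'\<rfloor>}" by simp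
  qed
  have "prime_sum y' = prime_sum y + (\<Sum>q\<in>split_primes_le y' - split_primes_le y. real q)"
    unfolding prime_sum_def using sum.subset_diff[OF split_primes_le_mono[OF assms(2)] finite_split_primes_le, of real] by simp
  also have "(\<Sum>q\<in>split_primes_le y' - split_primes_le y. real q) \<le> (\<Sum>q\<in>{nat \<lfloor>y'\<rfloor>}. real q)"
    using sub by (intro sum_mono2) auto
  also have "(\<Sum>q\<in>{nat \<lfloor>y'\<rfloor>}. real q) \<le> y' powr (3/2)"
  proof -
    have "(\<Sum>q\<in>{nat \<lfloor>y'\<rfloor>}. real q) \<le> y'" using assms by simp
    moreover have "y' powr 1 \<le> y' powr (3/2)" using False by (intro powr_mono) auto
    moreover have "y' powr 1 = y'" using False by simp
    ultimately show ?thesis by linarith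
  qed
  finally show ?thesis by simp
qed

text \<open>With \<open>k\<close> primes available, at most \<open>k / 2\<close> of them are up to
  \<open>k / 2\<close>; the remaining ones number at least \<open>k / 2\<close> and each exceeds
  \<open>k / 2\<close>.\<close>

lemma prime_sum_ge: "y \<ge> 0 \<Longrightarrow> prime_sum y \<ge> (real (card (split_primes_le y)))\<^sup>2 / 4"
proof -
  assume y: "y \<ge> 0"
  define k where "k = real (card (split_primes_le y))"
  define w where "w = k / 2"
  have w: "0 \<le> w" by (simp add: w_def k_def)
  have wy: "w \<le> y" using card_split_primes_le[OF y] by (simp add: w_def k_def)
  have sub: "split_primes_le w \<subseteq> split_primes_le y" by (rule split_primes_le_mono[OF wy])
  have "w * w \<le> w * real (card (split_primes_le y - split_primes_le w))"
  proof (rule mult_left_mono[OF _ w])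
    have "card (split_primes_le y - split_primes_le w) = card (split_primes_le y) - card (split_primes_le w)"
      using sub by (intro card_Diff_subset) auto
    moreover have "card (split_primes_le w) \<le> card (split_primes_le y)" using sub by (intro card_mono) auto
    ultimately have "real (card (split_primes_le y - split_primes_le w)) = k - real (card (split_primes_le w))" by (simp add: k_def)
    then show "w \<le> real (card (split_primes_le y - split_primes_le w))" using card_split_primes_le[OF w] by (simp add: w_def)
  qed
  also have "\<dots> = (\<Sum>q\<in>split_primes_le y - split_primes_le w. w)" by (simp add: mult.commute)
  also have "\<dots> \<le> (\<Sum>q\<in>split_primes_le y - split_primes_le w. real q)"
    by (intro sum_mono) (auto simp: split_primes_le_def)
  also have "\<dots> \<le> prime_sum y" unfolding prime_sum_def by (intro sum_mono2) auto
  finally show ?thesis by (simp add: w_def k_def power2_eq_square)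
qed

lemma cost_le:
  assumes "T \<ge> 0" shows "cost T \<le> S2 * T\<^sup>2"
proof -
  obtain M where M: "T \<le> real M" using real_arch_simple by blast
  have "cost T \<le> (\<Sum>l<M. T\<^sup>2 * (lstep l)\<^sup>2)" unfolding cost_eq[OF assms M]
  proof (rule sum_mono)
    fix l show "prime_sum (T * lstep l) \<le> T\<^sup>2 * (lstep l)\<^sup>2"
      using prime_sum_le[of "T * lstep l"] assms lstep_pos[of l] by (simp add: power_mult_distrib)
  qed
  also have "\<dots> = T\<^sup>2 * (\<Sum>l<M. (lstep l)\<^sup>2)" by (simp add: sum_distrib_left)
  also have "\<dots> \<le> T\<^sup>2 * S2" unfolding S2_def by (intro mult_left_mono sum_le_suminf summable_lstep_2) auto
  finally show ?thesis by (simp add: mult.commute)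
qed

text \<open>Raising the threshold by 1 costs only about \<open>T powr (3/2)\<close>, small against
  \<open>T^2\<close>. So an integer threshold can leave only a negligible part of the budget
  unspent.\<close>

lemma cost_step:
  assumes "T \<ge> 0" shows "cost (T + 1) \<le> cost T + S3 * (T + 1) powr (3/2)"
proof -
  obtain M where M: "T + 1 \<le> real M" using real_arch_simple by blast
  have M': "T \<le> real M" "T + 1 \<ge> 0" using M assms by auto
  have "cost (T + 1) \<le> (\<Sum>l<M. prime_sum (T * lstep l) + (T + 1) powr (3/2) * lstep l powr (3/2))"
    unfolding cost_eq[OF M'(2) M]
  proof (rule sum_mono)
    fix l
    have "prime_sum ((T + 1) * lstep l) \<le> prime_sum (T * lstep l) + ((T + 1) * lstep l) powr (3/2)"
      using assms lstep_pos[of l] lstep_le_1[of l] by (intro prime_sum_step) (auto simp: algebra_simps)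
    also have "((T + 1) * lstep l) powr (3/2) = (T + 1) powr (3/2) * lstep l powr (3/2)"
      using assms lstep_pos[of l] by (subst powr_mult) auto
    finally show "prime_sum ((T + 1) * lstep l) \<le> prime_sum (T * lstep l) + (T + 1) powr (3/2) * lstep l powr (3/2)" .
  qed
  also have "\<dots> = cost T + (T + 1) powr (3/2) * (\<Sum>l<M. lstep l powr (3/2))"
    unfolding cost_eq[OF assms M'(1)] by (simp add: sum.distrib sum_distrib_left)
  also have "(T + 1) powr (3/2) * (\<Sum>l<M. lstep l powr (3/2)) \<le> (T + 1) powr (3/2) * S3"
    unfolding S3_def by (intro mult_left_mono sum_le_suminf summable_lstep_3) auto
  finally show ?thesis by (simp only: mult.commute add_le_cancel_left)
qed

text \<open>Level 0 alone, the primes up to \<open>T * ln 2\<close>, suffices. The cube of the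
  logarithm leaves slack, as the bound only serves for a crude comparison of \<open>T\<close> with
  the budget.\<close>

lemma cost_lower:
  "eventually (\<lambda>T. cost T \<ge> T\<^sup>2 / (ln T) ^ 3) at_top"
proof -
  have l0: "lstep 0 = ln 2" by (simp add: lstep_def)
  have "filterlim (\<lambda>T::real. T * ln 2) at_top at_top" by real_asymp
  from eventually_compose_filterlim[OF card_split_primes_lower this]
  have e1: "eventually (\<lambda>T. real (card (split_primes_le (T * ln 2))) \<ge> T * ln 2 / (8 * ln (T * ln 2))) at_top" .
  have e2: "eventually (\<lambda>T::real. T\<^sup>2 / (ln T) ^ 3 \<le> (T * ln 2 / (8 * ln (T * ln 2)))\<^sup>2 / 4) at_top" by real_asymp
  have e3: "eventually (\<lambda>T::real. 0 \<le> T * ln 2 / (8 * ln (T * ln 2))) at_top" by real_asymp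
  show ?thesis using e1 e2 e3 eventually_ge_at_top[of 1]
  proof eventually_elim
    case (elim T)
    define M where "M = Suc (nat \<lceil>T\<rceil>)"
    have M: "T \<le> real M" unfolding M_def by simp linarith
    have "T\<^sup>2 / (ln T) ^ 3 \<le> (real (card (split_primes_le (T * ln 2))))\<^sup>2 / 4"
      by (rule order.trans[OF elim(2)]) (use elim in \<open>intro divide_right_mono power_mono, auto\<close>)
    also have "\<dots> \<le> prime_sum (T * lstep 0)" unfolding l0 using elim by (intro prime_sum_ge) auto
    also have "\<dots> \<le> (\<Sum>l<M. prime_sum (T * lstep l))"
      by (rule member_le_sum) (auto simp: M_def prime_sum_nonneg)
    also have "\<dots> = cost T" using elim M by (intro cost_eq[symmetric]) auto
    finally show ?case by simp
  qed
qed

lemma harmonic_sum_le: "M \<ge> 1 \<Longrightarrow> (\<Sum>l<M. 1 / real (Suc l)) \<le> 1 + ln (real M)"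
proof (induction M rule: nat_induct_at_least)
  case (Suc M)
  have "ln (real M / real (Suc M)) \<le> real M / real (Suc M) - 1"
    using Suc.hyps by (intro ln_le_minus_one) auto
  also have "\<dots> = - 1 / real (Suc M)" by (simp add: field_simps)
  finally have "1 / real (Suc M) \<le> ln (real (Suc M)) - ln (real M)"
    using Suc.hyps by (simp add: ln_div)
  then show ?case using Suc.IH by simp
qed simp

text \<open>Counts the bought units, hence the distinct prime bases required for \<open>n\<close>.
  Level \<open>l\<close> has at most \<open>T / (l + 1)\<close> units, and the harmonic sum gives
  the logarithm.\<close>

lemma sum_mult_count_le:
  assumes "T \<ge> 1"
  shows "(\<Sum>q\<in>base_primes (real T). real (mult_count (real T) q)) \<le> real T * (1 + ln (real T))"
proof -
  have "(\<Sum>q\<in>base_primes (real T). real (mult_count (real T) q)) = (\<Sum>l<T. real (card (split_primes_le (real T * lstep l))))"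
    using items_swap[of "real T" T "\<lambda>q l. 1"] by simp
  also have "\<dots> \<le> (\<Sum>l<T. real T * (1 / real (Suc l)))"
  proof (rule sum_mono)
    fix l
    have "real (card (split_primes_le (real T * lstep l))) \<le> real T * lstep l"
      using lstep_pos[of l] by (intro card_split_primes_le) auto
    also have "\<dots> \<le> real T * (1 / real (Suc l))" using lstep_le by (intro mult_left_mono) auto
    finally show "real (card (split_primes_le (real T * lstep l))) \<le> real T * (1 / real (Suc l))" .
  qed
  also have "\<dots> = real T * (\<Sum>l<T. 1 / real (Suc l))" by (simp only: sum_distrib_left)
  also have "\<dots> \<le> real T * (1 + ln (real T))" using harmonic_sum_le[OF assms] by (intro mult_left_mono) auto
  finally show ?thesis .
qed

section \<open>Realising prescribed multiplicities by an integer n\<close>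

lemma split_part_prod_prime_powers:
  assumes "finite I" "inj_on f I" "\<And>i. i \<in> I \<Longrightarrow> f i \<in> primes_1mod4" "\<And>i. i \<in> I \<Longrightarrow> e i > 0"
  shows "(\<Prod>i\<in>I. f i ^ e i) > 0 \<and> prime_factors (\<Prod>i\<in>I. f i ^ e i) = f ` I \<and>
     split_part (\<Prod>i\<in>I. f i ^ e i) = (\<Prod>i\<in>I. e i + 1)"
  using assms
proof (induction I rule: finite_induct)
  case empty
  show ?case by (simp add: split_part_def)
next
  case (insert i I)
  define m where "m = (\<Prod>i\<in>I. f i ^ e i)"
  have IH: "m > 0" "prime_factors m = f ` I" "split_part m = (\<Prod>i\<in>I. e i + 1)"
    using insert.IH insert.prems unfolding m_def by auto
  have p: "prime (f i)" "f i mod 4 = 1" using insert.prems by (auto simp: primes_1mod4_def)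
  have "f i \<notin> f ` I" using insert.prems(1) insert.hyps(2) by (auto simp: inj_on_def)
  then have nd: "\<not> f i dvd m" using IH(1,2) p(1) by (auto simp: in_prime_factors_iff)
  have e0: "e i > 0" using insert.prems by auto
  have eq: "(\<Prod>i\<in>insert i I. f i ^ e i) = f i ^ e i * m" using insert.hyps by (simp add: m_def)
  have sp: "split_part (f i ^ e i * m) = (e i + 1) * split_part m"
    using split_part_mult_prime_power[OF p(1) nd e0 IH(1)] p(2) by simp
  have pf: "prime_factors (f i ^ e i * m) = insert (f i) (prime_factors m)"
    using IH(1) p(1) e0 prime_gt_0_nat[OF p(1)] by (simp add: prime_factors_product prime_factors_power prime_prime_factors)
  show ?case unfolding eq sp pf using insert.hyps IH prime_gt_0_nat[OF p(1)] by simp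
qed

text \<open>Each unit \<open>(q, l)\<close> receives its own prime \<open>f (q, l) \<le> z\<close>
  with exponent \<open>q - 1\<close>, so that it contributes the factor \<open>q\<close> to
  \<open>delta n\<close>. Injectivity of \<open>f\<close> keeps the exponents from merging.\<close>

lemma delta_delta_construct:
  assumes B: "finite B" "B \<subseteq> primes_1mod4" "\<And>q. q \<in> B \<Longrightarrow> b q > 0"
    and z: "z > 1" "(\<Sum>q\<in>B. b q) \<le> card (split_primes_le z)"
    and x: "x > 1" "ln z * (\<Sum>q\<in>B. real (b q) * real q) \<le> ln x"
  shows "\<exists>n\<ge>1. real n \<le> x \<and> delta_delta n > 0 \<and> ln (real_of_rat (delta_delta n)) = (\<Sum>q\<in>B. ln (real (b q) + 1))"
proof -
  define I where "I = Sigma B (\<lambda>q. {..<b q})"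
  have fI: "finite I" using B(1) by (auto simp: I_def)
  have cI: "card I = (\<Sum>q\<in>B. b q)" using B(1) by (simp add: I_def)
  obtain f where f: "f ` I \<subseteq> split_primes_le z" "inj_on f I"
    using card_le_inj[OF fI finite_split_primes_le[of z]] z(2) cI by auto
  define e where "e = (\<lambda>i::nat \<times> nat. fst i - 1)"
  have q5: "fst i \<ge> 5" if "i \<in> I" for i using that B(2) primes_1mod4_ge_5 by (auto simp: I_def)
  define n where "n = (\<Prod>i\<in>I. f i ^ e i)"
  have fP: "f i \<in> primes_1mod4" "real (f i) \<le> z" if "i \<in> I" for i using f(1) that by (auto simp: split_primes_le_def)
  have N: "n > 0" "prime_factors n = f ` I" "split_part n = (\<Prod>i\<in>I. e i + 1)"
    using split_part_prod_prime_powers[OF fI f(2), of e] fP q5 unfolding n_def e_def by fastforce+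
  define m where "m = (\<Prod>q\<in>B. q ^ b q)"
  have "split_part n = (\<Prod>i\<in>I. fst i)" unfolding N(3)
    by (intro prod.cong) (use q5 in \<open>fastforce simp: e_def\<close>)+
  also have "\<dots> = (\<Prod>q\<in>B. \<Prod>l<b q. q)" unfolding I_def using B(1) by (subst prod.Sigma) (auto intro!: prod.cong)
  also have "\<dots> = m" by (simp add: m_def)
  finally have sm: "split_part n = m" .
  have "delta n = of_nat (split_part n)" by (rule delta_eq_split_part_1mod4) (use N(1,2) fP in auto)
  then have dn: "delta n = of_nat m" by (simp only: sm)
  have M: "m > 0" "prime_factors m = B" "split_part m = (\<Prod>q\<in>B. b q + 1)"
  proof -
    have "m > 0 \<and> prime_factors m = (\<lambda>q. q) ` B \<and> split_part m = (\<Prod>q\<in>B. b q + 1)"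
      unfolding m_def by (rule split_part_prod_prime_powers[OF B(1)]) (use B in auto)
    then show "m > 0" "prime_factors m = B" "split_part m = (\<Prod>q\<in>B. b q + 1)" by (simp_all only: image_ident simp_thms)
  qed
  have dm: "delta m = of_nat (split_part m)" using M B by (intro delta_eq_split_part_1mod4) auto
  have dd: "delta_delta n = of_nat (split_part m)" by (simp add: delta_delta_def dn dm)
  have sp0: "split_part m > 0" unfolding M(3) by (intro prod_pos) auto
  have "real_of_rat (delta_delta n) = real (split_part m)" by (simp only: dd of_rat_of_nat_eq)
  also have "\<dots> = (\<Prod>q\<in>B. real (b q) + 1)" unfolding M(3) by (simp add: add.commute)
  finally have "ln (real_of_rat (delta_delta n)) = ln (\<Prod>q\<in>B. real (b q) + 1)" by (simp only:)
  also have "\<dots> = (\<Sum>q\<in>B. ln (real (b q) + 1))" using B(1) by (subst ln_prod) (auto intro!: add_nonneg_pos)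
  finally have val: "ln (real_of_rat (delta_delta n)) = (\<Sum>q\<in>B. ln (real (b q) + 1))" .
  have f0: "f i > 0" if "i \<in> I" for i using primes_1mod4_ge_5[OF fP(1)[OF that]] by simp
  have "ln (real n) = ln (\<Prod>i\<in>I. real (f i) ^ e i)" by (simp add: n_def)
  also have "\<dots> = (\<Sum>i\<in>I. ln (real (f i) ^ e i))" using fI f0 by (subst ln_prod) auto
  also have "\<dots> = (\<Sum>i\<in>I. real (e i) * ln (real (f i)))" using f0 by (intro sum.cong) (auto simp: ln_realpow)
  also have "\<dots> \<le> (\<Sum>i\<in>I. real (fst i) * ln z)"
  proof (rule sum_mono)
    fix i assume i: "i \<in> I"
    have "ln (real (f i)) \<le> ln z" using fP(2)[OF i] f0[OF i] z(1) by (subst ln_le_cancel_iff) auto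
    then show "real (e i) * ln (real (f i)) \<le> real (fst i) * ln z"
      using f0[OF i] by (intro mult_mono) (auto simp: e_def)
  qed
  also have "\<dots> = (\<Sum>q\<in>B. \<Sum>l<b q. real q * ln z)" unfolding I_def using B(1) by (subst sum.Sigma) (auto intro!: sum.cong)
  also have "\<dots> = ln z * (\<Sum>q\<in>B. real (b q) * real q)" by (simp add: sum_distrib_left mult_ac)
  also have "\<dots> \<le> ln x" by (rule x(2))
  finally have "real n \<le> x" using N(1) x(1) by (subst (asm) ln_le_cancel_iff) auto
  then show ?thesis using val N(1) dd sp0 by (intro exI[of _ n]) auto
qed

text \<open>The greedy solution at the largest affordable integer threshold; it exists because the
  cost eventually exceeds \<open>T\<close>. The last clause is guarded by \<open>T1\<close>, since
  the lower bound for the cost is only asymptotic.\<close>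

lemma threshold_index:
  "\<exists>T1. \<forall>Y\<ge>0. \<exists>T::nat. cost (real T) \<le> Y \<and> Y < cost (real T + 1) \<and> (real T \<ge> T1 \<longrightarrow> (real T)\<^sup>2 \<le> Y * (ln (real T)) ^ 3 \<and> real T \<le> Y)"
proof -
  have e: "eventually (\<lambda>T::real. T \<le> T\<^sup>2 / (ln T) ^ 3) at_top" by real_asymp
  from eventually_conj[OF eventually_conj[OF cost_lower e] eventually_gt_at_top[of 1]]
  obtain T1 where T1: "\<And>T. T \<ge> T1 \<Longrightarrow> T\<^sup>2 / (ln T) ^ 3 \<le> cost T \<and> T \<le> T\<^sup>2 / (ln T) ^ 3 \<and> T > 1"
    unfolding eventually_at_top_linorder by blast
  show ?thesis
  proof (intro exI[of _ T1] allI impI)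
    fix Y :: real assume Y: "Y \<ge> 0"
    define A where "A = {T::nat. cost (real T) \<le> Y}"
    have "split_primes_le 0 = {}" by (rule split_primes_le_empty) simp
    then have "cost 0 = 0" by (simp add: cost_def base_primes_def)
    then have A0: "0 \<in> A" using Y by (simp add: A_def)
    have fA: "finite A"
    proof (rule finite_subset)
      show "A \<subseteq> {..nat \<lceil>max T1 Y\<rceil>}"
      proof (rule subsetI)
        fix T assume "T \<in> A"
        then have c: "cost (real T) \<le> Y" by (simp add: A_def)
        have "real T \<le> max T1 Y"
        proof (cases "real T \<ge> T1")
          case True
          then show ?thesis using T1[OF True] c by auto
        qed auto
        then show "T \<in> {..nat \<lceil>max T1 Y\<rceil>}" by simp linarith
      qed
    qed simp
    define T where "T = Max A"
    have TA: "T \<in> A" unfolding T_def using fA A0 by (intro Max_in) auto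
    have "Suc T \<notin> A"
    proof
      assume "Suc T \<in> A"
      then have "Suc T \<le> T" unfolding T_def using fA by (intro Max_ge)
      then show False by simp
    qed
    then have c2: "Y < cost (real T + 1)" by (simp add: A_def add.commute)
    have c1: "cost (real T) \<le> Y" using TA by (simp add: A_def)
    have "(real T)\<^sup>2 \<le> Y * (ln (real T)) ^ 3 \<and> real T \<le> Y" if "real T \<ge> T1"
    proof -
      note t = T1[OF that]
      have l: "ln (real T) > 0" using t by simp
      have "(real T)\<^sup>2 / (ln (real T)) ^ 3 \<le> Y" "real T \<le> Y" using t c1 by linarith+
      then show ?thesis using l by (simp add: pos_divide_le_eq)
    qed
    then show "\<exists>T::nat. cost (real T) \<le> Y \<and> Y < cost (real T + 1) \<and> (real T \<ge> T1 \<longrightarrow> (real T)\<^sup>2 \<le> Y * (ln (real T)) ^ 3 \<and> real T \<le> Y)"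
      using c1 c2 by blast
  qed
qed

text \<open>The primes up to \<open>zbound X\<close> are numerous enough to serve as the bases of all prime powers in \<open>n\<close>.\<close>

definition zbound :: "real \<Rightarrow> real" where "zbound X = sqrt X * (ln X) ^ 5"

lemma lower_bound_aux:
  "\<exists>K. eventually (\<lambda>X. \<forall>x>1. ln x = X \<longrightarrow> (\<exists>n\<ge>1. real n \<le> x \<and> delta_delta n > 0 \<and>
     ln (real_of_rat (delta_delta n)) \<ge> (1 - K / ln X) * (sqrt S2 * sqrt X / ln (zbound X)))) at_top"
proof -
  obtain C where C: "C > 0" "eventually (\<lambda>T. \<forall>d. 0 \<le> d \<longrightarrow> d \<le> 1 \<longrightarrow> \<bar>Phi d T - T\<^sup>2 * S2 / (4 * ln T)\<bar> \<le> C * (T\<^sup>2 / (ln T)\<^sup>2)) at_top"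
    using Phi_asymp by blast
  have es: "eventually (\<lambda>T::real. S3 * (T + 1) powr (3/2) \<le> T\<^sup>2 / (ln T)\<^sup>2) at_top" by real_asymp
  from eventually_conj[OF eventually_conj[OF C(2) es] eventually_gt_at_top[of 1]]
  obtain T2 where T2: "\<And>T. T \<ge> T2 \<Longrightarrow> (\<forall>d. 0 \<le> d \<longrightarrow> d \<le> 1 \<longrightarrow> \<bar>Phi d T - T\<^sup>2 * S2 / (4 * ln T)\<bar> \<le> C * (T\<^sup>2 / (ln T)\<^sup>2))
      \<and> S3 * (T + 1) powr (3/2) \<le> T\<^sup>2 / (ln T)\<^sup>2 \<and> T > 1"
    unfolding eventually_at_top_linorder by blast
  obtain T1 where T1: "\<And>Y. Y \<ge> 0 \<Longrightarrow> \<exists>T::nat. cost (real T) \<le> Y \<and> Y < cost (real T + 1) \<and> (real T \<ge> T1 \<longrightarrow> (real T)\<^sup>2 \<le> Y * (ln (real T)) ^ 3 \<and> real T \<le> Y)"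
    using threshold_index by blast
  \<comment> \<open>In \<open>C + 1\<close>, \<open>C\<close> is the error of \<open>Phi\<close> and
    1 the unspent budget. The 16 is a 4 from the main term \<open>t^2 * S2 / (4 * ln t)\<close>
    times a 4 from \<open>ln t \<ge> ln X / 4\<close>.\<close>
  define K where "K = 16 * (C + 1) / S2"
  have K0: "K > 0" using C(1) S2_pos by (simp add: K_def)
  have zlim: "filterlim zbound at_top at_top" unfolding zbound_def[abs_def] by real_asymp
  have e1: "eventually (\<lambda>X. zbound X / (8 * ln (zbound X)) \<le> real (card (split_primes_le (zbound X)))) at_top"
    by (rule eventually_compose_filterlim[OF card_split_primes_lower zlim])
  \<comment> \<open>Below, \<open>t \<le> sqrt X * (ln X) ^ 2\<close>, so the left side bounds the
    number of units. The fifth power in \<open>zbound\<close> covers the three logarithms here and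
    the one in the denominator.\<close>
  have e2: "eventually (\<lambda>X. (sqrt X * (ln X) ^ 2) * (1 + ln X) \<le> zbound X / (8 * ln (zbound X))) at_top"
    unfolding zbound_def by real_asymp
  have e3: "eventually (\<lambda>X. S2 * (X powr (1/4) + 1)\<^sup>2 \<le> X / ln (zbound X)) at_top"
    unfolding zbound_def using S2_pos by real_asymp
  have e4: "eventually (\<lambda>X::real. X powr (1/4) \<ge> max (max T1 T2) 1) at_top"
  proof -
    have "filterlim (\<lambda>X::real. X powr (1/4)) at_top at_top" by real_asymp
    then show ?thesis unfolding filterlim_at_top by blast
  qed
  have e5: "eventually (\<lambda>X::real. ln X \<ge> max K 1) at_top"
    using ln_at_top unfolding filterlim_at_top by blast
  have e6: "eventually (\<lambda>X. ln (zbound X) \<ge> 1) at_top" unfolding zbound_def by real_asymp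
  have e7: "eventually (\<lambda>X. zbound X > 1) at_top" unfolding zbound_def by real_asymp
  show ?thesis
  proof (intro exI[of _ K])
    show "eventually (\<lambda>X. \<forall>x>1. ln x = X \<longrightarrow> (\<exists>n\<ge>1. real n \<le> x \<and> delta_delta n > 0 \<and>
     ln (real_of_rat (delta_delta n)) \<ge> (1 - K / ln X) * (sqrt S2 * sqrt X / ln (zbound X)))) at_top"
      using e1 e2 e3 e4 e5 e6 e7 eventually_gt_at_top[of 1]
    proof eventually_elim
      case (elim X)
      show ?case
      proof (intro allI impI)
        fix x :: real assume x: "x > 1" and lx: "ln x = X"
        have X1: "X > 1" and lX: "ln X \<ge> 1" "ln X \<ge> K" using elim by auto
        define lz where "lz = ln (zbound X)"
        have lz1: "lz \<ge> 1" using elim by (simp add: lz_def)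
        define Y where "Y = X / lz"
        have Y0: "Y \<ge> 0" and YX: "Y \<le> X" using lz1 X1 by (auto simp: Y_def field_simps)
        obtain T :: nat where T: "cost (real T) \<le> Y" "Y < cost (real T + 1)"
            "real T \<ge> T1 \<longrightarrow> (real T)\<^sup>2 \<le> Y * (ln (real T)) ^ 3 \<and> real T \<le> Y"
          using T1[OF Y0] by blast
        define t where "t = real T"
        have t0: "t \<ge> 0" by (simp add: t_def)
        have t4: "t \<ge> X powr (1/4)"
        proof -
          have "S2 * (X powr (1/4) + 1)\<^sup>2 \<le> Y" using elim(3) by (simp add: Y_def lz_def)
          also have "\<dots> < S2 * (t + 1)\<^sup>2" using T(2) cost_le[of "t + 1"] t0 by (simp add: t_def)
          finally have "(X powr (1/4) + 1)\<^sup>2 < (t + 1)\<^sup>2" using S2_pos by simp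
          then have "X powr (1/4) + 1 < t + 1" by (rule power2_less_imp_less) (use t0 in simp)
          then show ?thesis by simp
        qed
        have tT: "t \<ge> T1" "t \<ge> T2" "t \<ge> 1" using t4 elim(4) by auto
        have tb: "t\<^sup>2 \<le> Y * (ln t) ^ 3" "t \<le> Y" using T(3) tT(1) by (auto simp: t_def)
        have lt: "ln t > 0" using T2[OF tT(2)] by simp
        have ltX: "ln t \<le> ln X" using tb(2) YX tT(3) X1 by simp
        have tsq: "t \<le> sqrt X * (ln X) ^ 2"
        proof (rule power2_le_imp_le)
          have "t\<^sup>2 \<le> Y * (ln t) ^ 3" by (rule tb)
          also have "\<dots> \<le> X * (ln X) ^ 3" using YX Y0 lt ltX X1 by (intro mult_mono power_mono) auto
          also have "\<dots> \<le> X * (ln X) ^ 4" using X1 lX by (intro mult_left_mono power_increasing) auto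
          also have "\<dots> = (sqrt X * (ln X)\<^sup>2)\<^sup>2" using X1 by (simp add: power_mult_distrib power_mult[symmetric])
          finally show "t\<^sup>2 \<le> (sqrt X * (ln X)\<^sup>2)\<^sup>2" .
        qed (use X1 in simp)
        have ltz: "ln t \<le> lz"
        proof -
          have "t \<le> zbound X"
          proof (rule order.trans[OF tsq])
            show "sqrt X * (ln X)\<^sup>2 \<le> zbound X" unfolding zbound_def
              using X1 lX by (intro mult_left_mono power_increasing) auto
          qed
          then show ?thesis unfolding lz_def using tT(3) by simp
        qed
        have lt4: "ln t \<ge> ln X / 4"
        proof -
          have "ln (X powr (1/4)) \<le> ln t" using t4 X1 tT(3) by (subst ln_le_cancel_iff) auto
          then show ?thesis using X1 by (simp add: ln_powr)
        qed
        define B where "B = base_primes t"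
        define b where "b = mult_count t"
        have B: "finite B" "B \<subseteq> primes_1mod4" by (auto simp: B_def base_primes_def split_primes_le_def intro: finite_subset[OF _ finite_split_primes_le[of "t * lstep 0"]])
        have b0: "b q > 0" if "q \<in> B" for q
        proof -
          have q: "q \<ge> 1" "real q \<le> t * lstep 0"
            using that primes_1mod4_ge_5[of q] by (auto simp: B_def base_primes_def split_primes_le_def)
          then have "0 \<in> {l. real q \<le> t * lstep l}" by simp
          then show ?thesis using index_set_eq[OF t0 q(1)] by (auto simp: b_def)
        qed
        have N: "(\<Sum>q\<in>B. b q) \<le> card (split_primes_le (zbound X))"
        proof -
          have "real (\<Sum>q\<in>B. b q) = (\<Sum>q\<in>base_primes (real T). real (mult_count (real T) q))" by (simp add: B_def b_def t_def)
          also have "\<dots> \<le> t * (1 + ln t)" unfolding t_def using tT(3) by (intro sum_mult_count_le) (simp add: t_def)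
          also have "\<dots> \<le> (sqrt X * (ln X) ^ 2) * (1 + ln X)" using tsq ltX lt t0 X1 by (intro mult_mono) auto
          also have "\<dots> \<le> real (card (split_primes_le (zbound X)))" using elim(1,2) by linarith
          finally show ?thesis by (simp only: of_nat_le_iff)
        qed
        have cst: "ln (zbound X) * (\<Sum>q\<in>B. real (b q) * real q) \<le> ln x"
        proof -
          have "(\<Sum>q\<in>B. real (b q) * real q) \<le> Y" using T(1) by (simp add: cost_def B_def b_def t_def)
          then have "lz * (\<Sum>q\<in>B. real (b q) * real q) \<le> lz * Y" using lz1 by (intro mult_left_mono) auto
          also have "\<dots> = X" using lz1 by (simp add: Y_def)
          finally show ?thesis by (simp add: lz_def lx)
        qed
        obtain n where n: "n \<ge> 1" "real n \<le> x" "delta_delta n > 0" "ln (real_of_rat (delta_delta n)) = (\<Sum>q\<in>B. ln (real (b q) + 1))"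
          using delta_delta_construct[OF B b0 elim(7) N x cst] by blast
        define g where "g = (\<Sum>q\<in>B. ln (real (b q) + 1))"
        have g: "t * g = Phi 0 t + cost t" unfolding g_def B_def b_def by (rule gain_eq[OF t0])
        define \<eta> where "\<eta> = K / ln X"
        have eta: "0 \<le> 1 - \<eta>" "\<eta> \<ge> 0" using lX K0 by (auto simp: \<eta>_def)
        \<comment> \<open>By maximality of the threshold the budget is exhausted up to one step of
          the cost.\<close>
        have costY: "cost t \<ge> Y - t\<^sup>2 / (ln t)\<^sup>2"
          using T(2) cost_step[OF t0] T2[OF tT(2)] by (simp add: t_def)
        have PhiY: "Phi 0 t \<ge> t\<^sup>2 * S2 / (4 * ln t) - C * (t\<^sup>2 / (ln t)\<^sup>2)"
        proof -
          have "\<bar>Phi 0 t - t\<^sup>2 * S2 / (4 * ln t)\<bar> \<le> C * (t\<^sup>2 / (ln t)\<^sup>2)" using T2[OF tT(2)] by simp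
          then show ?thesis by linarith
        qed
        have err: "(C + 1) * (t\<^sup>2 / (ln t)\<^sup>2) \<le> \<eta> * (t\<^sup>2 * S2 / (4 * ln t))"
        proof -
          have "1 / ln t \<le> 1 / (ln X / 4)" using lt4 lX lt by (intro divide_left_mono) auto
          then have i: "1 / ln t \<le> 4 / ln X" by simp
          have "(C + 1) * (t\<^sup>2 / (ln t)\<^sup>2) = (C + 1) * (t\<^sup>2 / ln t) * (1 / ln t)" by (simp add: power2_eq_square)
          also have "\<dots> \<le> (C + 1) * (t\<^sup>2 / ln t) * (4 / ln X)" using i C(1) lt by (intro mult_left_mono) auto
          also have "\<dots> = \<eta> * (t\<^sup>2 * S2 / (4 * ln t))" unfolding \<eta>_def K_def using S2_pos lt lX by (simp add: field_simps)
          finally show ?thesis .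
        qed
        have "t * g \<ge> t\<^sup>2 * S2 / (4 * ln t) - (C + 1) * (t\<^sup>2 / (ln t)\<^sup>2) + Y"
          unfolding g distrib_right mult_1 using costY PhiY by linarith
        then have "t * g \<ge> (1 - \<eta>) * (t\<^sup>2 * S2 / (4 * ln t)) + Y" using err unfolding left_diff_distrib mult_1 by linarith
        moreover have "(1 - \<eta>) * (t\<^sup>2 * S2 / (4 * lz)) \<le> (1 - \<eta>) * (t\<^sup>2 * S2 / (4 * ln t))"
          using eta ltz lt S2_pos by (intro mult_left_mono divide_left_mono) auto
        moreover have "(1 - \<eta>) * Y \<le> Y" using eta Y0 by (simp add: mult_left_le_one_le)
        ultimately have "t * g \<ge> (1 - \<eta>) * (t\<^sup>2 * S2 / (4 * lz)) + (1 - \<eta>) * Y" by linarith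
        also have "(1 - \<eta>) * (t\<^sup>2 * S2 / (4 * lz)) + (1 - \<eta>) * Y = (1 - \<eta>) / lz * (t\<^sup>2 * S2 / 4 + X)"
          using lz1 by (simp add: Y_def field_simps)
        finally have h1: "(1 - \<eta>) / lz * (t\<^sup>2 * S2 / 4 + X) \<le> t * g" .
        \<comment> \<open>AM-GM: the bound holds for whatever \<open>t\<close> the budget dictates,
          so no asymptotic formula for \<open>t\<close> enters.\<close>
        have amgm: "t * (sqrt S2 * sqrt X) \<le> t\<^sup>2 * S2 / 4 + X"
        proof -
          have "0 \<le> (t * sqrt S2 / 2 - sqrt X)\<^sup>2" by simp
          also have "\<dots> = t\<^sup>2 * S2 / 4 + X - t * (sqrt S2 * sqrt X)"
            using S2_pos X1 by (simp add: power2_diff power_mult_distrib power_divide)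
          finally show ?thesis by simp
        qed
        have "(1 - \<eta>) / lz * (t * (sqrt S2 * sqrt X)) \<le> (1 - \<eta>) / lz * (t\<^sup>2 * S2 / 4 + X)"
          using amgm eta lz1 by (intro mult_left_mono) auto
        with h1 have "t * ((1 - \<eta>) * (sqrt S2 * sqrt X / lz)) \<le> t * g" by (simp add: field_simps)
        moreover have "t > 0" using tT(3) by simp
        ultimately have "(1 - \<eta>) * (sqrt S2 * sqrt X / lz) \<le> g" by (simp only: mult_le_cancel_left_pos)
        then show "\<exists>n\<ge>1. real n \<le> x \<and> delta_delta n > 0 \<and>
           ln (real_of_rat (delta_delta n)) \<ge> (1 - K / ln X) * (sqrt S2 * sqrt X / ln (zbound X))"
          using n unfolding \<eta>_def lz_def g_def by auto
      qed
    qed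
  qed
qed

section \<open>The maximal order\<close>

text \<open>Here \<open>X\<close> stands for \<open>ln x\<close>, and \<open>2 * sqrt S2\<close> is
  \<open>c / sqrt 2\<close>.\<close>

definition main_term :: "real \<Rightarrow> real" where
  "main_term X = 2 * sqrt S2 * sqrt X / ln X"

definition error_scale :: "real \<Rightarrow> real" where
  "error_scale X = sqrt X * ln (ln X) / (ln X)\<^sup>2"

lemma upper_bound_eventually:
  "\<exists>K>0. eventually (\<lambda>x. \<forall>n\<ge>1. real n \<le> x \<longrightarrow> delta_delta n > 0 \<longrightarrow>
     ln (real_of_rat (delta_delta n)) \<le> main_term (ln x) + K * error_scale (ln x)) at_top"
proof -
  obtain C where C: "C > 0" "eventually (\<lambda>T. \<forall>d. 0 \<le> d \<longrightarrow> d \<le> 1 \<longrightarrow> \<bar>Phi d T - T\<^sup>2 * S2 / (4 * ln T)\<bar> \<le> C * (T\<^sup>2 / (ln T)\<^sup>2)) at_top"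
    using Phi_asymp by blast
  \<comment> \<open>Small enough that \<open>y X * ln (X + 1)\<close> is
    \<open>O(sqrt X / (ln X)^2)\<close>, yet \<open>ln (y X)\<close> is still
    \<open>(ln X) / 2 - 3 * ln (ln X)\<close>.\<close>
  define y where "y = (\<lambda>X::real. sqrt X / (ln X) ^ 3)"
  \<comment> \<open>The minimiser of \<open>X / (T * ln (y X)) + T * S2 / (4 * ln T)\<close> when
    both logarithms are replaced by \<open>(ln X) / 2\<close>; the two terms are then equal.\<close>
  define T where "T = (\<lambda>X::real. 2 * sqrt X / sqrt S2)"
  define U where "U = (\<lambda>X::real. y X * ln (X + 1) + sqrt X * sqrt S2 / (2 * ln (y X)) + sqrt X * sqrt S2 / (2 * ln (T X)) + C * T X / (ln (T X))\<^sup>2)"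
  have Tlim: "filterlim T at_top at_top" unfolding T_def using S2_pos by real_asymp
  have e1: "eventually (\<lambda>X. Phi 1 (T X) \<le> (T X)\<^sup>2 * S2 / (4 * ln (T X)) + C * ((T X)\<^sup>2 / (ln (T X))\<^sup>2)) at_top"
    using eventually_compose_filterlim[OF C(2) Tlim]
  proof eventually_elim
    case (elim X)
    then have "\<bar>Phi 1 (T X) - (T X)\<^sup>2 * S2 / (4 * ln (T X))\<bar> \<le> C * ((T X)\<^sup>2 / (ln (T X))\<^sup>2)" by simp
    then show ?case by linarith
  qed
  have e2: "eventually (\<lambda>X. y X > 1) at_top" unfolding y_def by real_asymp
  have "(\<lambda>X. U X - main_term X) \<in> O(error_scale)"
    unfolding U_def y_def T_def main_term_def[abs_def] error_scale_def[abs_def] using S2_pos by real_asymp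
  then obtain K where K: "K > 0" "eventually (\<lambda>X. norm (U X - main_term X) \<le> K * norm (error_scale X)) at_top"
    by (elim landau_o.bigE)
  have e3: "eventually (\<lambda>X. error_scale X \<ge> 0) at_top" unfolding error_scale_def by real_asymp
  have "eventually (\<lambda>X. \<forall>x>1. ln x = X \<longrightarrow> (\<forall>n\<ge>1. real n \<le> x \<longrightarrow> delta_delta n > 0 \<longrightarrow>
     ln (real_of_rat (delta_delta n)) \<le> main_term X + K * error_scale X)) at_top"
    using e1 e2 e3 K(2) eventually_gt_at_top[of 0]
  proof eventually_elim
    case (elim X)
    show ?case
    proof (intro allI impI)
      fix x :: real and n :: nat
      assume x: "x > 1" "ln x = X" and n: "n \<ge> 1" "real n \<le> x" "delta_delta n > 0"
      have T0: "T X > 0" using elim S2_pos by (simp add: T_def)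
      have "ln (real_of_rat (delta_delta n)) \<le> y X * ln (ln x + 1) + (ln x / ln (y X) + Phi 1 (T X)) / T X"
        by (rule delta_delta_upper[OF n x(1) elim(2) T0])
      also have "\<dots> \<le> y X * ln (X + 1) + (X / ln (y X) + ((T X)\<^sup>2 * S2 / (4 * ln (T X)) + C * ((T X)\<^sup>2 / (ln (T X))\<^sup>2))) / T X"
        unfolding x(2) using elim(1) T0 by (intro add_left_mono divide_right_mono) auto
      also have "\<dots> = U X"
      proof -
        have a: "X / ln (y X) / T X = sqrt X * sqrt S2 / (2 * ln (y X))"
        proof -
          have "X / T X = sqrt X * sqrt S2 / 2"
          proof -
            have "X = sqrt X * sqrt X" using elim(5) by simp
            then have "X / T X = (sqrt X * sqrt X) / (2 * sqrt X / sqrt S2)" by (simp add: T_def)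
            also have "\<dots> = sqrt X * sqrt S2 / 2" using elim(5) S2_pos by (simp add: field_simps)
            finally show ?thesis .
          qed
          then have "X / T X / ln (y X) = sqrt X * sqrt S2 / 2 / ln (y X)" by (simp only:)
          then show ?thesis by (simp only: divide_divide_eq_left mult.commute)
        qed
        have b: "(T X)\<^sup>2 * S2 / (4 * ln (T X)) / T X = sqrt X * sqrt S2 / (2 * ln (T X))"
        proof -
          have "T X * S2 = 2 * sqrt X * sqrt S2"
          proof -
            have "S2 / sqrt S2 = sqrt S2" using S2_pos by (simp add: real_div_sqrt)
            then show ?thesis unfolding T_def by (metis times_divide_eq_left times_divide_eq_right)
          qed
          moreover have "(T X)\<^sup>2 * S2 / (4 * ln (T X)) / T X = T X * S2 / (4 * ln (T X))"
            using T0 by (simp add: power2_eq_square)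
          ultimately show ?thesis by simp
        qed
        have c: "C * ((T X)\<^sup>2 / (ln (T X))\<^sup>2) / T X = C * T X / (ln (T X))\<^sup>2"
          using T0 by (simp add: power2_eq_square)
        show ?thesis unfolding U_def add_divide_distrib a b c by simp
      qed
      also have "\<dots> \<le> main_term X + K * error_scale X" using elim(3,4) by simp
      finally show "ln (real_of_rat (delta_delta n)) \<le> main_term X + K * error_scale X" .
    qed
  qed
  from eventually_compose_filterlim[OF this ln_at_top]
  have "eventually (\<lambda>x. \<forall>n\<ge>1. real n \<le> x \<longrightarrow> delta_delta n > 0 \<longrightarrow>
     ln (real_of_rat (delta_delta n)) \<le> main_term (ln x) + K * error_scale (ln x)) at_top"
    using eventually_gt_at_top[of 1] by eventually_elim blast
  then show ?thesis using K(1) by blast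
qed

text \<open>\<open>ln (zbound X)\<close> is \<open>(ln X) / 2 + 5 * ln (ln X)\<close>; expanding its
  reciprocal yields the error scale, and the factor \<open>1 - K0 / ln X\<close> costs less than
  that.\<close>

lemma lower_bound_eventually:
  "\<exists>K>0. eventually (\<lambda>x. \<exists>n\<ge>1. real n \<le> x \<and> delta_delta n > 0 \<and>
     ln (real_of_rat (delta_delta n)) \<ge> main_term (ln x) - K * error_scale (ln x)) at_top"
proof -
  obtain K0 where K0: "eventually (\<lambda>X. \<forall>x>1. ln x = X \<longrightarrow> (\<exists>n\<ge>1. real n \<le> x \<and> delta_delta n > 0 \<and>
     ln (real_of_rat (delta_delta n)) \<ge> (1 - K0 / ln X) * (sqrt S2 * sqrt X / ln (zbound X)))) at_top"
    using lower_bound_aux by blast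
  have "(\<lambda>X. (1 - K0 / ln X) * (sqrt S2 * sqrt X / ln (zbound X)) - main_term X) \<in> O(error_scale)"
    unfolding zbound_def main_term_def[abs_def] error_scale_def[abs_def] using S2_pos by real_asymp
  then obtain K where K: "K > 0" "eventually (\<lambda>X. norm ((1 - K0 / ln X) * (sqrt S2 * sqrt X / ln (zbound X)) - main_term X) \<le> K * norm (error_scale X)) at_top"
    by (elim landau_o.bigE)
  have e3: "eventually (\<lambda>X. error_scale X \<ge> 0) at_top" unfolding error_scale_def by real_asymp
  have "eventually (\<lambda>X. \<forall>x>1. ln x = X \<longrightarrow> (\<exists>n\<ge>1. real n \<le> x \<and> delta_delta n > 0 \<and>
     ln (real_of_rat (delta_delta n)) \<ge> main_term X - K * error_scale X)) at_top"
    using K0 K(2) e3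
  proof eventually_elim
    case (elim X)
    have le: "main_term X - K * error_scale X \<le> (1 - K0 / ln X) * (sqrt S2 * sqrt X / ln (zbound X))"
      using elim(2,3) by (simp add: abs_le_iff)
    show ?case
    proof (intro allI impI)
      fix x :: real assume "x > 1" "ln x = X"
      then obtain n where "n \<ge> 1" "real n \<le> x" "delta_delta n > 0"
        "ln (real_of_rat (delta_delta n)) \<ge> (1 - K0 / ln X) * (sqrt S2 * sqrt X / ln (zbound X))"
        using elim(1) by blast
      then show "\<exists>n\<ge>1. real n \<le> x \<and> delta_delta n > 0 \<and>
         ln (real_of_rat (delta_delta n)) \<ge> main_term X - K * error_scale X"
        using le order.trans by blast
    qed
  qed
  from eventually_compose_filterlim[OF this ln_at_top]
  have "eventually (\<lambda>x. \<exists>n\<ge>1. real n \<le> x \<and> delta_delta n > 0 \<and>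
     ln (real_of_rat (delta_delta n)) \<ge> main_term (ln x) - K * error_scale (ln x)) at_top"
    using eventually_gt_at_top[of 1] by eventually_elim blast
  then show ?thesis using K(1) by blast
qed

theorem theorem2p1:
  fixes c :: real
  assumes "c = sqrt (8 * (\<Sum>l. (ln (1 + 1 / real (Suc l)))\<^sup>2))"
  shows "\<exists>E \<in> O[at_top](\<lambda>x :: real. ln (ln (ln x)) / ln (ln x)).
    \<forall>\<^sub>F x in at_top.
      Max {ln (real_of_rat (delta_delta n)) | n. n \<ge> 1 \<and> real n \<le> x \<and> delta_delta n > 0}
        = sqrt (ln x) / ln (ln x) * (c / sqrt 2 + E x)"
proof -
  define A where "A = (\<lambda>x. {ln (real_of_rat (delta_delta n)) | n. n \<ge> 1 \<and> real n \<le> x \<and> delta_delta n > 0})"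
  have "c = sqrt (8 * S2)" using assms by (simp add: S2_def lstep_def)
  also have "\<dots> = sqrt (2 * (4 * S2))" by simp
  also have "\<dots> = sqrt 2 * (sqrt 4 * sqrt S2)" by (simp only: real_sqrt_mult)
  also have "\<dots> = sqrt 2 * (2 * sqrt S2)" by simp
  finally have c: "c / sqrt 2 = 2 * sqrt S2" by simp
  obtain K1 where K1: "K1 > 0" "eventually (\<lambda>x. \<forall>n\<ge>1. real n \<le> x \<longrightarrow> delta_delta n > 0 \<longrightarrow>
     ln (real_of_rat (delta_delta n)) \<le> main_term (ln x) + K1 * error_scale (ln x)) at_top"
    using upper_bound_eventually by blast
  obtain K2 where K2: "K2 > 0" "eventually (\<lambda>x. \<exists>n\<ge>1. real n \<le> x \<and> delta_delta n > 0 \<and>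
     ln (real_of_rat (delta_delta n)) \<ge> main_term (ln x) - K2 * error_scale (ln x)) at_top"
    using lower_bound_eventually by blast
  define K where "K = max K1 K2"
  \<comment> \<open>\<open>E\<close> is obtained by solving the claimed formula for the error, so
    that the equation holds as soon as the logarithms are positive and only the size of
    \<open>E\<close> is at stake.\<close>
  define E where "E = (\<lambda>x. Max (A x) * (ln (ln x) / sqrt (ln x)) - 2 * sqrt S2)"
  have e3: "eventually (\<lambda>x. error_scale (ln x) \<ge> 0) at_top" unfolding error_scale_def by real_asymp
  have e4: "eventually (\<lambda>x::real. ln (ln x) > 0 \<and> ln x > 0) at_top"
    by (intro eventually_conj) real_asymp+
  have fin: "finite (A x)" for x
  proof (rule finite_subset)
    show "A x \<subseteq> (\<lambda>n. ln (real_of_rat (delta_delta n))) ` {..nat \<lfloor>x\<rfloor>}"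
      by (auto simp: A_def le_nat_floor)
  qed simp
  have memA: "\<exists>n\<ge>1. real n \<le> x \<and> delta_delta n > 0 \<and> a = ln (real_of_rat (delta_delta n))" if "a \<in> A x" for a x
    using that by (auto simp: A_def)
  have bound: "eventually (\<lambda>x. \<bar>Max (A x) - main_term (ln x)\<bar> \<le> K * error_scale (ln x)) at_top"
    using K1(2) K2(2) e3
  proof eventually_elim
    case (elim x)
    obtain n where n: "n \<ge> 1" "real n \<le> x" "delta_delta n > 0"
      "ln (real_of_rat (delta_delta n)) \<ge> main_term (ln x) - K2 * error_scale (ln x)" using elim(2) by blast
    \<comment> \<open>The lower bound also shows that the set is nonempty, which makes
      \<open>Max\<close> meaningful.\<close>
    have nA: "ln (real_of_rat (delta_delta n)) \<in> A x" using n by (auto simp: A_def)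
    have "main_term (ln x) - K2 * error_scale (ln x) \<le> Max (A x)"
      using Max_ge[OF fin nA] n(4) by linarith
    moreover have "Max (A x) \<in> A x" using fin nA by (intro Max_in) auto
    then obtain k where "k \<ge> 1" "real k \<le> x" "delta_delta k > 0" "Max (A x) = ln (real_of_rat (delta_delta k))"
      using memA by blast
    then have "Max (A x) \<le> main_term (ln x) + K1 * error_scale (ln x)"
      using elim(1) by simp
    moreover have "K1 * error_scale (ln x) \<le> K * error_scale (ln x)" "K2 * error_scale (ln x) \<le> K * error_scale (ln x)"
      using elim(3) by (auto simp: K_def intro!: mult_right_mono)
    ultimately show ?case unfolding abs_le_iff by linarith
  qed
  have "E \<in> O[at_top](\<lambda>x. ln (ln (ln x)) / ln (ln x))"
  proof (rule bigoI[where c = K])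
    show "eventually (\<lambda>x. norm (E x) \<le> K * norm (ln (ln (ln x)) / ln (ln x))) at_top"
      using bound e4
    proof eventually_elim
      case (elim x)
      define X where "X = ln x"
      define r where "r = ln X / sqrt X"
      have X: "X > 0" "ln X > 0" using elim by (auto simp: X_def)
      have r0: "r > 0" using X by (simp add: r_def)
      have m: "main_term X * r = 2 * sqrt S2" using X by (simp add: main_term_def r_def)
      have er: "error_scale X * r = ln (ln X) / ln X" using X by (simp add: error_scale_def r_def power2_eq_square)
      have "E x = (Max (A x) - main_term X) * r" unfolding E_def X_def[symmetric] r_def[symmetric] left_diff_distrib m by simp
      then have "\<bar>E x\<bar> = \<bar>Max (A x) - main_term X\<bar> * r" using r0 by (simp add: abs_mult)
      also have "\<dots> \<le> K * error_scale X * r" using elim(1) r0 unfolding X_def[symmetric] by (intro mult_right_mono) auto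
      also have "\<dots> = K * (ln (ln X) / ln X)" using er by (simp only: mult.assoc)
      also have "\<dots> \<le> K * \<bar>ln (ln X) / ln X\<bar>" using K1(1) by (intro mult_left_mono abs_ge_self) (auto simp: K_def)
      finally show ?case by (simp only: X_def real_norm_def)
    qed
  qed
  moreover have "\<forall>\<^sub>F x in at_top. Max (A x) = sqrt (ln x) / ln (ln x) * (c / sqrt 2 + E x)"
    using e4 unfolding c
  proof eventually_elim
    case (elim x)
    then have "ln (ln x) \<noteq> 0" "sqrt (ln x) \<noteq> 0" by auto
    moreover have "b / a * (m * (a / b)) = m" if "a \<noteq> 0" "b \<noteq> 0" for a b m :: real
      using that by simp
    ultimately have "sqrt (ln x) / ln (ln x) * (Max (A x) * (ln (ln x) / sqrt (ln x))) = Max (A x)" by blast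
    then show ?case by (simp add: E_def)
  qed
  ultimately show ?thesis unfolding A_def by (intro bexI[of _ E])
qed

end
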